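(* Let $n=1$ and $\varphi(z)=|z|^2$ on $\mathbb{C}$. The spectrum of $\square_{\varphi,0}=\overline\partial^*_\varphi\,\overline\partial$, acting on $L^2(\mathbb{C},e^{-|z|^2})$, consists of all non-negative integers $\{0,1,2,\dots\}$, each of which is an eigenvalue of infinite multiplicity; so $0$ is the bottom of the essential spectrum of $\square_{\varphi,0}$. The spectrum of $\square_{\varphi,1}=\overline\partial\,\overline\partial^*_\varphi$, acting on $L^2_{(0,1)}(\mathbb{C},e^{-|z|^2})$, consists of all positive integers $\{1,2,3,\dots\}$, each of which is an eigenvalue of infinite multiplicity.
   Context: Let $\lambda$ be Lebesgue measure on $\mathbb{C}$ and $\varphi(z)=|z|^2$. The space $L^2(\mathbb{C},e^{-\varphi})$ consists of the measurable $f:\mathbb{C}\to\mathbb{C}$ with $\int_{\mathbb{C}}|f|^2e^{-\varphi}\,d\lambda<\infty$, with inner product $(f,g)_\varphi=\int_{\mathbb{C}} f\,\overline g\,e^{-\varphi}\,d\lambda$. The space $L^2_{(0,1)}(\mathbb{C},e^{-\varphi})$ consists of forms $g\,d\overline z$ with $g\in L^2(\mathbb{C},e^{-\varphi})$, normed by $\|g\|_\varphi$. The operator $\overline\partial: L^2(\mathbb{C},e^{-\varphi})\to L^2_{(0,1)}(\mathbb{C},e^{-\varphi})$, $\overline\partial u=\frac{\partial u}{\partial\overline z}\,d\overline z$, is taken in the sense of distributions, with domain all $u$ for which $\overline\partial u$ is in $L^2_{(0,1)}(\mathbb{C},e^{-\varphi})$. Its Hilbert space adjoint is $\overline\partial^*_\varphi$,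 given by $\overline\partial^*_\varphi(g\,d\overline z)=-\frac{\partial g}{\partial z}+\overline z\,g$ (in the sense of distributions, on those $g$ for which the result is in $L^2(\mathbb{C},e^{-\varphi})$). The operators $\square_{\varphi,0}=\overline\partial^*_\varphi\,\overline\partial$ and $\square_{\varphi,1}=\overline\partial\,\overline\partial^*_\varphi$ are the non-negative self-adjoint operators with the natural composition domains; they are the closures of the corresponding operators initially defined on smooth compactly supported functions/forms. Explicitly, $\square_{\varphi,0}u=-u_{z\overline z}+\overline z\,u_{\overline z}$ and $\square_{\varphi,1}(g\,d\overline z)=(-g_{z\overline z}+\overline z\,g_{\overline z}+g)\,d\overline z$. Subscripts $z,\overline z$ denote the Wirtinger derivatives. The multiplicity of an eigenvalue is the dimension of its eigenspace. *)

theory Defs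
  imports "HOL-Analysis.Analysis"
begin

section \<open>Square-integrable functions\<close>

text \<open>
  The elements of the Hilbert space \<open>L\<^sup>2(M)\<close> are represented by functions, and functions that agree
  almost everywhere with respect to \<open>M\<close> represent the same element.  Every notion below is invariant
  under changing representatives, or states the identification explicitly by \<open>AE x in M\<close>.
\<close>

definition L2 :: "'a measure \<Rightarrow> ('a \<Rightarrow> complex) set" where
  "L2 M = {f \<in> borel_measurable M. integrable M (\<lambda>x. (cmod (f x))\<^sup>2)}"

definition L2_inner :: "'a measure \<Rightarrow> ('a \<Rightarrow> complex) \<Rightarrow> ('a \<Rightarrow> complex) \<Rightarrow> complex" where
  "L2_inner M f g = (LINT x|M. f x * cnj (g x))"

definition L2_norm :: "'a measure \<Rightarrow> ('a \<Rightarrow> complex) \<Rightarrow> real" where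
  "L2_norm M f = sqrt (LINT x|M. (cmod (f x))\<^sup>2)"


section \<open>Unbounded linear operators on \<open>L\<^sup>2\<close>\<close>

text \<open>
  An operator is given by its graph: \<open>(u, w) \<in> A\<close> means that \<open>u\<close> lies in the domain and that \<open>w\<close>
  represents the image of \<open>u\<close>.  The composition with its natural domain is then the composition of
  relations; in \<open>A O B\<close> the operator \<open>A\<close> is applied first.
\<close>

type_synonym 'a L2_operator = "(('a \<Rightarrow> complex) \<times> ('a \<Rightarrow> complex)) set"

definition L2_adjoint :: "'a measure \<Rightarrow> 'a L2_operator \<Rightarrow> 'a L2_operator" where
  "L2_adjoint M A =
     {(g, h). g \<in> L2 M \<and> h \<in> L2 M \<and> (\<forall>(u, w)\<in>A. L2_inner M w g = L2_inner M u h)}"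

text \<open>
  The three conditions: \<open>A - z\<close> maps the domain of \<open>A\<close> onto \<open>L\<^sup>2(M)\<close>, it is injective, and its inverse
  is bounded.
\<close>

definition resolvent_set :: "'a measure \<Rightarrow> 'a L2_operator \<Rightarrow> complex set" where
  "resolvent_set M A = {z.
     (\<forall>f\<in>L2 M. \<exists>(u, w)\<in>A. AE x in M. w x - z * u x = f x) \<and>
     (\<forall>(u, w)\<in>A. (AE x in M. w x - z * u x = 0) \<longrightarrow> (AE x in M. u x = 0)) \<and>
     (\<exists>C. \<forall>(u, w)\<in>A. L2_norm M u \<le> C * L2_norm M (\<lambda>x. w x - z * u x))}"

definition spectrum :: "'a measure \<Rightarrow> 'a L2_operator \<Rightarrow> complex set" where
  "spectrum M A = - resolvent_set M A"

definition eigenspace :: "'a measure \<Rightarrow> 'a L2_operator \<Rightarrow> complex \<Rightarrow> ('a \<Rightarrow> complex) set" where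
  "eigenspace M A z = {u. \<exists>w. (u, w) \<in> A \<and> (AE x in M. w x = z * u x)}"

definition is_eigenvalue :: "'a measure \<Rightarrow> 'a L2_operator \<Rightarrow> complex \<Rightarrow> bool" where
  "is_eigenvalue M A z \<longleftrightarrow> (\<exists>u\<in>eigenspace M A z. \<not> (AE x in M. u x = 0))"

definition AE_independent :: "'a measure \<Rightarrow> ('a \<Rightarrow> complex) set \<Rightarrow> bool" where
  "AE_independent M B \<longleftrightarrow>
     (\<forall>c. (AE x in M. (\<Sum>b\<in>B. c b * b x) = 0) \<longrightarrow> (\<forall>b\<in>B. c b = 0))"

text \<open>
  The complex dimension, modulo functions vanishing almost everywhere, of a linear space of functions;
  it is \<open>\<infinity>\<close> if there are arbitrarily large finite independent subsets.
\<close>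

definition AE_dim :: "'a measure \<Rightarrow> ('a \<Rightarrow> complex) set \<Rightarrow> enat" where
  "AE_dim M E = (SUP B\<in>{B. finite B \<and> B \<subseteq> E \<and> AE_independent M B}. enat (card B))"

definition eigenvalue_multiplicity :: "'a measure \<Rightarrow> 'a L2_operator \<Rightarrow> complex \<Rightarrow> enat" where
  "eigenvalue_multiplicity M A z = AE_dim M (eigenspace M A z)"

text \<open>
  For self-adjoint operators: the essential spectrum is the complement in the spectrum of the
  discrete spectrum, the latter being the isolated points of the spectrum that are eigenvalues of
  finite multiplicity.
\<close>

definition discrete_spectrum :: "'a measure \<Rightarrow> 'a L2_operator \<Rightarrow> complex set" where
  "discrete_spectrum M A =
     {z \<in> spectrum M A. \<not> z islimpt spectrum M A \<and>
        is_eigenvalue M A z \<and> eigenvalue_multiplicity M A z < \<infinity>}"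

definition essential_spectrum :: "'a measure \<Rightarrow> 'a L2_operator \<Rightarrow> complex set" where
  "essential_spectrum M A = spectrum M A - discrete_spectrum M A"


section \<open>The distributional Cauchy-Riemann operator\<close>

text \<open>
  Functions on \<open>\<complex>\<close> that are \<open>k\<close> times continuously differentiable in the real sense; the values
  of the Frechet derivative at \<open>1\<close> and \<open>\<i>\<close> are the partial derivatives in \<open>x\<close> and \<open>y\<close>.
\<close>

primrec times_cont_diff :: "nat \<Rightarrow> (complex \<Rightarrow> complex) \<Rightarrow> bool" where
  "times_cont_diff 0 f \<longleftrightarrow> continuous_on UNIV f"
| "times_cont_diff (Suc k) f \<longleftrightarrow>
     (\<forall>z. f differentiable (at z)) \<and>
     times_cont_diff k (\<lambda>z. frechet_derivative f (at z) 1) \<and>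
     times_cont_diff k (\<lambda>z. frechet_derivative f (at z) \<i>)"

definition test_function :: "(complex \<Rightarrow> complex) \<Rightarrow> bool" where
  "test_function \<psi> \<longleftrightarrow> (\<forall>k. times_cont_diff k \<psi>) \<and> compact (closure {z. \<psi> z \<noteq> 0})"

definition d_zbar :: "(complex \<Rightarrow> complex) \<Rightarrow> complex \<Rightarrow> complex" where
  "d_zbar f z = (frechet_derivative f (at z) 1 + \<i> * frechet_derivative f (at z) \<i>) / 2"

definition locally_integrable :: "(complex \<Rightarrow> complex) \<Rightarrow> bool" where
  "locally_integrable f \<longleftrightarrow> (\<forall>K. compact K \<longrightarrow> f absolutely_integrable_on K)"

definition weak_d_zbar :: "(complex \<Rightarrow> complex) \<Rightarrow> (complex \<Rightarrow> complex) \<Rightarrow> bool" where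
  "weak_d_zbar u v \<longleftrightarrow> locally_integrable u \<and> locally_integrable v \<and>
     (\<forall>\<psi>. test_function \<psi> \<longrightarrow>
        (LINT z|lebesgue. u z * d_zbar \<psi> z) = - (LINT z|lebesgue. v z * \<psi> z))"


section \<open>The complex Laplacians\<close>

definition weighted_measure :: "(complex \<Rightarrow> real) \<Rightarrow> complex measure" where
  "weighted_measure \<phi> = density lebesgue (\<lambda>z. ennreal (exp (- \<phi> z)))"

text \<open>
  A \<open>(0,1)\<close>-form \<open>g d\<zeta>\<close>, where \<open>\<zeta>\<close> is the conjugate coordinate, is represented by its coefficient \<open>g\<close>;
  its norm is by definition that of \<open>g\<close>, so both Hilbert spaces are \<open>L2 (weighted_measure \<phi>)\<close>.
\<close>

definition dbar :: "(complex \<Rightarrow> real) \<Rightarrow> complex L2_operator" where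
  "dbar \<phi> = {(u, v). u \<in> L2 (weighted_measure \<phi>) \<and> v \<in> L2 (weighted_measure \<phi>) \<and> weak_d_zbar u v}"

definition dbar_adjoint :: "(complex \<Rightarrow> real) \<Rightarrow> complex L2_operator" where
  "dbar_adjoint \<phi> = L2_adjoint (weighted_measure \<phi>) (dbar \<phi>)"

definition box0 :: "(complex \<Rightarrow> real) \<Rightarrow> complex L2_operator" where
  "box0 \<phi> = dbar \<phi> O dbar_adjoint \<phi>"

definition box1 :: "(complex \<Rightarrow> real) \<Rightarrow> complex L2_operator" where
  "box1 \<phi> = dbar_adjoint \<phi> O dbar \<phi>"

end

theory Submission
  imports Defs "HOL-Computational_Algebra.Polynomial" "HOL-Probability.Distributions"
begin

text \<open>
  Write \<open>D\<close> for \<open>d/dzbar\<close> and \<open>D* = - d/dz + zbar\<close> for its formal adjoint with respect to the Gaussian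
  weight.  They satisfy the commutation relation \<open>D D* - D* D = 1\<close> of the harmonic oscillator.
  Since \<open>D z\<^sup>m = 0\<close>, the complex Hermite polynomials \<open>h\<^sub>m\<^sub>,\<^sub>k = (D*)\<^sup>k z\<^sup>m\<close> form ladders
  \<open>D h\<^sub>m\<^sub>,\<^sub>k = k h\<^sub>m\<^sub>,\<^sub>k\<^sub>-\<^sub>1\<close> and \<open>D* h\<^sub>m\<^sub>,\<^sub>k = h\<^sub>m\<^sub>,\<^sub>k\<^sub>+\<^sub>1\<close>, whence \<open>D* D h\<^sub>m\<^sub>,\<^sub>k = k h\<^sub>m\<^sub>,\<^sub>k\<close> and
  \<open>D D* h\<^sub>m\<^sub>,\<^sub>k = (k + 1) h\<^sub>m\<^sub>,\<^sub>k\<close>.  They are orthogonal and complete in \<open>L\<^sup>2\<close>.  So \<open>D* D\<close> and \<open>D D*\<close> are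
  diagonal in one orthonormal basis, with eigenvalues \<open>k\<close> and \<open>k + 1\<close>, each repeated for all
  \<open>m = 0, 1, 2, ...\<close>; the spectrum of a diagonal operator is the closure of the set of its diagonal
  entries (\<open>spectrum_diagonal\<close>).

  The formal computation says nothing about domains: the operators are given by weak derivatives,
  by a Hilbert space adjoint and by composition.  The substance of the proof is that
  these operators are exactly the diagonal ones, on exactly the expected domains.

  \<^item> If \<open>v\<close> is the weak derivative of \<open>u\<close>, then the Hermite coefficients of \<open>v\<close> are shifted coefficients of \<open>u\<close>.
    This amounts to using \<open>cnj q exp (- |z|\<^sup>2)\<close> as a test function, with \<open>q\<close> a polynomial, and is justified by
    smooth cutoffs (\<open>weak_d_zbar_inner\<close>).  Applied to polynomials \<open>u\<close>, it also yields
    the orthogonality relations (\<open>hermite_inner\<close>).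

  \<^item> Completeness (\<open>orthogonal_to_polynomials_AE_0\<close>): if \<open>f\<close> is orthogonal to all polynomials, then so is
    \<open>f\<close> times a Gaussian in one real coordinate, by expanding the Gaussian into a power series; hence, by the
    Weierstrass theorem, so is \<open>f\<close> times any continuous function of that Gaussian, and in the limit \<open>f\<close>
    restricted to a strip.  Intersecting two strips shows that \<open>f exp (- |z|\<^sup>2)\<close> integrates to zero over all squares.

  \<^item> By Parseval's identity, the relation between the coefficients conversely implies that \<open>v\<close> is the weak
    derivative of \<open>u\<close>, and it determines the adjoint in the same way (\<open>ladder_pairing\<close>, \<open>dbar_iff_coeff\<close>,
    \<open>dbar_adjoint_iff_coeff\<close>).

  \<^item> For the compositions, the intermediate function is built from its coefficients by the Riesz-Fischer
    theorem (\<open>box0_diagonal\<close>, \<open>box1_diagonal\<close>).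
\<close>

section \<open>The space of square-integrable functions\<close>

lemma L2_measurable [measurable_dest]: "f \<in> L2 M \<Longrightarrow> f \<in> borel_measurable M"
  by (simp add: L2_def)

lemma borel_measurable_cnj [measurable (raw)]:
  "f \<in> borel_measurable M \<Longrightarrow> (\<lambda>x. cnj (f x)) \<in> borel_measurable M"
  by (rule measurable_compose[OF _ borel_measurable_continuous_onI]) (auto intro: continuous_intros)

lemma L2_integrable_square: "f \<in> L2 M \<Longrightarrow> integrable M (\<lambda>x. (cmod (f x))\<^sup>2)"
  by (simp add: L2_def)

lemma L2_integrable_inner:
  assumes f: "f \<in> L2 M" and g: "g \<in> L2 M"
  shows "integrable M (\<lambda>x. f x * cnj (g x))"
proof (rule Bochner_Integration.integrable_bound)
  show "integrable M (\<lambda>x. (cmod (f x))\<^sup>2 + (cmod (g x))\<^sup>2)"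
    using f g by (auto simp: L2_def)
  show "(\<lambda>x. f x * cnj (g x)) \<in> borel_measurable M"
    using L2_measurable[OF f] L2_measurable[OF g] by measurable
  have "a * b \<le> a\<^sup>2 + b\<^sup>2" if "a \<ge> 0" "b \<ge> 0" for a b :: real
    using sum_squares_bound[of a b] that by (simp add: mult.assoc) (smt (verit) mult_nonneg_nonneg)
  then show "AE x in M. norm (f x * cnj (g x)) \<le> norm ((cmod (f x))\<^sup>2 + (cmod (g x))\<^sup>2)"
    by (simp add: norm_mult)
qed

lemma L2_scale: "f \<in> L2 M \<Longrightarrow> (\<lambda>x. c * f x) \<in> L2 M"
  by (auto simp: L2_def norm_mult power_mult_distrib)

lemma cmod_add_square_le: "(cmod (a + b))\<^sup>2 \<le> 2 * (cmod a)\<^sup>2 + 2 * (cmod b)\<^sup>2"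
proof -
  have "(cmod (a + b))\<^sup>2 \<le> (cmod a + cmod b)\<^sup>2"
    by (simp add: norm_triangle_ineq power_mono)
  also have "\<dots> \<le> 2 * (cmod a)\<^sup>2 + 2 * (cmod b)\<^sup>2"
    using sum_squares_bound[of "cmod a" "cmod b"] by (simp add: power2_sum)
  finally show ?thesis .
qed

lemma L2_add:
  assumes f: "f \<in> L2 M" and g: "g \<in> L2 M"
  shows "(\<lambda>x. f x + g x) \<in> L2 M"
proof -
  have "integrable M (\<lambda>x. (cmod (f x + g x))\<^sup>2)"
  proof (rule Bochner_Integration.integrable_bound)
    show "integrable M (\<lambda>x. 2 * (cmod (f x))\<^sup>2 + 2 * (cmod (g x))\<^sup>2)"
      using f g by (auto simp: L2_def)
    show "(\<lambda>x. (cmod (f x + g x))\<^sup>2) \<in> borel_measurable M"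
      using L2_measurable[OF f] L2_measurable[OF g] by measurable
  qed (simp add: cmod_add_square_le)
  then show ?thesis using f g by (auto simp: L2_def)
qed

lemma L2_diff: "f \<in> L2 M \<Longrightarrow> g \<in> L2 M \<Longrightarrow> (\<lambda>x. f x - g x) \<in> L2 M"
  using L2_add[of f M "\<lambda>x. (-1) * g x"] L2_scale[of g M "-1"] by simp

lemma L2_zero: "(\<lambda>x. 0) \<in> L2 M"
  by (simp add: L2_def)

lemma L2_sum: "(\<And>i. i \<in> I \<Longrightarrow> f i \<in> L2 M) \<Longrightarrow> (\<lambda>x. \<Sum>i\<in>I. f i x) \<in> L2 M"
  by (induction I rule: infinite_finite_induct) (auto intro: L2_add L2_zero)

lemma L2_bounded_mult:
  assumes f: "f \<in> L2 M" and g: "g \<in> borel_measurable M" and b: "\<And>x. cmod (g x) \<le> B"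
  shows "(\<lambda>x. g x * f x) \<in> L2 M"
proof -
  have "integrable M (\<lambda>x. (cmod (g x * f x))\<^sup>2)"
  proof (rule Bochner_Integration.integrable_bound)
    show "integrable M (\<lambda>x. B\<^sup>2 * (cmod (f x))\<^sup>2)" using f by (auto simp: L2_def)
    show "(\<lambda>x. (cmod (g x * f x))\<^sup>2) \<in> borel_measurable M"
      using L2_measurable[OF f] g by measurable
  qed (simp add: norm_mult power_mult_distrib mult_right_mono b power_mono)
  then show ?thesis using f g by (auto simp: L2_def)
qed

lemma L2_inner_add_left:
  "f \<in> L2 M \<Longrightarrow> g \<in> L2 M \<Longrightarrow> h \<in> L2 M \<Longrightarrow>
    L2_inner M (\<lambda>x. f x + g x) h = L2_inner M f h + L2_inner M g h"
  by (simp add: L2_inner_def ring_distribs L2_integrable_inner)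

lemma L2_inner_scale_left: "L2_inner M (\<lambda>x. c * f x) h = c * L2_inner M f h"
  by (simp add: L2_inner_def mult.assoc)

lemma L2_inner_diff_left:
  "f \<in> L2 M \<Longrightarrow> g \<in> L2 M \<Longrightarrow> h \<in> L2 M \<Longrightarrow>
    L2_inner M (\<lambda>x. f x - g x) h = L2_inner M f h - L2_inner M g h"
  by (simp add: L2_inner_def ring_distribs L2_integrable_inner)

lemma L2_inner_sum_left:
  "(\<And>i. i \<in> I \<Longrightarrow> f i \<in> L2 M) \<Longrightarrow> h \<in> L2 M \<Longrightarrow>
    L2_inner M (\<lambda>x. \<Sum>i\<in>I. f i x) h = (\<Sum>i\<in>I. L2_inner M (f i) h)"
proof (induction I rule: infinite_finite_induct)
  case (insert i I)
  then show ?case using L2_inner_add_left[of "f i" M "\<lambda>x. \<Sum>i\<in>I. f i x" h]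
    by (auto intro: L2_sum)
qed (auto simp: L2_inner_def)

lemma L2_inner_commute: "L2_inner M g f = cnj (L2_inner M f g)"
  unfolding L2_inner_def Bochner_Integration.integral_cnj[symmetric]
  by (rule Bochner_Integration.integral_cong) simp_all

lemma L2_inner_scale_right: "L2_inner M f (\<lambda>x. c * h x) = cnj c * L2_inner M f h"
proof -
  have "L2_inner M f (\<lambda>x. c * h x) = cnj (L2_inner M (\<lambda>x. c * h x) f)" by (rule L2_inner_commute)
  also have "\<dots> = cnj c * cnj (L2_inner M h f)" by (simp add: L2_inner_scale_left)
  also have "cnj (L2_inner M h f) = L2_inner M f h" by (rule L2_inner_commute[symmetric])
  finally show ?thesis .
qed

lemma L2_inner_cong_AE:
  "f \<in> L2 M \<Longrightarrow> f' \<in> L2 M \<Longrightarrow> g \<in> L2 M \<Longrightarrow> AE x in M. f x = f' x \<Longrightarrow>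
    L2_inner M f g = L2_inner M f' g"
  unfolding L2_inner_def by (rule integral_cong_AE) (auto dest!: L2_measurable)

lemma L2_inner_self: "L2_inner M f f = of_real ((L2_norm M f)\<^sup>2)"
  unfolding L2_inner_def L2_norm_def
  by (simp add: complex_norm_square[symmetric] del: of_real_power)

lemma L2_norm_square: "(L2_norm M f)\<^sup>2 = (LINT x|M. (cmod (f x))\<^sup>2)"
  by (simp add: L2_norm_def)

lemma L2_norm_nonneg: "0 \<le> L2_norm M f"
  by (simp add: L2_norm_def)

lemma L2_norm_eq_0_iff: "f \<in> L2 M \<Longrightarrow> L2_norm M f = 0 \<longleftrightarrow> (AE x in M. f x = 0)"
  by (simp add: L2_norm_def L2_integrable_square integral_nonneg_eq_0_iff_AE)

text \<open>
  Integrating \<open>0 \<le> (|f| - t |g|)\<^sup>2\<close> bounds the integral of \<open>|f| |g|\<close> for every real \<open>t\<close>; the best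
  choice of \<open>t\<close> is the quotient of the two norms.
\<close>

lemma L2_Cauchy_Schwarz:
  assumes f: "f \<in> L2 M" and g: "g \<in> L2 M"
  shows "cmod (L2_inner M f g) \<le> L2_norm M f * L2_norm M g"
proof -
  have "cmod (L2_inner M f g) \<le> (LINT x|M. cmod (f x) * cmod (g x))"
    unfolding L2_inner_def by (rule integral_norm_bound[THEN order_trans]) (simp add: norm_mult)
  define I where "I = (LINT x|M. cmod (f x) * cmod (g x))"
  have int: "integrable M (\<lambda>x. cmod (f x) * cmod (g x))"
    using integrable_norm[OF L2_integrable_inner[OF f g]] by (simp add: norm_mult)
  have quad: "2 * t * I \<le> (L2_norm M f)\<^sup>2 + t\<^sup>2 * (L2_norm M g)\<^sup>2" for t
  proof -
    have "(LINT x|M. 2 * t * (cmod (f x) * cmod (g x)))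
      \<le> (LINT x|M. (cmod (f x))\<^sup>2 + t\<^sup>2 * (cmod (g x))\<^sup>2)"
    proof (rule integral_mono)
      show "2 * t * (cmod (f x) * cmod (g x)) \<le> (cmod (f x))\<^sup>2 + t\<^sup>2 * (cmod (g x))\<^sup>2" for x
        using sum_squares_bound[of "cmod (f x)" "t * cmod (g x)"]
        by (simp add: power_mult_distrib mult_ac)
    qed (use int L2_integrable_square[OF f] L2_integrable_square[OF g] in auto)
    then show ?thesis
      using L2_integrable_square[OF f] L2_integrable_square[OF g] 
      by (simp add: I_def L2_norm_square)
  qed
  have "I \<le> L2_norm M f * L2_norm M g"
  proof (cases "L2_norm M f = 0 \<or> L2_norm M g = 0")
    case True
    then have "(AE x in M. f x = 0) \<or> (AE x in M. g x = 0)" using f g L2_norm_eq_0_iff by blast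
    then have "AE x in M. cmod (f x) * cmod (g x) = 0" by auto
    then have "I = 0" unfolding I_def by (rule integral_eq_zero_AE)
    then show ?thesis by (simp add: L2_norm_nonneg)
  next
    case False
    then have pos: "L2_norm M f > 0" "L2_norm M g > 0"
      using L2_norm_nonneg[of M f] L2_norm_nonneg[of M g] by auto
    have "L2_norm M f * I \<le> L2_norm M f * (L2_norm M f * L2_norm M g)"
      using quad[of "L2_norm M f / L2_norm M g"] pos by (simp add: power_divide field_simps power2_eq_square)
    then show ?thesis using pos by (simp only: mult_le_cancel_left_pos)
  qed
  then show ?thesis using \<open>cmod (L2_inner M f g) \<le> _\<close> by (simp add: I_def)
qed

text \<open>
  Along a subsequence whose increments \<open>d\<^sub>j\<close> have norms at most \<open>4\<^sup>-\<^sup>j\<close>, the series of \<open>4\<^sup>j |d\<^sub>j|\<^sup>2\<close>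
  has a finite integral.  Its terms therefore tend to zero almost everywhere, which makes
  \<open>|d\<^sub>j|\<close> eventually smaller than \<open>2\<^sup>-\<^sup>j\<close> and the subsequence pointwise convergent.  Fatou's lemma turns the
  pointwise limit into a limit in norm.
\<close>

lemma L2_complete:
  assumes s: "\<And>n. s n \<in> L2 M"
    and Cauchy: "\<And>\<epsilon>. \<epsilon> > 0 \<Longrightarrow> \<exists>N. \<forall>m\<ge>N. \<forall>n\<ge>N. L2_norm M (\<lambda>x. s m x - s n x) < \<epsilon>"
  shows "\<exists>f\<in>L2 M. (\<lambda>n. L2_norm M (\<lambda>x. s n x - f x)) \<longlonglongrightarrow> 0"
proof -
  have meas [measurable]: "s n \<in> borel_measurable M" for n using s by (rule L2_measurable)
  have "\<exists>N. \<forall>m\<ge>N. \<forall>n\<ge>N. L2_norm M (\<lambda>x. s m x - s n x) < (1/4) ^ j" for j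
    by (rule Cauchy) simp
  then obtain N where N: "\<And>j m n. m \<ge> N j \<Longrightarrow> n \<ge> N j \<Longrightarrow> L2_norm M (\<lambda>x. s m x - s n x) < (1/4) ^ j"
    by metis
  \<comment> \<open>The sum makes \<open>r\<close> monotone, the summand \<open>j\<close> makes it unbounded.\<close>
  define r where "r j = (\<Sum>i\<le>j. N i) + j" for j
  have r_N: "r j \<ge> N j" for j unfolding r_def by (simp add: member_le_sum trans_le_add1)
  have r_mono: "r i \<le> r j" if "i \<le> j" for i j
    unfolding r_def using that by (intro add_mono sum_mono2) auto
  have r_ge: "r j \<ge> j" for j by (simp add: r_def)
  define d where "d j x = s (r (Suc j)) x - s (r j) x" for j x
  have dL2: "d j \<in> L2 M" for j unfolding d_def by (intro L2_diff s)
  have [measurable]: "d j \<in> borel_measurable M" for j using dL2 by (rule L2_measurable)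
  have d_bound: "(LINT x|M. (cmod (d j x))\<^sup>2) \<le> (1/16) ^ j" for j
  proof -
    have "L2_norm M (d j) < (1/4)^j"
      unfolding d_def using r_N[of j] r_mono[of j "Suc j"] by (intro N) auto
    then have "(L2_norm M (d j))\<^sup>2 \<le> ((1/4)^j)\<^sup>2"
      by (intro power_mono) (auto simp: L2_norm_nonneg)
    also have "\<dots> = (1/16)^j" by (simp add: power_mult[symmetric] power_divide mult.commute[of j 2] power_mult)
    finally show ?thesis by (simp add: L2_norm_square)
  qed
  have "AE x in M. (\<Sum>j. ennreal (4 ^ j * (cmod (d j x))\<^sup>2)) \<noteq> \<infinity>"
  proof (rule nn_integral_noteq_infinite)
    have "(\<integral>\<^sup>+ x. (\<Sum>j. ennreal (4 ^ j * (cmod (d j x))\<^sup>2)) \<partial>M)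
       = (\<Sum>j. \<integral>\<^sup>+ x. ennreal (4 ^ j * (cmod (d j x))\<^sup>2) \<partial>M)"
      by (rule nn_integral_suminf) measurable
    also have "\<dots> \<le> (\<Sum>j. ennreal ((1/4) ^ j))"
    proof (rule suminf_le)
      fix j
      have "(\<integral>\<^sup>+ x. ennreal (4 ^ j * (cmod (d j x))\<^sup>2) \<partial>M) = ennreal (4 ^ j * (LINT x|M. (cmod (d j x))\<^sup>2))"
        using L2_integrable_square[OF dL2[of j]] by (subst nn_integral_eq_integral) auto
      also have "\<dots> \<le> ennreal (4 ^ j * (1/16) ^ j)"
        using d_bound[of j] by (intro ennreal_leI mult_left_mono) auto
      also have "\<dots> = ennreal ((1/4) ^ j)" by (simp add: power_mult_distrib[symmetric])
      finally show "(\<integral>\<^sup>+ x. ennreal (4 ^ j * (cmod (d j x))\<^sup>2) \<partial>M) \<le> ennreal ((1/4) ^ j)" .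
    qed auto
    also have "\<dots> = ennreal (\<Sum>j. (1/4) ^ j)"
      by (rule suminf_ennreal2) (auto intro: summable_geometric)
    also have "\<dots> < \<infinity>" by simp
    finally show "(\<integral>\<^sup>+ x. (\<Sum>j. ennreal (4 ^ j * (cmod (d j x))\<^sup>2)) \<partial>M) \<noteq> \<infinity>" by simp
  qed measurable
  then have conv: "AE x in M. convergent (\<lambda>j. s (r j) x)"
  proof eventually_elim
    case (elim x)
    have "summable (\<lambda>j. 4 ^ j * (cmod (d j x))\<^sup>2)"
      by (rule summable_suminf_not_top) (use elim in auto)
    then have "(\<lambda>j. 4 ^ j * (cmod (d j x))\<^sup>2) \<longlonglongrightarrow> 0" by (rule summable_LIMSEQ_zero)
    then have "\<forall>\<^sub>F j in sequentially. 4 ^ j * (cmod (d j x))\<^sup>2 < 1"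
      by (rule order_tendstoD) simp
    then have "\<forall>\<^sub>F j in sequentially. norm (d j x) \<le> (1/2) ^ j"
    proof eventually_elim
      case (elim j)
      have "(2 ^ j * cmod (d j x))\<^sup>2 < 1\<^sup>2"
        using elim by (simp add: power_mult_distrib power_mult[symmetric] mult.commute[of j 2])
          (simp add: power_mult)
      then have "2 ^ j * cmod (d j x) < 1" by (rule power2_less_imp_less) simp
      then show ?case by (simp add: power_divide field_simps)
    qed
    then have "summable (\<lambda>j. d j x)"
      by (rule summable_comparison_test_ev) (auto intro: summable_geometric)
    then have "convergent (\<lambda>n. \<Sum>j<n. d j x)" by (rule summable_iff_convergent[THEN iffD1])
    moreover have "(\<Sum>j<n. d j x) = s (r n) x - s (r 0) x" for n
      unfolding d_def by (rule sum_lessThan_telescope)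
    ultimately have "convergent (\<lambda>n. s (r n) x - s (r 0) x)" by simp
    then have "convergent (\<lambda>n. (s (r n) x - s (r 0) x) + s (r 0) x)"
      by (rule convergent_add) (rule convergent_const)
    then show ?case by simp
  qed
  define f where "f x = lim (\<lambda>j. s (r j) x)" for x
  have f_meas [measurable]: "f \<in> borel_measurable M"
    unfolding f_def by (intro borel_measurable_lim_metric) measurable
  have lim: "AE x in M. (\<lambda>j. s (r j) x) \<longlonglongrightarrow> f x"
    using conv by eventually_elim (auto simp: f_def convergent_LIMSEQ_iff)
  have fatou: "(\<integral>\<^sup>+ x. ennreal ((cmod (s n x - f x))\<^sup>2) \<partial>M) \<le> ennreal (((1/4)^k)\<^sup>2)" if "n \<ge> N k" for n k
  proof -
    have "(\<integral>\<^sup>+ x. ennreal ((cmod (s n x - f x))\<^sup>2) \<partial>M)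
      = (\<integral>\<^sup>+ x. liminf (\<lambda>j. ennreal ((cmod (s n x - s (r j) x))\<^sup>2)) \<partial>M)"
    proof (rule nn_integral_cong_AE)
      show "AE x in M. ennreal ((cmod (s n x - f x))\<^sup>2) = liminf (\<lambda>j. ennreal ((cmod (s n x - s (r j) x))\<^sup>2))"
        using lim
      proof eventually_elim
        case (elim x)
        have "(\<lambda>j. ennreal ((cmod (s n x - s (r j) x))\<^sup>2)) \<longlonglongrightarrow> ennreal ((cmod (s n x - f x))\<^sup>2)"
          by (intro tendsto_intros elim)
        then show ?case by (rule lim_imp_Liminf[symmetric, OF trivial_limit_sequentially])
      qed
    qed
    also have "\<dots> \<le> liminf (\<lambda>j. \<integral>\<^sup>+ x. ennreal ((cmod (s n x - s (r j) x))\<^sup>2) \<partial>M)"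
      by (rule nn_integral_liminf) measurable
    also have "\<dots> \<le> ennreal (((1/4)^k)\<^sup>2)"
    proof (rule Liminf_le)
      show "\<forall>\<^sub>F j in sequentially. (\<integral>\<^sup>+ x. ennreal ((cmod (s n x - s (r j) x))\<^sup>2) \<partial>M) \<le> ennreal (((1/4)^k)\<^sup>2)"
        using eventually_ge_at_top[of "N k"]
      proof eventually_elim
        case (elim j)
        have "L2_norm M (\<lambda>x. s n x - s (r j) x) < (1/4)^k"
          using that elim r_ge[of j] by (intro N) auto
        then have "(L2_norm M (\<lambda>x. s n x - s (r j) x))\<^sup>2 \<le> ((1/4)^k)\<^sup>2"
          by (intro power_mono) (auto simp: L2_norm_nonneg)
        then show ?case
          using L2_integrable_square[OF L2_diff[OF s s]]
          by (subst nn_integral_eq_integral) (auto simp: L2_norm_square intro: ennreal_leI)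
      qed
    qed simp
    finally show ?thesis .
  qed
  have diffL2: "(\<lambda>x. s n x - f x) \<in> L2 M" if "n \<ge> N k" for n k
  proof -
    have "integrable M (\<lambda>x. (cmod (s n x - f x))\<^sup>2)"
      by (rule integrableI_bounded)
        (use fatou[OF that] in \<open>auto simp: le_less_trans[OF _ ennreal_less_top]\<close>)
    then show ?thesis by (simp add: L2_def)
  qed
  have "f \<in> L2 M"
    using L2_diff[OF s diffL2[OF order_refl], of "N 0" 0] by simp
  moreover have "(\<lambda>n. L2_norm M (\<lambda>x. s n x - f x)) \<longlonglongrightarrow> 0"
  proof (rule LIMSEQ_I)
    fix \<epsilon> :: real assume "\<epsilon> > 0"
    then obtain k where k: "(1/4)^k < \<epsilon>" using real_arch_pow_inv[of \<epsilon> "1/4"] by auto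
    have "norm (L2_norm M (\<lambda>x. s n x - f x) - 0) < \<epsilon>" if "n \<ge> N k" for n
    proof -
      have "ennreal ((L2_norm M (\<lambda>x. s n x - f x))\<^sup>2) \<le> ennreal (((1/4)^k)\<^sup>2)"
        using fatou[OF that] L2_integrable_square[OF diffL2[OF that]]
        by (subst (asm) nn_integral_eq_integral) (auto simp: L2_norm_square)
      then have "(L2_norm M (\<lambda>x. s n x - f x))\<^sup>2 \<le> ((1/4)^k)\<^sup>2"
        by (subst (asm) ennreal_le_iff) auto
      then have "L2_norm M (\<lambda>x. s n x - f x) \<le> (1/4)^k"
        by (rule power2_le_imp_le) simp
      then show ?thesis using k L2_norm_nonneg[of M "\<lambda>x. s n x - f x"] by simp
    qed
    then show "\<exists>no. \<forall>n\<ge>no. norm (L2_norm M (\<lambda>x. s n x - f x) - 0) < \<epsilon>" by blast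
  qed
  ultimately show ?thesis by blast
qed

section \<open>Orthonormal bases and diagonal operators\<close>

text \<open>
  The index type is countable so that the basis can be exhausted by an increasing sequence of finite
  sets; the Hermite functions will be indexed by pairs of natural numbers.
\<close>

locale orthonormal_basis =
  fixes M :: "'a measure" and b :: "'i :: countable \<Rightarrow> 'a \<Rightarrow> complex"
  assumes basis_L2: "b i \<in> L2 M"
    and orthonormal: "L2_inner M (b i) (b j) = (if i = j then 1 else 0)"
    and total: "f \<in> L2 M \<Longrightarrow> (\<And>i. L2_inner M f (b i) = 0) \<Longrightarrow> AE x in M. f x = 0"
begin

lemma combination_L2: "(\<lambda>x. \<Sum>i\<in>I. c i * b i x) \<in> L2 M"
  by (intro L2_sum L2_scale basis_L2)

lemma combination_inner:
  "g \<in> L2 M \<Longrightarrow> L2_inner M (\<lambda>x. \<Sum>i\<in>I. c i * b i x) g = (\<Sum>i\<in>I. c i * L2_inner M (b i) g)"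
  by (subst L2_inner_sum_left) (auto simp: L2_inner_scale_left intro: L2_scale basis_L2)

lemma combination_coeff:
  "finite I \<Longrightarrow> L2_inner M (\<lambda>x. \<Sum>i\<in>I. c i * b i x) (b j) = (if j \<in> I then c j else 0)"
  by (simp add: combination_inner basis_L2 orthonormal if_distrib sum.delta cong: if_cong)

lemma combination_norm:
  assumes "finite I"
  shows "(L2_norm M (\<lambda>x. \<Sum>i\<in>I. c i * b i x))\<^sup>2 = (\<Sum>i\<in>I. (cmod (c i))\<^sup>2)"
proof -
  let ?s = "\<lambda>x. \<Sum>i\<in>I. c i * b i x"
  have "complex_of_real ((L2_norm M ?s)\<^sup>2) = (\<Sum>i\<in>I. c i * L2_inner M (b i) ?s)"
    by (simp add: L2_inner_self[symmetric] combination_inner combination_L2 del: of_real_power)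
  also have "\<dots> = (\<Sum>i\<in>I. c i * cnj (c i))"
    using assms by (intro sum.cong refl, subst L2_inner_commute) (simp add: combination_coeff)
  also have "\<dots> = complex_of_real (\<Sum>i\<in>I. (cmod (c i))\<^sup>2)"
    by (simp add: complex_norm_square[symmetric] del: of_real_power)
  finally show ?thesis using of_real_eq_iff by blast
qed

text \<open>
  The inner product of \<open>f\<close> with its partial expansion is the sum \<open>S\<close> on the left, and the partial
  expansion has norm \<open>sqrt S\<close>.  So by Cauchy-Schwarz, \<open>S\<close> is at most \<open>sqrt S\<close> times the norm of \<open>f\<close>.
\<close>

lemma Bessel_inequality:
  assumes f: "f \<in> L2 M" and I: "finite I"
  shows "(\<Sum>i\<in>I. (cmod (L2_inner M f (b i)))\<^sup>2) \<le> (L2_norm M f)\<^sup>2"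
proof -
  let ?S = "\<Sum>i\<in>I. (cmod (L2_inner M f (b i)))\<^sup>2"
  let ?s = "\<lambda>x. \<Sum>i\<in>I. L2_inner M f (b i) * b i x"
  have fs: "L2_inner M ?s f = of_real ?S"
    unfolding combination_inner[OF f] of_real_sum
    by (intro sum.cong refl, subst (2) L2_inner_commute) (simp add: complex_norm_square del: of_real_power)
  have "of_real ?S = cmod (L2_inner M ?s f)" unfolding fs norm_of_real by (simp add: sum_nonneg)
  also have "\<dots> \<le> L2_norm M ?s * L2_norm M f"
    by (intro L2_Cauchy_Schwarz combination_L2 f)
  finally have "?S \<le> L2_norm M ?s * L2_norm M f" by simp
  moreover have "L2_norm M ?s = sqrt ?S"
    by (intro real_sqrt_unique[symmetric] combination_norm I L2_norm_nonneg)
  ultimately have *: "?S \<le> sqrt ?S * L2_norm M f" by simp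
  show ?thesis
  proof (cases "?S = 0")
    case False
    then have "?S > 0" using sum_nonneg[of I "\<lambda>i. (cmod (L2_inner M f (b i)))\<^sup>2"] by simp
    then have "sqrt ?S * sqrt ?S \<le> sqrt ?S * L2_norm M f" using * by simp
    then have "sqrt ?S \<le> L2_norm M f" using \<open>?S > 0\<close> by (simp only: mult_le_cancel_left_pos real_sqrt_gt_zero)
    then show ?thesis by (rule sqrt_le_D)
  qed simp
qed

lemma coeff_square_summable:
  "f \<in> L2 M \<Longrightarrow> (\<lambda>i. (cmod (L2_inner M f (b i)))\<^sup>2) summable_on UNIV"
  by (rule nonneg_bdd_above_summable_on) (auto intro!: bdd_aboveI2 Bessel_inequality)

definition initial :: "nat \<Rightarrow> 'i set" where
  "initial n = {i. to_nat i < n}"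

lemma finite_initial: "finite (initial n)"
proof -
  have "to_nat ` initial n \<subseteq> {..<n}" by (auto simp: initial_def)
  then have "finite (to_nat ` initial n)" by (rule finite_subset[OF _ finite_lessThan])
  then show ?thesis by (rule finite_imageD) (rule inj_on_subset[OF inj_to_nat subset_UNIV])
qed

text \<open>
  Links sums over the index type, which can be reindexed freely, to limits of sequences, which the
  completeness theorem is about.
\<close>

lemma has_sum_initial:
  fixes f :: "'i \<Rightarrow> 'b :: {comm_monoid_add, topological_space}"
  assumes "(f has_sum s) UNIV"
  shows "(\<lambda>n. sum f (initial n)) \<longlonglongrightarrow> s"
proof -
  have "filterlim initial (finite_subsets_at_top UNIV) sequentially"
    unfolding filterlim_finite_subsets_at_top
  proof (intro allI impI)
    fix X :: "'i set" assume X: "finite X \<and> X \<subseteq> UNIV"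
    have "X \<subseteq> initial n" if "n \<ge> Suc (Max (to_nat ` X))" for n
    proof
      fix i assume "i \<in> X"
      then have "to_nat i \<le> Max (to_nat ` X)" using X by (intro Max_ge) auto
      then show "i \<in> initial n" using that by (simp add: initial_def)
    qed
    then show "\<forall>\<^sub>F n in sequentially. finite (initial n) \<and> X \<subseteq> initial n \<and> initial n \<subseteq> UNIV"
      unfolding eventually_sequentially using finite_initial by blast
  qed
  then show ?thesis using assms 
    unfolding has_sum_def by (rule filterlim_compose[rotated])
qed

text \<open>
  The partial sums form a Cauchy sequence because the square of the norm of a difference is a
  difference of partial sums of the series of \<open>|c\<^sub>i|\<^sup>2\<close>.  Convergence in norm is part of the conclusion since
  Parseval's identity needs it.
\<close>

lemma Riesz_Fischer:
  assumes c: "(\<lambda>i. (cmod (c i))\<^sup>2) summable_on UNIV"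
  shows "\<exists>f\<in>L2 M. (\<forall>i. L2_inner M f (b i) = c i) \<and>
    (\<lambda>n. L2_norm M (\<lambda>x. (\<Sum>i\<in>initial n. c i * b i x) - f x)) \<longlonglongrightarrow> 0"
proof -
  define s where "s n x = (\<Sum>i\<in>initial n. c i * b i x)" for n x
  have sL2: "s n \<in> L2 M" for n unfolding s_def by (rule combination_L2)
  define T where "T n = (\<Sum>i\<in>initial n. (cmod (c i))\<^sup>2)" for n
  have mono: "initial n \<subseteq> initial m" if "n \<le> m" for m n using that by (auto simp: initial_def)
  have diff: "(L2_norm M (\<lambda>x. s m x - s n x))\<^sup>2 = T m - T n" if "n \<le> m" for m n
  proof -
    have "s m x - s n x = (\<Sum>i\<in>initial m - initial n. c i * b i x)" for x
      unfolding s_def by (simp add: sum_diff finite_initial mono that)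
    then have "(\<lambda>x. s m x - s n x) = (\<lambda>x. \<Sum>i\<in>initial m - initial n. c i * b i x)" by blast
    then show ?thesis
      unfolding T_def by (simp only: combination_norm finite_initial finite_Diff)
        (simp add: sum_diff finite_initial mono that)
  qed
  have norm_sym: "L2_norm M (\<lambda>x. s m x - s n x) = L2_norm M (\<lambda>x. s n x - s m x)" for m n
    by (simp add: L2_norm_def norm_minus_commute)
  have "T \<longlonglongrightarrow> infsum (\<lambda>i. (cmod (c i))\<^sup>2) UNIV"
    unfolding T_def by (rule has_sum_initial) (simp add: c)
  then have CT: "Cauchy T" by (rule LIMSEQ_imp_Cauchy)
  have "\<exists>N. \<forall>m\<ge>N. \<forall>n\<ge>N. L2_norm M (\<lambda>x. s m x - s n x) < \<epsilon>" if "\<epsilon> > 0" for \<epsilon>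
  proof -
    obtain N where N: "\<And>m n. m \<ge> N \<Longrightarrow> n \<ge> N \<Longrightarrow> norm (T m - T n) < \<epsilon>\<^sup>2"
      using CauchyD[OF CT, of "\<epsilon>\<^sup>2"] \<open>\<epsilon> > 0\<close> by auto
    have le: "L2_norm M (\<lambda>x. s m x - s n x) < \<epsilon>" if "m \<ge> N" "n \<ge> N" "n \<le> m" for m n
    proof (rule power2_less_imp_less)
      show "(L2_norm M (\<lambda>x. s m x - s n x))\<^sup>2 < \<epsilon>\<^sup>2"
        using N[OF that(1,2)] by (simp add: diff[OF that(3)] abs_less_iff)
    qed (use \<open>\<epsilon> > 0\<close> in simp)
    have "L2_norm M (\<lambda>x. s m x - s n x) < \<epsilon>" if "m \<ge> N" "n \<ge> N" for m n
      using le[of m n] le[of n m] norm_sym[of m n] that by (cases "n \<le> m") auto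
    then show ?thesis by blast
  qed
  from L2_complete[OF sL2 this] obtain f where f: "f \<in> L2 M"
    and lim: "(\<lambda>n. L2_norm M (\<lambda>x. s n x - f x)) \<longlonglongrightarrow> 0" by blast
  have "L2_inner M f (b j) = c j" for j
  proof -
    have "(\<lambda>n. L2_inner M (s n) (b j) - L2_inner M f (b j)) \<longlonglongrightarrow> 0"
    proof (rule Lim_null_comparison)
      show "\<forall>\<^sub>F n in sequentially. norm (L2_inner M (s n) (b j) - L2_inner M f (b j))
          \<le> L2_norm M (\<lambda>x. s n x - f x) * L2_norm M (b j)"
        using L2_Cauchy_Schwarz[OF L2_diff[OF sL2 f] basis_L2]
        by (intro always_eventually allI) (simp add: L2_inner_diff_left sL2 f basis_L2)
      show "(\<lambda>n. L2_norm M (\<lambda>x. s n x - f x) * L2_norm M (b j)) \<longlonglongrightarrow> 0"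
        using tendsto_mult_left_zero[OF lim] .
    qed
    moreover have "\<forall>\<^sub>F n in sequentially. L2_inner M (s n) (b j) - L2_inner M f (b j) = c j - L2_inner M f (b j)"
      unfolding s_def using eventually_gt_at_top[of "to_nat j"]
      by eventually_elim (subst combination_coeff[OF finite_initial], simp add: initial_def)
    ultimately have "(\<lambda>n. c j - L2_inner M f (b j)) \<longlonglongrightarrow> 0"
      by (rule Lim_transform_eventually)
    then show ?thesis by (simp add: LIMSEQ_const_iff)
  qed
  then show ?thesis using f lim unfolding s_def by blast
qed

text \<open>
  The expansion built from the coefficients of \<open>f\<close> by the Riesz-Fischer theorem has the same coefficients as
  \<open>f\<close>, hence equals \<open>f\<close> almost everywhere by totality; the inner product is continuous in the norm.
  Absolute convergence makes the sum independent of the enumeration of the indices.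
\<close>

theorem Parseval:
  assumes f: "f \<in> L2 M" and g: "g \<in> L2 M"
  shows "((\<lambda>i. L2_inner M f (b i) * L2_inner M (b i) g) has_sum L2_inner M f g) UNIV"
proof -
  define c where "c i = L2_inner M f (b i)" for i
  define t where "t i = L2_inner M f (b i) * L2_inner M (b i) g" for i
  obtain f' where f': "f' \<in> L2 M" "\<And>i. L2_inner M f' (b i) = c i" and
    lim: "(\<lambda>n. L2_norm M (\<lambda>x. (\<Sum>i\<in>initial n. c i * b i x) - f' x)) \<longlonglongrightarrow> 0"
    using Riesz_Fischer[of c] coeff_square_summable[OF f] unfolding c_def by metis
  have "AE x in M. f x - f' x = 0"
    by (rule total) (auto intro: L2_diff simp: f f' L2_inner_diff_left basis_L2 c_def)
  then have ff': "L2_inner M f g = L2_inner M f' g"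
    by (intro L2_inner_cong_AE) (auto simp: f f' g)
  have "(\<lambda>n. (\<Sum>i\<in>initial n. t i) - L2_inner M f' g) \<longlonglongrightarrow> 0"
  proof (rule Lim_null_comparison)
    show "\<forall>\<^sub>F n in sequentially. norm ((\<Sum>i\<in>initial n. t i) - L2_inner M f' g)
      \<le> L2_norm M (\<lambda>x. (\<Sum>i\<in>initial n. c i * b i x) - f' x) * L2_norm M g"
      using L2_Cauchy_Schwarz[OF L2_diff[OF combination_L2 f'(1)] g]
      by (intro always_eventually allI)
        (simp add: L2_inner_diff_left combination_L2 f' g combination_inner t_def c_def)
    show "(\<lambda>n. L2_norm M (\<lambda>x. (\<Sum>i\<in>initial n. c i * b i x) - f' x) * L2_norm M g) \<longlonglongrightarrow> 0"
      using tendsto_mult_left_zero[OF lim] .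
  qed
  then have lim1: "(\<lambda>n. (\<Sum>i\<in>initial n. t i)) \<longlonglongrightarrow> L2_inner M f g"
    unfolding ff' by (simp add: LIM_zero_iff)
  have "(\<lambda>i. norm (t i)) summable_on UNIV"
  proof (rule summable_on_comparison_test)
    show "(\<lambda>i. (cmod (L2_inner M f (b i)))\<^sup>2 + (cmod (L2_inner M g (b i)))\<^sup>2) summable_on UNIV"
      by (intro summable_on_add coeff_square_summable f g)
    fix i
    have *: "cmod (L2_inner M (b i) g) = cmod (L2_inner M g (b i))"
      by (subst L2_inner_commute) simp
    show "norm (t i) \<le> (cmod (L2_inner M f (b i)))\<^sup>2 + (cmod (L2_inner M g (b i)))\<^sup>2"
      using sum_squares_bound[of "cmod (L2_inner M f (b i))" "cmod (L2_inner M g (b i))"]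
        mult_nonneg_nonneg[OF norm_ge_zero norm_ge_zero, of "L2_inner M f (b i)" "L2_inner M g (b i)"]
      unfolding t_def norm_mult * by linarith
  qed auto
  then have "t summable_on UNIV" by (rule abs_summable_summable)
  then have hs: "(t has_sum infsum t UNIV) UNIV" by simp
  from LIMSEQ_unique[OF has_sum_initial[OF hs] lim1] hs show ?thesis unfolding t_def by simp
qed

corollary Parseval_norm:
  assumes f: "f \<in> L2 M"
  shows "((\<lambda>i. (cmod (L2_inner M f (b i)))\<^sup>2) has_sum (L2_norm M f)\<^sup>2) UNIV"
proof -
  have "((\<lambda>i. Re (L2_inner M f (b i) * L2_inner M (b i) f)) has_sum Re (L2_inner M f f)) UNIV"
    by (rule has_sum_Re[OF Parseval[OF f f]])
  moreover have "L2_inner M f (b i) * L2_inner M (b i) f = of_real ((cmod (L2_inner M f (b i)))\<^sup>2)" for i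
    by (subst (2) L2_inner_commute) (simp only: complex_norm_square)
  ultimately show ?thesis by (simp add: L2_inner_self del: of_real_power)
qed

text \<open>
  The maximal diagonal operator: the domain consists of all \<open>u\<close> for which some \<open>w\<close> in \<open>L\<^sup>2\<close> has the
  coefficients \<open>l\<^sub>i u\<^sub>i\<close>.
\<close>

definition diagonal_operator :: "('i \<Rightarrow> complex) \<Rightarrow> 'a L2_operator" where
  "diagonal_operator l =
     {(u, w). u \<in> L2 M \<and> w \<in> L2 M \<and> (\<forall>i. L2_inner M w (b i) = l i * L2_inner M u (b i))}"

lemma basis_diagonal_operator: "(b i, \<lambda>x. l i * b i x) \<in> diagonal_operator l"
  by (simp add: diagonal_operator_def basis_L2 L2_scale L2_inner_scale_left orthonormal)

lemma basis_norm: "L2_norm M (b i) = 1"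
  using L2_inner_self[of M "b i"] L2_norm_nonneg[of M "b i"]
  by (simp add: orthonormal power2_eq_1_iff flip: of_real_power)

lemma basis_eigenspace: "b i \<in> eigenspace M (diagonal_operator l) (l i)"
  unfolding eigenspace_def using basis_diagonal_operator[of i l] by auto

lemma basis_not_AE_zero: "\<not> (AE x in M. b i x = 0)"
  using L2_norm_eq_0_iff[OF basis_L2, of i] basis_norm[of i] by simp

lemma is_eigenvalue_diagonal: "is_eigenvalue M (diagonal_operator l) (l i)"
  unfolding is_eigenvalue_def using basis_eigenspace basis_not_AE_zero by blast

lemma inj_basis: "inj b"
proof (rule injI)
  fix i j assume "b i = b j"
  then have "L2_inner M (b i) (b i) = L2_inner M (b j) (b i)" by simp
  then show "i = j" by (simp add: orthonormal split: if_splits)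
qed

lemma AE_independent_basis: 
  assumes I: "finite I"
  shows "AE_independent M (b ` I)"
  unfolding AE_independent_def
proof (intro allI impI ballI)
  fix c y assume 0: "AE x in M. (\<Sum>y\<in>b ` I. c y * y x) = 0" and "y \<in> b ` I"
  then obtain j where j: "j \<in> I" "y = b j" by blast
  have sum: "(\<Sum>y\<in>b ` I. c y * y x) = (\<Sum>i\<in>I. c (b i) * b i x)" for x
    using inj_basis by (subst sum.reindex) (auto intro: inj_on_subset)
  have "L2_inner M (\<lambda>x. \<Sum>i\<in>I. c (b i) * b i x) (b j) = L2_inner M (\<lambda>x. 0) (b j)"
    using 0 unfolding sum by (intro L2_inner_cong_AE combination_L2 L2_zero basis_L2)
  then show "c y = 0" using j I by (subst (asm) combination_coeff) (auto simp: L2_inner_def)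
qed

lemma eigenvalue_multiplicity_diagonal:
  assumes inf: "infinite {i. l i = z}"
  shows "eigenvalue_multiplicity M (diagonal_operator l) z = \<infinity>"
proof -
  have "enat n \<le> eigenvalue_multiplicity M (diagonal_operator l) z" for n
  proof -
    obtain I where I: "I \<subseteq> {i. l i = z}" "finite I" "card I = n"
      using infinite_arbitrarily_large[OF inf] by blast
    have "b ` I \<subseteq> eigenspace M (diagonal_operator l) z"
      using I basis_eigenspace by auto
    moreover have "card (b ` I) = n"
      using I inj_on_subset[OF inj_basis subset_UNIV] by (simp add: card_image)
    ultimately show ?thesis
      unfolding eigenvalue_multiplicity_def AE_dim_def
      using AE_independent_basis[OF I(2)] I(2) by (intro SUP_upper2[of "b ` I"]) auto
  qed
  note ge = this
  show ?thesis
  proof (cases "eigenvalue_multiplicity M (diagonal_operator l) z")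
    case (enat n)
    then show ?thesis using ge[of "Suc n"] by simp
  qed
qed

text \<open>
  Solving \<open>w - z u = f\<close> means dividing the coefficients of \<open>f\<close> by \<open>l\<^sub>i - z\<close>, which is bounded exactly if
  \<open>z\<close> has positive distance from all \<open>l\<^sub>i\<close>.  If it has not, then basis vectors with \<open>l\<^sub>i\<close> close to \<open>z\<close> refute the
  boundedness of the inverse.
\<close>

theorem spectrum_diagonal: "spectrum M (diagonal_operator l) = closure (range l)"
proof -
  have "z \<in> resolvent_set M (diagonal_operator l) \<longleftrightarrow> z \<notin> closure (range l)" for z
  proof
    assume "z \<in> resolvent_set M (diagonal_operator l)"
    then obtain C where C: "\<And>u w. (u, w) \<in> diagonal_operator l \<Longrightarrow>
        L2_norm M u \<le> C * L2_norm M (\<lambda>x. w x - z * u x)"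
      unfolding resolvent_set_def by blast
    have bound: "1 \<le> C * cmod (l i - z)" for i
    proof -
      have "(L2_norm M (\<lambda>x. l i * b i x - z * b i x))\<^sup>2 = (cmod (l i - z))\<^sup>2 * (L2_norm M (b i))\<^sup>2"
        unfolding L2_norm_square 
        by (simp add: left_diff_distrib[symmetric] norm_mult power_mult_distrib)
      then have "L2_norm M (\<lambda>x. l i * b i x - z * b i x) = cmod (l i - z)"
        by (simp add: basis_norm power2_eq_iff_nonneg L2_norm_nonneg)
      then show ?thesis using C[OF basis_diagonal_operator[of i l]] by (simp add: basis_norm)
    qed
    \<comment> \<open>Index types are inhabited, and the bound at any one index forces \<open>C\<close> to be positive.\<close>
    have Cpos: "C > 0"
    proof (rule ccontr)
      assume "\<not> C > 0"
      then have "C * cmod (l undefined - z) \<le> 0" by (intro mult_nonpos_nonneg) auto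
      then show False using bound[of undefined] by linarith
    qed
    show "z \<notin> closure (range l)"
    proof
      assume "z \<in> closure (range l)"
      then have "\<forall>e>0. \<exists>i. dist (l i) z < e" by (auto simp: closure_approachable)
      then have "\<exists>i. dist (l i) z < 1 / C" using Cpos by (elim allE[of _ "1 / C"]) simp
      then obtain i where "dist (l i) z < 1 / C" by blast
      then have "C * cmod (l i - z) < 1" using Cpos by (simp add: dist_norm field_simps)
      then show False using bound[of i] by simp
    qed
  next
    assume "z \<notin> closure (range l)"
    then have "\<exists>d>0. \<forall>i. d \<le> cmod (l i - z)"
      by (simp add: closure_approachable dist_norm not_less)
    then obtain d where d: "d > 0" "\<And>i. d \<le> cmod (l i - z)" by blast
    have nz: "l i \<noteq> z" for i using d(1) d(2)[of i] by auto
    have bound: "L2_norm M u \<le> (1 / d) * L2_norm M (\<lambda>x. w x - z * u x)" 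
      if "(u, w) \<in> diagonal_operator l" for u w
    proof -
      let ?f = "\<lambda>x. w x - z * u x"
      have u: "u \<in> L2 M" and w: "w \<in> L2 M" and
        uw: "\<And>i. L2_inner M w (b i) = l i * L2_inner M u (b i)"
        using that by (auto simp: diagonal_operator_def)
      have f: "?f \<in> L2 M" by (intro L2_diff L2_scale u w)
      have "(L2_norm M u)\<^sup>2 \<le> (1 / d)\<^sup>2 * (L2_norm M ?f)\<^sup>2"
      proof (rule has_sum_mono)
        show "((\<lambda>i. (cmod (L2_inner M u (b i)))\<^sup>2) has_sum (L2_norm M u)\<^sup>2) UNIV"
          by (rule Parseval_norm[OF u])
        show "((\<lambda>i. (1 / d)\<^sup>2 * (cmod (L2_inner M ?f (b i)))\<^sup>2) has_sum (1 / d)\<^sup>2 * (L2_norm M ?f)\<^sup>2) UNIV"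
          by (intro has_sum_cmult_right Parseval_norm f)
        fix i
        have "L2_inner M ?f (b i) = (l i - z) * L2_inner M u (b i)"
          by (simp add: L2_inner_diff_left u w L2_scale basis_L2 L2_inner_scale_left uw algebra_simps)
        then have "d * cmod (L2_inner M u (b i)) \<le> cmod (L2_inner M ?f (b i))"
          using d(2)[of i] by (simp add: norm_mult mult_right_mono)
        then have "cmod (L2_inner M u (b i)) \<le> (1 / d) * cmod (L2_inner M ?f (b i))"
          using d(1) by (simp add: field_simps)
        then show "(cmod (L2_inner M u (b i)))\<^sup>2 \<le> (1 / d)\<^sup>2 * (cmod (L2_inner M ?f (b i)))\<^sup>2"
          unfolding power_mult_distrib[symmetric] by (intro power_mono) auto
      qed
      then show ?thesis unfolding power_mult_distrib[symmetric]
        by (rule power2_le_imp_le) (use d in \<open>simp add: L2_norm_nonneg\<close>)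
    qed
    have inj: "AE x in M. u x = 0" 
      if uw: "(u, w) \<in> diagonal_operator l" and 0: "AE x in M. w x - z * u x = 0" for u w
    proof -
      have L2: "u \<in> L2 M" "w \<in> L2 M" using uw by (auto simp: diagonal_operator_def)
      then have "L2_norm M (\<lambda>x. w x - z * u x) = 0"
        using 0 by (subst L2_norm_eq_0_iff) (auto intro: L2_diff L2_scale)
      then show ?thesis using bound[OF uw] L2_norm_nonneg[of M u] L2 by (simp add: L2_norm_eq_0_iff)
    qed
    have surj: "\<exists>(u, w)\<in>diagonal_operator l. AE x in M. w x - z * u x = f x" if f: "f \<in> L2 M" for f
    proof -
      define c where "c i = L2_inner M f (b i) / (l i - z)" for i
      have "(\<lambda>i. (cmod (c i))\<^sup>2) summable_on UNIV"
      proof (rule summable_on_comparison_test)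
        show "(\<lambda>i. (1 / d)\<^sup>2 * (cmod (L2_inner M f (b i)))\<^sup>2) summable_on UNIV"
          by (intro summable_on_cmult_right coeff_square_summable f)
        fix i
        have "cmod (c i) \<le> (1 / d) * cmod (L2_inner M f (b i))"
          using d(1) d(2)[of i] by (simp add: c_def norm_divide frac_le)
        then show "(cmod (c i))\<^sup>2 \<le> (1 / d)\<^sup>2 * (cmod (L2_inner M f (b i)))\<^sup>2"
          unfolding power_mult_distrib[symmetric] by (intro power_mono) auto
      qed auto
      from Riesz_Fischer[OF this] obtain u where u: "u \<in> L2 M" "\<And>i. L2_inner M u (b i) = c i" by blast
      define w where "w x = f x + z * u x" for x
      have "L2_inner M w (b i) = l i * L2_inner M u (b i)" for i
        using nz[of i] unfolding w_def
        by (simp add: L2_inner_add_left f u L2_scale basis_L2 L2_inner_scale_left c_def field_simps)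
      then have "(u, w) \<in> diagonal_operator l"
        using u f by (auto simp: diagonal_operator_def w_def[abs_def] intro: L2_add L2_scale)
      then show ?thesis by (force simp: w_def)
    qed
    show "z \<in> resolvent_set M (diagonal_operator l)"
      unfolding resolvent_set_def using surj inj bound by blast
  qed
  then show ?thesis by (auto simp: spectrum_def)
qed

end

section \<open>Smooth functions and a flat function\<close>

lemma frechet_derivative_eq: "(f has_derivative D) (at z) \<Longrightarrow> frechet_derivative f (at z) = D"
  by (metis frechet_derivative_at)

text \<open>
  This rule and the next replace the chosen derivative \<open>frechet_derivative\<close> by a known one.
\<close>

lemma times_cont_diff_SucI:
  assumes "\<And>z. (f has_derivative D z) (at z)"
    and "times_cont_diff k (\<lambda>z. D z 1)" "times_cont_diff k (\<lambda>z. D z \<i>)"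
  shows "times_cont_diff (Suc k) f"
  using assms by (auto simp: frechet_derivative_eq[OF assms(1)] differentiable_def)

lemma times_cont_diff_SucE:
  assumes "times_cont_diff (Suc k) f"
  obtains D where "\<And>z. (f has_derivative D z) (at z)"
    "times_cont_diff k (\<lambda>z. D z 1)" "times_cont_diff k (\<lambda>z. D z \<i>)"
  using assms by (intro that[of "\<lambda>z. frechet_derivative f (at z)"]) (auto simp: frechet_derivative_works)

lemma times_cont_diff_mono: "times_cont_diff (Suc k) f \<Longrightarrow> times_cont_diff k f"
proof (induction k arbitrary: f)
  case 0
  then show ?case 
    by (auto intro!: continuous_at_imp_continuous_on differentiable_imp_continuous_within)
next
  case (Suc k)
  show ?case
    using Suc.prems unfolding times_cont_diff.simps(2)[of "Suc k"] times_cont_diff.simps(2)[of k f]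
    by (intro conjI Suc.IH) blast+
qed

lemma times_cont_diff_const: "times_cont_diff k (\<lambda>z. c)"
  by (induction k arbitrary: c) auto

lemma times_cont_diff_add:
  "times_cont_diff k f \<Longrightarrow> times_cont_diff k g \<Longrightarrow> times_cont_diff k (\<lambda>z. f z + g z)"
proof (induction k arbitrary: f g)
  case 0
  then show ?case by (auto intro: continuous_intros)
next
  case (Suc k)
  obtain D where D: "\<And>z. (f has_derivative D z) (at z)"
    "times_cont_diff k (\<lambda>z. D z 1)" "times_cont_diff k (\<lambda>z. D z \<i>)"
    using times_cont_diff_SucE[OF Suc.prems(1)] by blast
  obtain E where E: "\<And>z. (g has_derivative E z) (at z)"
    "times_cont_diff k (\<lambda>z. E z 1)" "times_cont_diff k (\<lambda>z. E z \<i>)"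
    using times_cont_diff_SucE[OF Suc.prems(2)] by blast
  show ?case
    by (rule times_cont_diff_SucI[OF has_derivative_add[OF D(1) E(1)]]) (intro Suc.IH D E)+
qed

lemma times_cont_diff_mult:
  "times_cont_diff k f \<Longrightarrow> times_cont_diff k g \<Longrightarrow> times_cont_diff k (\<lambda>z. f z * g z)"
proof (induction k arbitrary: f g)
  case 0
  then show ?case by (auto intro: continuous_intros)
next
  case (Suc k)
  obtain D where D: "\<And>z. (f has_derivative D z) (at z)"
    "times_cont_diff k (\<lambda>z. D z 1)" "times_cont_diff k (\<lambda>z. D z \<i>)"
    using times_cont_diff_SucE[OF Suc.prems(1)] by blast
  obtain E where E: "\<And>z. (g has_derivative E z) (at z)"
    "times_cont_diff k (\<lambda>z. E z 1)" "times_cont_diff k (\<lambda>z. E z \<i>)"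
    using times_cont_diff_SucE[OF Suc.prems(2)] by blast
  show ?case
    by (rule times_cont_diff_SucI[OF has_derivative_mult[OF D(1) E(1)]])
      (intro times_cont_diff_add Suc.IH D E Suc.prems[THEN times_cont_diff_mono])+
qed

lemma times_cont_diff_bounded_linear:
  assumes "bounded_linear l"
  shows "times_cont_diff k (l :: complex \<Rightarrow> complex)"
proof (cases k)
  case 0
  then show ?thesis using assms by (simp add: linear_continuous_on)
next
  case (Suc k)
  show ?thesis unfolding Suc
    by (rule times_cont_diff_SucI[OF bounded_linear_imp_has_derivative[OF assms]])
      (rule times_cont_diff_const)+
qed

lemma times_cont_diff_cnj: "times_cont_diff k f \<Longrightarrow> times_cont_diff k (\<lambda>z. cnj (f z))"
proof (induction k arbitrary: f)
  case 0
  then show ?case by (auto intro: continuous_on_cnj)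
next
  case (Suc k)
  obtain D where D: "\<And>z. (f has_derivative D z) (at z)"
    "times_cont_diff k (\<lambda>z. D z 1)" "times_cont_diff k (\<lambda>z. D z \<i>)"
    using times_cont_diff_SucE[OF Suc.prems] by blast
  show ?case
    by (rule times_cont_diff_SucI[OF bounded_linear.has_derivative[OF bounded_linear_cnj D(1)]])
      (intro Suc.IH D)+
qed

text \<open>
  A chain rule for real functions of a real-valued function, all viewed as complex-valued.  The derivative \<open>D\<close>
  of a real-valued function takes real values only.
\<close>

lemma has_derivative_compose_of_real:
  fixes \<rho> :: "'a :: real_normed_vector \<Rightarrow> real"
  assumes D: "((\<lambda>z. complex_of_real (\<rho> z)) has_derivative D) (at z)"
    and H: "(H has_real_derivative H') (at (\<rho> z))"
  shows "((\<lambda>z. complex_of_real (H (\<rho> z))) has_derivative (\<lambda>h. of_real H' * D h)) (at z)"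
proof -
  have D_real: "D h = of_real (Re (D h))" for h
  proof -
    have "((\<lambda>z. Im (complex_of_real (\<rho> z))) has_derivative (\<lambda>h. Im (D h))) (at z)"
      by (rule has_derivative_Im[OF D])
    then have "((\<lambda>z. 0) has_derivative (\<lambda>h. Im (D h))) (at z)" by simp
    moreover have "((\<lambda>z. 0) has_derivative (\<lambda>h. 0)) (at z)" by simp
    ultimately have "(\<lambda>h. Im (D h)) = (\<lambda>h. 0)" by (rule has_derivative_unique)
    then have "Im (D h) = 0" by (rule fun_cong)
    then show ?thesis by (simp add: complex_eq_iff)
  qed
  have "((\<lambda>z. Re (complex_of_real (\<rho> z))) has_derivative (\<lambda>h. Re (D h))) (at z)"
    by (rule has_derivative_Re[OF D])
  then have "(\<rho> has_derivative (\<lambda>h. Re (D h))) (at z)" by simp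
  then have "((\<lambda>z. H (\<rho> z)) has_derivative (\<lambda>h. H' * Re (D h))) (at z)"
    by (rule has_derivative_compose) (use H in \<open>simp add: has_field_derivative_def\<close>)
  then have "((\<lambda>z. complex_of_real (H (\<rho> z))) has_derivative
      (\<lambda>h. of_real (H' * Re (D h)))) (at z)"
    by (rule has_derivative_of_real)
  then show ?thesis by (simp add: D_real[symmetric])
qed

text \<open>
  A whole sequence of functions, each the derivative of the preceding one, makes the induction on
  the order of differentiability go through: the derivative of \<open>H n \<circ> \<rho>\<close> involves \<open>H (Suc n) \<circ> \<rho>\<close>.
\<close>

lemma times_cont_diff_compose_real:
  fixes H :: "nat \<Rightarrow> real \<Rightarrow> real" and \<rho> :: "complex \<Rightarrow> real"
  assumes H: "\<And>n t. (H n has_real_derivative H (Suc n) t) (at t)"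
    and \<rho>: "\<And>k. times_cont_diff k (\<lambda>z. complex_of_real (\<rho> z))"
  shows "times_cont_diff k (\<lambda>z. complex_of_real (H n (\<rho> z)))"
proof (induction k arbitrary: n)
  case 0
  have "continuous_on UNIV (\<lambda>z. Re (complex_of_real (\<rho> z)))"
    using \<rho>[of 0] by (intro continuous_on_Re) simp
  moreover have "continuous_on UNIV (H n)"
    using H by (intro continuous_at_imp_continuous_on ballI DERIV_isCont)
  ultimately show ?case
    by (auto intro!: continuous_on_of_real continuous_on_compose2[of UNIV "H n"])
next
  case (Suc k)
  obtain D where D: "\<And>z. ((\<lambda>z. complex_of_real (\<rho> z)) has_derivative D z) (at z)"
    "times_cont_diff k (\<lambda>z. D z 1)" "times_cont_diff k (\<lambda>z. D z \<i>)"
    using times_cont_diff_SucE[OF \<rho>[of "Suc k"]] by blast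
  have "((\<lambda>z. complex_of_real (H n (\<rho> z))) has_derivative
      (\<lambda>h. of_real (H (Suc n) (\<rho> z)) * D z h)) (at z)" for z
    by (rule has_derivative_compose_of_real[OF D(1) H])
  then show ?case
    by (rule times_cont_diff_SucI) (intro times_cont_diff_mult Suc.IH D)+
qed

text \<open>
  With \<open>p = 1\<close> this is the standard smooth function that vanishes exactly for \<open>t \<le> 0\<close>.  The
  polynomial factor makes the family closed under differentiation.
\<close>

definition flat :: "real poly \<Rightarrow> real \<Rightarrow> real" where
  "flat p t = (if t > 0 then poly p (1 / t) * exp (- 1 / t) else 0)"

lemma tendsto_poly_exp_0: "((\<lambda>s::real. poly p s * exp (- s)) \<longlongrightarrow> 0) at_top"
proof -
  have "((\<lambda>s::real. \<Sum>i\<le>degree p. coeff p i * (s ^ i / exp s)) \<longlongrightarrow> (\<Sum>i\<le>degree p. coeff p i * 0)) at_top"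
    by (intro tendsto_sum tendsto_mult tendsto_const tendsto_power_div_exp_0)
  then show ?thesis
    by (simp add: poly_altdef sum_distrib_right exp_minus divide_inverse mult.assoc)
qed

lemma flat_tendsto_0: "((\<lambda>t. flat p t / t) \<longlongrightarrow> 0) (at 0)"
proof -
  \<comment> \<open>Dividing by \<open>t\<close> multiplies the polynomial in \<open>1/t\<close> by its variable.\<close>
  have "((\<lambda>t. poly (pCons 0 p) (inverse t) * exp (- (inverse t))) \<longlongrightarrow> 0) (at_right (0::real))"
    by (rule filterlim_compose[OF tendsto_poly_exp_0 filterlim_inverse_at_top_right])
  then have "((\<lambda>t. flat p t / t) \<longlongrightarrow> 0) (at_right 0)"
    by (rule Lim_transform_eventually)
      (auto simp: flat_def divide_inverse eventually_at_right_field intro!: exI[of _ 1])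
  moreover have "((\<lambda>t. flat p t / t) \<longlongrightarrow> 0) (at_left 0)"
    by (rule tendsto_eventually) (auto simp: flat_def eventually_at_left_field intro!: exI[of _ "-1"])
  ultimately show ?thesis by (simp add: filterlim_at_split)
qed

text \<open>
  The chain rule for \<open>p (1/t) exp (- 1/t)\<close>, in the variable \<open>s = 1/t\<close> with \<open>ds/dt = - s\<^sup>2\<close>.
\<close>

definition flat_step :: "real poly \<Rightarrow> real poly" where
  "flat_step p = monom 1 2 * (p - pderiv p)"

lemma flat_deriv: "(flat p has_real_derivative flat (flat_step p) t) (at t)"
proof -
  consider "t > 0" | "t < 0" | "t = 0" by linarith
  then show ?thesis
  proof cases
    case 1
    have "((\<lambda>t. poly p (1 / t) * exp (- 1 / t)) has_real_derivative flat (flat_step p) t) (at t)"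
      using 1 by (auto intro!: derivative_eq_intros DERIV_chain'[OF _ poly_DERIV]
          simp: flat_def flat_step_def poly_monom field_simps power2_eq_square)
    then show ?thesis
      by (rule has_field_derivative_transform_within_open[of _ _ _ "{0<..}"]) (use 1 in \<open>auto simp: flat_def\<close>)
  next
    case 2
    \<comment> \<open>Both functions vanish on the negative half-line.\<close>
    have "((\<lambda>t. 0) has_real_derivative flat (flat_step p) t) (at t)"
      using 2 by (simp add: flat_def)
    then show ?thesis
      by (rule has_field_derivative_transform_within_open[of _ _ _ "{..<0}"]) (use 2 in \<open>auto simp: flat_def\<close>)
  next
    case 3
    then show ?thesis using flat_tendsto_0[of p] by (simp add: has_field_derivative_iff flat_def)
  qed
qed

lemma times_cont_diff_flat:
  assumes "\<And>k. times_cont_diff k (\<lambda>z. complex_of_real (\<rho> z))"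
  shows "times_cont_diff k (\<lambda>z. complex_of_real (flat p (\<rho> z)))"
  using times_cont_diff_compose_real[of "\<lambda>n. flat ((flat_step ^^ n) p)" \<rho> k 0] assms flat_deriv
  by simp

lemma times_cont_diff_exp:
  assumes "\<And>k. times_cont_diff k (\<lambda>z. complex_of_real (\<rho> z))"
  shows "times_cont_diff k (\<lambda>z. complex_of_real (exp (\<rho> z)))"
  using times_cont_diff_compose_real[of "\<lambda>n. exp" \<rho> k 0] assms by simp

lemma times_cont_diff_cmod_square: "times_cont_diff k (\<lambda>z. complex_of_real ((cmod z)\<^sup>2))"
  unfolding complex_norm_square
  by (intro times_cont_diff_mult times_cont_diff_bounded_linear bounded_linear_ident bounded_linear_cnj)

section \<open>Wirtinger derivatives\<close>

text \<open>
  \<open>a\<close> and \<open>b\<close> are the derivatives with respect to \<open>z\<close> and \<open>zbar\<close>.  Recording both at once, as the coefficients of the real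
  derivative, makes the product and chain rules mechanical.
\<close>

definition wirtinger :: "(complex \<Rightarrow> complex) \<Rightarrow> (complex \<Rightarrow> complex) \<Rightarrow> (complex \<Rightarrow> complex) \<Rightarrow> bool" where
  "wirtinger f a b \<longleftrightarrow> (\<forall>z. (f has_derivative (\<lambda>h. a z * h + b z * cnj h)) (at z))"

lemma wirtinger_has_derivative:
  "wirtinger f a b \<Longrightarrow> (f has_derivative (\<lambda>h. a z * h + b z * cnj h)) (at z)"
  by (simp add: wirtinger_def)

lemma wirtinger_continuous: "wirtinger f a b \<Longrightarrow> continuous_on S f"
  by (meson continuous_at_imp_continuous_on has_derivative_continuous wirtinger_has_derivative)

lemma d_zbar_wirtinger: "wirtinger f a b \<Longrightarrow> d_zbar f z = b z"
  unfolding d_zbar_def frechet_derivative_eq[OF wirtinger_has_derivative]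
  by (simp add: algebra_simps)

lemma wirtinger_const: "wirtinger (\<lambda>z. c) (\<lambda>z. 0) (\<lambda>z. 0)"
  by (simp add: wirtinger_def)

lemma wirtinger_ident: "wirtinger (\<lambda>z. z) (\<lambda>z. 1) (\<lambda>z. 0)"
  by (simp add: wirtinger_def)

lemma wirtinger_cnj: "wirtinger f a b \<Longrightarrow> wirtinger (\<lambda>z. cnj (f z)) (\<lambda>z. cnj (b z)) (\<lambda>z. cnj (a z))"
  unfolding wirtinger_def
proof
  fix z assume "\<forall>z. (f has_derivative (\<lambda>h. a z * h + b z * cnj h)) (at z)"
  then have "(f has_derivative (\<lambda>h. a z * h + b z * cnj h)) (at z)" by blast
  from bounded_linear.has_derivative[OF bounded_linear_cnj this]
  show "((\<lambda>z. cnj (f z)) has_derivative (\<lambda>h. cnj (b z) * h + cnj (a z) * cnj h)) (at z)"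
    by (simp add: algebra_simps)
qed

lemma wirtinger_add:
  "wirtinger f a b \<Longrightarrow> wirtinger g c d \<Longrightarrow> 
    wirtinger (\<lambda>z. f z + g z) (\<lambda>z. a z + c z) (\<lambda>z. b z + d z)"
  unfolding wirtinger_def
  by (auto intro!: derivative_eq_intros simp: algebra_simps)

lemma wirtinger_mult:
  "wirtinger f a b \<Longrightarrow> wirtinger g c d \<Longrightarrow>
    wirtinger (\<lambda>z. f z * g z) (\<lambda>z. a z * g z + f z * c z) (\<lambda>z. b z * g z + f z * d z)"
  unfolding wirtinger_def
  by (auto intro!: derivative_eq_intros simp: algebra_simps)

lemma wirtinger_scale: "wirtinger f a b \<Longrightarrow> wirtinger (\<lambda>z. c * f z) (\<lambda>z. c * a z) (\<lambda>z. c * b z)"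
  using wirtinger_mult[OF wirtinger_const, of f a b c] by simp

lemma wirtinger_compose_real:
  assumes "wirtinger (\<lambda>z. complex_of_real (\<rho> z)) a b" "\<And>t. (H has_real_derivative H' t) (at t)"
  shows "wirtinger (\<lambda>z. complex_of_real (H (\<rho> z))) (\<lambda>z. of_real (H' (\<rho> z)) * a z) (\<lambda>z. of_real (H' (\<rho> z)) * b z)"
  unfolding wirtinger_def
proof
  fix z
  show "((\<lambda>z. complex_of_real (H (\<rho> z))) has_derivative
      (\<lambda>h. complex_of_real (H' (\<rho> z)) * a z * h + complex_of_real (H' (\<rho> z)) * b z * cnj h)) (at z)"
    using has_derivative_compose_of_real[OF wirtinger_has_derivative[OF assms(1)] assms(2), of z]
    by (simp add: algebra_simps)
qed

lemma wirtinger_cmod_square: "wirtinger (\<lambda>z. complex_of_real ((cmod z)\<^sup>2)) (\<lambda>z. cnj z) (\<lambda>z. z)"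
  unfolding complex_norm_square
  using wirtinger_mult[OF wirtinger_ident wirtinger_cnj[OF wirtinger_ident]] by simp


section \<open>Integration by parts\<close>

lemma integrable_continuous_compact_support:
  fixes f :: "'a :: euclidean_space \<Rightarrow> 'b :: {banach, second_countable_topology}"
  assumes cont: "continuous_on UNIV f" and supp: "\<And>x. norm x > R \<Longrightarrow> f x = 0"
  shows "integrable lborel f"
proof -
  have "integrable lborel (\<lambda>x. indicator (cball 0 R) x *\<^sub>R f x)"
    by (rule borel_integrable_compact) (auto intro: continuous_on_subset[OF cont])
  moreover have "(\<lambda>x. indicator (cball 0 R) x *\<^sub>R f x) = f"
    using supp by (auto simp: indicator_def fun_eq_iff not_le)
  ultimately show ?thesis by simp
qed

lemma lborel_integral_translation:
  fixes f :: "'a :: euclidean_space \<Rightarrow> 'b :: {banach, second_countable_topology}"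
  assumes [measurable]: "f \<in> borel_measurable borel"
  shows "(LINT x|lborel. f (x + c)) = (LINT x|lborel. f x)"
proof -
  have "(LINT x|lborel. f x) = (LINT x|distr lborel borel ((+) c). f x)"
    by (simp add: lborel_distr_plus)
  also have "\<dots> = (LINT x|lborel. f (c + x))" by (rule integral_distr) auto
  finally show ?thesis by (simp add: add.commute)
qed

lemma lborel_integrable_translation:
  fixes f :: "'a :: euclidean_space \<Rightarrow> 'b :: {banach, second_countable_topology}"
  assumes "integrable lborel f"
  shows "integrable lborel (\<lambda>x. f (x + c))"
proof -
  have "integrable (distr lborel borel ((+) c)) f" using assms by (simp add: lborel_distr_plus)
  then have "integrable lborel (\<lambda>x. f (c + x))" by (rule integrable_distr[rotated]) auto
  then show ?thesis by (simp add: add.commute)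
qed

lemma derivative_outside_support:
  fixes F :: "'a :: real_normed_vector \<Rightarrow> 'b :: real_normed_vector"
  assumes D: "(F has_derivative D) (at x)"
    and supp: "\<And>x. norm x > R \<Longrightarrow> F x = 0" and x: "norm x > R"
  shows "D = (\<lambda>h. 0)"
proof -
  have "((\<lambda>x. 0) has_derivative D) (at x)"
    by (rule has_derivative_transform_within_open[OF D, of "- cball 0 R"]) (use x supp in auto)
  moreover have "((\<lambda>x. 0 :: 'b) has_derivative (\<lambda>h. 0)) (at x)" by simp
  ultimately show ?thesis by (rule has_derivative_unique)
qed

text \<open>
  The difference quotients of \<open>F\<close> integrate to zero by translation invariance of Lebesgue measure.  They are
  bounded by a bound for the derivative and vanish outside a fixed ball, so that their
  integrals converge to that of the derivative.
\<close>

lemma integral_directional_derivative_eq_0: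
  fixes F :: "'a :: euclidean_space \<Rightarrow> 'b :: {banach, second_countable_topology}"
  assumes D: "\<And>x. (F has_derivative D x) (at x)"
    and cont: "continuous_on UNIV (\<lambda>x. D x d)"
    and supp: "\<And>x. norm x > R \<Longrightarrow> F x = 0"
  shows "(LINT x|lborel. D x d) = 0"
proof -
  have contF: "continuous_on UNIV F"
    using D by (meson continuous_at_imp_continuous_on has_derivative_continuous)
  have intF: "integrable lborel F" by (rule integrable_continuous_compact_support[OF contF supp])
  have [measurable]: "F \<in> borel_measurable borel" using contF by (rule borel_measurable_continuous_onI)
  have [measurable]: "(\<lambda>x. D x d) \<in> borel_measurable borel" using cont by (rule borel_measurable_continuous_onI)
  have D0: "D x d = 0" if x: "norm x > R" for x
    by (simp add: derivative_outside_support[OF D supp x])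
  have "compact ((\<lambda>x. D x d) ` cball 0 R)"
    by (intro compact_continuous_image continuous_on_subset[OF cont]) auto
  then obtain B0 where "\<forall>x\<in>cball 0 R. norm (D x d) \<le> B0"
    using compact_imp_bounded[of "(\<lambda>x. D x d) ` cball 0 R"] unfolding bounded_iff by auto
  then have B0: "norm (D x d) \<le> B0" if "norm x \<le> R" for x using that by simp
  define B where "B = max B0 0"
  have B: "norm (D x d) \<le> B" for x
    using B0[of x] D0[of x] by (cases "norm x \<le> R") (auto simp: B_def)
  have lip: "norm (F (x + t *\<^sub>R d) - F x) \<le> B * t" if t: "t \<ge> 0" for x t
  proof -
    have "norm (F (x + t *\<^sub>R d) - F (x + 0 *\<^sub>R d)) \<le> B * norm (t - 0)"
    proof (rule differentiable_bound[of "{0..t}"])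
      fix s assume "s \<in> {0..t}"
      show "((\<lambda>s. F (x + s *\<^sub>R d)) has_derivative (\<lambda>h. h *\<^sub>R D (x + s *\<^sub>R d) d)) (at s within {0..t})"
      proof -
        interpret bounded_linear "D (x + s *\<^sub>R d)" using D by (rule has_derivative_bounded_linear)
        have "((\<lambda>s. x + s *\<^sub>R d) has_derivative (\<lambda>h. h *\<^sub>R d)) (at s within {0..t})"
          by (auto intro!: derivative_eq_intros)
        from has_derivative_compose[OF this D] show ?thesis by (simp add: scaleR)
      qed
      show "onorm (\<lambda>h. h *\<^sub>R D (x + s *\<^sub>R d) d) \<le> B"
        using B by (intro onorm_le) (simp add: mult.commute[of B] mult_left_mono)
    qed (use t in auto)
    then show ?thesis using t by simp
  qed
  define t :: "nat \<Rightarrow> real" where "t n = inverse (real (Suc n))" for n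
  have t: "t n > 0" "t n \<le> 1" for n by (auto simp: t_def field_simps)
  define g where "g n x = (1 / t n) *\<^sub>R (F (x + t n *\<^sub>R d) - F x)" for n x
  have int_g: "(LINT x|lborel. g n x) = 0" for n
    unfolding g_def
    by (simp add: intF lborel_integrable_translation lborel_integral_translation)
  have "(\<lambda>n. LINT x|lborel. g n x) \<longlonglongrightarrow> (LINT x|lborel. D x d)"
  proof (rule integral_dominated_convergence)
    show "integrable lborel (\<lambda>x. B * indicator (cball 0 (R + norm d)) x :: real)"
      by (intro integrable_mult_right integrable_real_indicator emeasure_compact_finite compact_cball) simp
    show "AE x in lborel. (\<lambda>n. g n x) \<longlonglongrightarrow> D x d"
    proof (rule AE_I2)
      fix x
      interpret bounded_linear "D x" using D by (rule has_derivative_bounded_linear)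
      have "((\<lambda>s. x + s *\<^sub>R d) has_derivative (\<lambda>h. h *\<^sub>R d)) (at 0)"
        by (auto intro!: derivative_eq_intros)
      moreover have "(F has_derivative D x) (at (x + 0 *\<^sub>R d))" using D by simp
      ultimately have "((\<lambda>s. F (x + s *\<^sub>R d)) has_derivative (\<lambda>h. D x (h *\<^sub>R d))) (at 0)"
        by (rule has_derivative_compose)
      then have "(\<lambda>s. norm (F (x + s *\<^sub>R d) - F x - s *\<^sub>R D x d) / norm s) \<midarrow>0\<rightarrow> 0"
        by (simp add: has_derivative_at scaleR)
      then have "(\<lambda>s. norm ((1 / s) *\<^sub>R (F (x + s *\<^sub>R d) - F x) - D x d)) \<midarrow>0\<rightarrow> 0"
      proof (rule Lim_transform_eventually)
        have "norm (F (x + s *\<^sub>R d) - F x - s *\<^sub>R D x d) / norm s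
          = norm ((1 / s) *\<^sub>R (F (x + s *\<^sub>R d) - F x) - D x d)" if "s \<noteq> 0" for s
        proof -
          have "(1 / s) *\<^sub>R (F (x + s *\<^sub>R d) - F x) - D x d
            = (1 / s) *\<^sub>R (F (x + s *\<^sub>R d) - F x - s *\<^sub>R D x d)"
            using that by (simp add: scaleR_diff_right)
          then show ?thesis by simp
        qed
        then show "\<forall>\<^sub>F s in at 0. norm (F (x + s *\<^sub>R d) - F x - s *\<^sub>R D x d) / norm s
          = norm ((1 / s) *\<^sub>R (F (x + s *\<^sub>R d) - F x) - D x d)"
          by (auto simp: eventually_at_filter)
      qed
      then have "(\<lambda>s. (1 / s) *\<^sub>R (F (x + s *\<^sub>R d) - F x)) \<midarrow>0\<rightarrow> D x d"
        by (rule LIM_zero_cancel[OF tendsto_norm_zero_cancel])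
      moreover have "filterlim t (at 0) sequentially"
        using t(1) LIMSEQ_inverse_real_of_nat 
        by (intro filterlim_atI) (auto simp: t_def[abs_def] intro!: always_eventually)
      ultimately show "(\<lambda>n. g n x) \<longlonglongrightarrow> D x d"
        unfolding g_def by (rule filterlim_compose)
    qed
    show "AE x in lborel. norm (g n x) \<le> B * indicator (cball 0 (R + norm d)) x" for n
    proof (rule AE_I2)
      fix x :: 'a
      show "norm (g n x) \<le> B * indicator (cball 0 (R + norm d)) x"
      proof (cases "norm x \<le> R + norm d")
        case True
        then show ?thesis using lip[of "t n" x] t(1)[of n]
          unfolding g_def norm_scaleR by (simp add: divide_le_eq del: scaleR_diff_right)
      next
        case False
        have "norm (t n *\<^sub>R d) \<le> norm d" using t(1)[of n] t(2)[of n] by (simp add: mult_left_le_one_le)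
        then have "norm (x + t n *\<^sub>R d) > R" using False norm_diff_ineq[of x "t n *\<^sub>R d"] by linarith
        moreover have "norm x > R" using False norm_ge_zero[of d] by linarith
        ultimately show ?thesis using False by (simp add: g_def supp)
      qed
    qed
    show "g n \<in> borel_measurable lborel" for n unfolding g_def by measurable
  qed auto
  then show ?thesis unfolding int_g by (simp add: LIMSEQ_const_iff)
qed

lemma lebesgue_integral_lborel:
  fixes f :: "'a :: euclidean_space \<Rightarrow> 'b :: {banach, second_countable_topology}"
  shows "f \<in> borel_measurable borel \<Longrightarrow> (LINT x|lebesgue. f x) = (LINT x|lborel. f x)"
  by (simp add: integral_completion)

lemma locally_integrable_continuous:
  assumes "continuous_on UNIV f"
  shows "locally_integrable f"
  unfolding locally_integrable_def
proof (intro allI impI)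
  fix K :: "complex set" assume K: "compact K"
  have "integrable lborel (\<lambda>x. indicator K x *\<^sub>R f x)"
    by (rule borel_integrable_compact[OF K continuous_on_subset[OF assms]]) simp
  then show "f absolutely_integrable_on K"
    unfolding set_integrable_def by (subst integrable_completion) (auto dest: borel_measurable_integrable)
qed

text \<open>
  For a test function \<open>\<psi>\<close>, the sum of the two integrands is the \<open>zbar\<close>-derivative of the compactly supported function
  \<open>u \<psi>\<close>, and so a combination of directional derivatives, which integrate to zero.
\<close>

lemma classical_imp_weak_d_zbar:
  assumes u: "wirtinger u a b" and cont: "continuous_on UNIV a" "continuous_on UNIV b"
  shows "weak_d_zbar u b"
  unfolding weak_d_zbar_def
proof (intro conjI allI impI locally_integrable_continuous cont wirtinger_continuous[OF u])
  fix \<psi> assume \<psi>: "test_function \<psi>"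
  then have smooth: "times_cont_diff (Suc 0) \<psi>" and comp: "compact (closure {z. \<psi> z \<noteq> 0})"
    by (auto simp: test_function_def simp del: times_cont_diff.simps)
  obtain D where D: "\<And>z. (\<psi> has_derivative D z) (at z)"
    "continuous_on UNIV (\<lambda>z. D z 1)" "continuous_on UNIV (\<lambda>z. D z \<i>)"
    using times_cont_diff_SucE[OF smooth] by auto
  obtain R where R: "\<And>z. \<psi> z \<noteq> 0 \<Longrightarrow> norm z \<le> R"
    using bounded_subset[OF compact_imp_bounded[OF comp] closure_subset] by (auto simp: bounded_iff)
  then have supp: "\<psi> z = 0" if "norm z > R" for z using that by force
  have cont\<psi>: "continuous_on UNIV \<psi>"
    using D(1) by (meson continuous_at_imp_continuous_on has_derivative_continuous)
  have contu: "continuous_on UNIV u" using wirtinger_continuous[OF u] .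
  have D0: "D z = (\<lambda>h. 0)" if z: "norm z > R" for z
    by (rule derivative_outside_support[OF D(1) supp z])
  define E where "E z h = u z * D z h + (a z * h + b z * cnj h) * \<psi> z" for z h
  have E: "((\<lambda>z. u z * \<psi> z) has_derivative E z) (at z)" for z
    unfolding E_def by (rule has_derivative_mult[OF wirtinger_has_derivative[OF u] D(1)])
  have contE: "continuous_on UNIV (\<lambda>z. E z 1)" "continuous_on UNIV (\<lambda>z. E z \<i>)"
    unfolding E_def by (intro continuous_intros D cont contu cont\<psi>)+
  have E_int: "(LINT z|lborel. E z 1) = 0" "(LINT z|lborel. E z \<i>) = 0"
    using integral_directional_derivative_eq_0[OF E contE(1), of R]
      integral_directional_derivative_eq_0[OF E contE(2), of R] by (simp_all add: supp)
  have E_integrable: "integrable lborel (\<lambda>z. E z 1)" "integrable lborel (\<lambda>z. E z \<i>)"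
    by (intro integrable_continuous_compact_support[of _ R] contE; simp add: E_def supp D0)+
  have dz: "d_zbar \<psi> z = (D z 1 + \<i> * D z \<i>) / 2" for z
    by (simp add: d_zbar_def frechet_derivative_eq[OF D(1)])
  have eq: "u z * d_zbar \<psi> z + b z * \<psi> z = (E z 1 + \<i> * E z \<i>) / 2" for z
    by (simp add: dz E_def algebra_simps add_divide_distrib)
  have cont1: "continuous_on UNIV (\<lambda>z. u z * d_zbar \<psi> z)"
    unfolding dz by (intro continuous_intros D contu) auto
  have cont2: "continuous_on UNIV (\<lambda>z. b z * \<psi> z)"
    by (intro continuous_intros cont cont\<psi>)
  have int1: "integrable lborel (\<lambda>z. u z * d_zbar \<psi> z)"
    by (rule integrable_continuous_compact_support[OF cont1, of R]) (simp add: dz D0)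
  have int2: "integrable lborel (\<lambda>z. b z * \<psi> z)"
    by (rule integrable_continuous_compact_support[OF cont2, of R]) (simp add: supp)
  have "(LINT z|lborel. u z * d_zbar \<psi> z) + (LINT z|lborel. b z * \<psi> z) = 
      (LINT z|lborel. (E z 1 + \<i> * E z \<i>) / 2)"
    unfolding eq[symmetric] by (rule Bochner_Integration.integral_add[symmetric, OF int1 int2])
  also have "\<dots> = 0" using E_integrable E_int by simp
  finally show "(LINT z|lebesgue. u z * d_zbar \<psi> z) = - (LINT z|lebesgue. b z * \<psi> z)"
    using cont1 cont2 by (simp add: lebesgue_integral_lborel borel_measurable_continuous_onI eq_neg_iff_add_eq_0)
qed

section \<open>The Gaussian measure on the complex plane\<close>

lemma nn_integral_gaussian_finite:
  assumes "c > 0"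
  shows "(\<integral>\<^sup>+x. ennreal (exp (- (c * x\<^sup>2))) \<partial>lborel) < \<infinity>"
proof -
  define \<sigma> where "\<sigma> = 1 / sqrt (2 * c)"
  have \<sigma>: "\<sigma> > 0" "2 * \<sigma>\<^sup>2 = 1 / c" using assms by (auto simp: \<sigma>_def power_divide)
  have "integrable lborel (normal_density 0 \<sigma>)" by (rule integrable_normal_density[OF \<sigma>(1)])
  then have "integrable lborel (\<lambda>x. sqrt (2 * pi * \<sigma>\<^sup>2) * normal_density 0 \<sigma> x)" by simp
  moreover have "sqrt (2 * pi * \<sigma>\<^sup>2) * normal_density 0 \<sigma> x = exp (- (c * x\<^sup>2))" for x
    using \<sigma> assms unfolding normal_density_def by (simp add: divide_simps mult.commute)
  ultimately have "integrable lborel (\<lambda>x::real. exp (- (c * x\<^sup>2)))" by simp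
  then show ?thesis by (simp add: integrable_iff_bounded)
qed

text \<open>
  The Gaussian is the product of Gaussians in the two real coordinates.
\<close>

lemma integrable_gaussian_complex:
  assumes "c > 0"
  shows "integrable lborel (\<lambda>z :: complex. exp (- (c * (cmod z)\<^sup>2)))"
proof (rule integrableI_bounded)
  have "(\<integral>\<^sup>+z. ennreal (norm (exp (- (c * (cmod z)\<^sup>2)))) \<partial>lborel)
    = (\<integral>\<^sup>+z. (\<Prod>b\<in>Basis. ennreal (exp (- (c * ((z::complex) \<bullet> b)\<^sup>2)))) \<partial>lborel)"
    by (intro nn_integral_cong)
      (simp add: Basis_complex_def inner_complex_def cmod_power2 algebra_simps ennreal_mult'[symmetric] exp_add[symmetric] exp_diff exp_minus divide_inverse)
  also have "\<dots> = (\<Prod>b\<in>(Basis :: complex set). (\<integral>\<^sup>+x. ennreal (exp (- (c * x\<^sup>2))) \<partial>lborel))"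
    by (rule nn_integral_lborel_prod) auto
  also have "\<dots> < \<infinity>"
    using nn_integral_gaussian_finite[OF assms] by (simp add: Basis_complex_def ennreal_mult_less_top)
  finally show "(\<integral>\<^sup>+z. ennreal (norm (exp (- (c * (cmod (z::complex))\<^sup>2)))) \<partial>lborel) < \<infinity>" .
qed simp

abbreviation gauss :: "complex measure" where
  "gauss \<equiv> weighted_measure (\<lambda>z. (cmod z)\<^sup>2)"

lemma borel_measurable_gauss: "f \<in> borel_measurable borel \<Longrightarrow> f \<in> borel_measurable gauss"
  unfolding weighted_measure_def by (simp add: measurable_completion)

lemma measurable_gauss_iff: "f \<in> borel_measurable gauss \<longleftrightarrow> f \<in> borel_measurable lebesgue"
  by (simp add: weighted_measure_def)

lemma gauss_weight_measurable [measurable]: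
  "(\<lambda>z. exp (- (cmod z)\<^sup>2)) \<in> borel_measurable lebesgue"
  by (rule measurable_completion) simp

lemma integral_gauss:
  fixes f :: "complex \<Rightarrow> 'b :: {banach, second_countable_topology}"
  assumes "f \<in> borel_measurable lebesgue"
  shows "(LINT z|gauss. f z) = (LINT z|lebesgue. exp (- (cmod z)\<^sup>2) *\<^sub>R f z)"
  unfolding weighted_measure_def using assms by (intro integral_density) auto

lemma integrable_gauss_iff:
  fixes f :: "complex \<Rightarrow> 'b :: {banach, second_countable_topology}"
  assumes "f \<in> borel_measurable lebesgue"
  shows "integrable gauss f \<longleftrightarrow> integrable lebesgue (\<lambda>z. exp (- (cmod z)\<^sup>2) *\<^sub>R f z)"
  unfolding weighted_measure_def using assms by (intro integrable_density) auto

lemma AE_gauss_iff: "(AE z in gauss. P z) \<longleftrightarrow> (AE z in lebesgue. P z)"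
  unfolding weighted_measure_def by (subst AE_density) auto

text \<open>
  Squaring the bound gives \<open>exp (|z|\<^sup>2 / 2)\<close>, which leaves \<open>exp (- |z|\<^sup>2 / 2)\<close> after multiplication by the weight.
\<close>

lemma L2_gauss_growth:
  assumes f: "f \<in> borel_measurable borel"
    and bound: "\<And>z. cmod (f z) \<le> C * exp ((cmod z)\<^sup>2 / 4)"
  shows "f \<in> L2 gauss"
proof -
  have [measurable]: "f \<in> borel_measurable lebesgue" using f by (simp add: measurable_completion)
  have "integrable lebesgue (\<lambda>z. exp (- (cmod z)\<^sup>2) *\<^sub>R (cmod (f z))\<^sup>2)"
  proof (rule Bochner_Integration.integrable_bound)
    show "integrable lebesgue (\<lambda>z::complex. C\<^sup>2 * exp (- (1/2 * (cmod z)\<^sup>2)))"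
      using integrable_gaussian_complex[of "1/2"]
      by (intro integrable_mult_right) (auto simp: integrable_completion)
    show "AE z in lebesgue. norm (exp (- (cmod z)\<^sup>2) *\<^sub>R (cmod (f z))\<^sup>2)
        \<le> norm (C\<^sup>2 * exp (- (1/2 * (cmod z)\<^sup>2)))"
    proof (rule AE_I2)
      fix z
      have "(cmod (f z))\<^sup>2 \<le> (C * exp ((cmod z)\<^sup>2 / 4))\<^sup>2"
        by (intro power_mono bound) simp
      also have "\<dots> = C\<^sup>2 * exp ((cmod z)\<^sup>2 / 2)"
        by (simp add: power_mult_distrib exp_double[symmetric])
      finally have "exp (- (cmod z)\<^sup>2) * (cmod (f z))\<^sup>2 \<le> exp (- (cmod z)\<^sup>2) * (C\<^sup>2 * exp ((cmod z)\<^sup>2 / 2))"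
        by (intro mult_left_mono) auto
      also have "\<dots> = C\<^sup>2 * exp (- (1/2 * (cmod z)\<^sup>2))"
        by (simp add: exp_add[symmetric] mult.left_commute)
      finally show "norm (exp (- (cmod z)\<^sup>2) *\<^sub>R (cmod (f z))\<^sup>2) \<le> norm (C\<^sup>2 * exp (- (1/2 * (cmod z)\<^sup>2)))"
        by simp
    qed
  qed measurable
  then show ?thesis
    using f by (simp add: L2_def borel_measurable_gauss integrable_gauss_iff)
qed

definition poly_growth :: "(complex \<Rightarrow> complex) \<Rightarrow> bool" where
  "poly_growth f \<longleftrightarrow> (\<exists>C n. \<forall>z. cmod (f z) \<le> C * (1 + cmod z) ^ n)"

lemma poly_growthI: "(\<And>z. cmod (f z) \<le> C * (1 + cmod z) ^ n) \<Longrightarrow> poly_growth f"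
  unfolding poly_growth_def by blast

lemma poly_growthE:
  assumes "poly_growth f"
  obtains C n where "C \<ge> 0" "\<And>z m. m \<ge> n \<Longrightarrow> cmod (f z) \<le> C * (1 + cmod z) ^ m"
proof -
  obtain C n where C: "\<And>z. cmod (f z) \<le> C * (1 + cmod z) ^ n"
    using assms unfolding poly_growth_def by blast
  have "C \<ge> 0" using order_trans[OF norm_ge_zero C[of 0]] by simp
  moreover have "cmod (f z) \<le> C * (1 + cmod z) ^ m" if "m \<ge> n" for z m
    using C[of z] mult_left_mono[OF power_increasing[OF that, of "1 + cmod z"] \<open>C \<ge> 0\<close>] by simp
  ultimately show ?thesis using that by blast
qed

lemma poly_growth_const: "poly_growth (\<lambda>z. c)"
  by (rule poly_growthI[of _ "cmod c" 0]) simp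

lemma poly_growth_ident: "poly_growth (\<lambda>z. z)"
  by (rule poly_growthI[of _ 1 1]) simp

lemma poly_growth_cnj: "poly_growth f \<Longrightarrow> poly_growth (\<lambda>z. cnj (f z))"
  by (simp add: poly_growth_def)

lemma poly_growth_add:
  assumes "poly_growth f" "poly_growth g"
  shows "poly_growth (\<lambda>z. f z + g z)"
proof -
  obtain C n where f: "\<And>z m. m \<ge> n \<Longrightarrow> cmod (f z) \<le> C * (1 + cmod z) ^ m" using poly_growthE[OF assms(1)] by metis
  obtain D k where g: "\<And>z m. m \<ge> k \<Longrightarrow> cmod (g z) \<le> D * (1 + cmod z) ^ m" using poly_growthE[OF assms(2)] by metis
  show ?thesis
  proof (rule poly_growthI)
    fix z
    show "cmod (f z + g z) \<le> (C + D) * (1 + cmod z) ^ (n + k)"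
      using norm_triangle_ineq[of "f z" "g z"] f[of "n + k" z] g[of "n + k" z] by (simp add: ring_distribs)
  qed
qed

lemma poly_growth_mult:
  assumes "poly_growth f" "poly_growth g"
  shows "poly_growth (\<lambda>z. f z * g z)"
proof -
  obtain C n where f: "C \<ge> 0" "\<And>z m. m \<ge> n \<Longrightarrow> cmod (f z) \<le> C * (1 + cmod z) ^ m" using poly_growthE[OF assms(1)] by metis
  obtain D k where g: "\<And>z m. m \<ge> k \<Longrightarrow> cmod (g z) \<le> D * (1 + cmod z) ^ m" using poly_growthE[OF assms(2)] by metis
  show ?thesis
  proof (rule poly_growthI)
    fix z
    have "cmod (f z) * cmod (g z) \<le> (C * (1 + cmod z) ^ n) * (D * (1 + cmod z) ^ k)"
      using f by (intro mult_mono f(2) g) auto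
    then show "cmod (f z * g z) \<le> (C * D) * (1 + cmod z) ^ (n + k)"
      by (simp add: norm_mult power_add mult_ac)
  qed
qed

lemma power_le_fact_exp: "x \<ge> 0 \<Longrightarrow> x ^ n \<le> fact n * exp (x :: real)"
proof -
  assume x: "x \<ge> 0"
  have "(\<Sum>k\<in>{n}. x ^ k /\<^sub>R fact k) \<le> exp x"
    unfolding exp_def using x by (intro sum_le_suminf summable_exp_generic) auto
  then show ?thesis by (simp add: field_simps)
qed

text \<open>
  \<open>x\<^sup>n \<le> n! exp x\<close> for \<open>x = 1 + |z|\<close>, and \<open>|z| \<le> c |z|\<^sup>2 + 1 / (4 c)\<close> by completing the square.
\<close>

lemma poly_growth_exp_bound:
  assumes "poly_growth f" "c > 0"
  obtains C where "C \<ge> 0" "\<And>z. cmod (f z) \<le> C * exp (c * (cmod z)\<^sup>2)"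
proof -
  obtain C n where f: "C \<ge> 0" "\<And>z m. m \<ge> n \<Longrightarrow> cmod (f z) \<le> C * (1 + cmod z) ^ m" using poly_growthE[OF assms(1)] by metis
  have "cmod (f z) \<le> (C * fact n * exp (1 + 1 / (4 * c))) * exp (c * (cmod z)\<^sup>2)" for z
  proof -
    have "0 \<le> (c * cmod z - 1/2)\<^sup>2 / c" using assms(2) by simp
    also have "\<dots> = c * (cmod z)\<^sup>2 - cmod z + 1 / (4 * c)"
      using assms(2) by (simp add: power2_diff field_simps power2_eq_square)
    finally have le: "1 + cmod z \<le> 1 + 1 / (4 * c) + c * (cmod z)\<^sup>2" by simp
    have "(1 + cmod z) ^ n \<le> fact n * exp (1 + cmod z)" by (rule power_le_fact_exp) simp
    also have "\<dots> \<le> fact n * exp (1 + 1 / (4 * c) + c * (cmod z)\<^sup>2)"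
      using le by (intro mult_left_mono) auto
    also have "\<dots> = fact n * exp (1 + 1 / (4 * c)) * exp (c * (cmod z)\<^sup>2)" by (simp only: exp_add mult.assoc)
    finally have "C * (1 + cmod z) ^ n \<le> C * (fact n * exp (1 + 1 / (4 * c)) * exp (c * (cmod z)\<^sup>2))"
      using f(1) by (rule mult_left_mono)
    then show ?thesis using f(2)[of n z] by (simp add: mult.assoc)
  qed
  then show ?thesis using f(1) by (intro that[of "C * fact n * exp (1 + 1 / (4 * c))"]) auto
qed

lemma L2_gauss_poly_growth:
  assumes "continuous_on UNIV f" "poly_growth f"
  shows "f \<in> L2 gauss"
proof -
  obtain C where "\<And>z. cmod (f z) \<le> C * exp ((1/4) * (cmod z)\<^sup>2)"
    using poly_growth_exp_bound[OF assms(2), of "1/4"] by auto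
  then show ?thesis
    using assms(1) by (intro L2_gauss_growth[of f C] borel_measurable_continuous_onI) auto
qed

text \<open>
  On a compact set the weight is bounded below, and \<open>2 |f| \<le> |f|\<^sup>2 + 1\<close>.
\<close>

lemma L2_gauss_locally_integrable:
  assumes f: "f \<in> L2 gauss"
  shows "locally_integrable f"
  unfolding locally_integrable_def
proof (intro allI impI)
  fix K :: "complex set" assume K: "compact K"
  then have K_meas [measurable]: "K \<in> sets lebesgue" 
    by (intro sets_completionI_sets) (simp add: borel_compact)
  obtain R where "R > 0" and R: "\<And>z. z \<in> K \<Longrightarrow> norm z \<le> R"
    using compact_imp_bounded[OF K] unfolding bounded_pos by blast
  have fm [measurable]: "f \<in> borel_measurable lebesgue"
    using f by (simp add: L2_def measurable_gauss_iff)
  have one: "(\<lambda>z. 1) \<in> L2 gauss" by (intro L2_gauss_poly_growth poly_growth_const continuous_on_const)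
  have "integrable gauss (\<lambda>z. (cmod (f z))\<^sup>2 + (cmod 1)\<^sup>2)"
    by (intro Bochner_Integration.integrable_add L2_integrable_square[OF f] L2_integrable_square[OF one])
  then have int: "integrable lebesgue (\<lambda>z. exp (- (cmod z)\<^sup>2) *\<^sub>R ((cmod (f z))\<^sup>2 + 1))"
    by (subst (asm) integrable_gauss_iff) auto
  have "integrable lebesgue (\<lambda>z. indicator K z *\<^sub>R f z)"
  proof (rule Bochner_Integration.integrable_bound)
    show "integrable lebesgue (\<lambda>z. exp (R\<^sup>2) * (exp (- (cmod z)\<^sup>2) *\<^sub>R ((cmod (f z))\<^sup>2 + 1)))"
      by (rule integrable_mult_right[OF int])
    show "AE z in lebesgue. norm (indicator K z *\<^sub>R f z)
        \<le> norm (exp (R\<^sup>2) * (exp (- (cmod z)\<^sup>2) *\<^sub>R ((cmod (f z))\<^sup>2 + 1)))"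
    proof (rule AE_I2)
      fix z
      show "norm (indicator K z *\<^sub>R f z) \<le> norm (exp (R\<^sup>2) * (exp (- (cmod z)\<^sup>2) *\<^sub>R ((cmod (f z))\<^sup>2 + 1)))"
      proof (cases "z \<in> K")
        case True
        then have "(cmod z)\<^sup>2 \<le> R\<^sup>2" using R by (intro power_mono) auto
        then have 1: "1 \<le> exp (R\<^sup>2) * exp (- (cmod z)\<^sup>2)" by (simp add: exp_add[symmetric])
        have "0 \<le> (cmod (f z) - 1)\<^sup>2" by simp
        then have "2 * cmod (f z) \<le> (cmod (f z))\<^sup>2 + 1" by (simp add: power2_diff)
        then have "1 * cmod (f z) \<le> (exp (R\<^sup>2) * exp (- (cmod z)\<^sup>2)) * ((cmod (f z))\<^sup>2 + 1)"
          using 1 norm_ge_zero[of "f z"] by (intro mult_mono) (auto simp del: norm_ge_zero)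
        then show ?thesis using True by (simp add: mult.assoc)
      qed simp
    qed
  qed measurable
  then show "f absolutely_integrable_on K" unfolding set_integrable_def .
qed


section \<open>Weak derivatives tested against polynomials\<close>

lemma flat_bounded: obtains B where "\<And>t. t \<le> 1 \<Longrightarrow> \<bar>flat p t\<bar> \<le> B"
proof -
  have "continuous_on {0..1} (flat p)"
    using flat_deriv by (intro continuous_at_imp_continuous_on ballI DERIV_isCont) blast
  then have "bounded (flat p ` {0..1})"
    by (intro compact_imp_bounded compact_continuous_image) auto
  then obtain B where B: "\<forall>t\<in>{0..1}. \<bar>flat p t\<bar> \<le> B" unfolding bounded_iff by auto
  then have "B \<ge> 0" using abs_ge_zero[of "flat p 0"] by force
  have "\<bar>flat p t\<bar> \<le> B" if "t \<le> 1" for t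
    using bspec[OF B, of t] \<open>B \<ge> 0\<close> that by (cases "t > 0") (simp, simp add: flat_def)
  then show ?thesis using that by blast
qed

text \<open>
  Supported in the closed ball of radius \<open>n + 1\<close>.  As \<open>n\<close> grows, the values at each point tend to \<open>exp (- 1)\<close>
  and the derivatives to zero; the constant \<open>exp (- 1)\<close> cancels from the identities obtained in the limit.
\<close>

definition cutoff :: "nat \<Rightarrow> complex \<Rightarrow> complex" where
  "cutoff n z = of_real (flat 1 (1 - (cmod z)\<^sup>2 / (real (Suc n))\<^sup>2))"

lemma times_cont_diff_cutoff_arg:
  "times_cont_diff k (\<lambda>z. complex_of_real (1 - (cmod z)\<^sup>2 / r))"
  using times_cont_diff_add[OF times_cont_diff_const[of k 1]
    times_cont_diff_mult[OF times_cont_diff_const[of k "- 1 / of_real r"] times_cont_diff_cmod_square[of k]]]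
  by (simp add: of_real_diff of_real_divide)

lemma times_cont_diff_cutoff: "times_cont_diff k (cutoff n)"
  unfolding cutoff_def[abs_def] by (rule times_cont_diff_flat[OF times_cont_diff_cutoff_arg])

lemma wirtinger_cutoff:
  "wirtinger (cutoff n)
    (\<lambda>z. of_real (flat (flat_step 1) (1 - (cmod z)\<^sup>2 / (real (Suc n))\<^sup>2)) * (- cnj z / (of_nat (Suc n))\<^sup>2))
    (\<lambda>z. of_real (flat (flat_step 1) (1 - (cmod z)\<^sup>2 / (real (Suc n))\<^sup>2)) * (- z / (of_nat (Suc n))\<^sup>2))"
  unfolding cutoff_def[abs_def]
proof (rule wirtinger_compose_real[OF _ flat_deriv])
  show "wirtinger (\<lambda>z. complex_of_real (1 - (cmod z)\<^sup>2 / (real (Suc n))\<^sup>2))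
      (\<lambda>z. - cnj z / (of_nat (Suc n))\<^sup>2) (\<lambda>z. - z / (of_nat (Suc n))\<^sup>2)"
    using wirtinger_add[OF wirtinger_const[of 1]
      wirtinger_scale[OF wirtinger_cmod_square, of "- 1 / (of_nat (Suc n))\<^sup>2"]]
    by (simp add: of_real_diff of_real_divide del: of_nat_Suc)
qed

lemma wirtinger_gaussian:
  "wirtinger (\<lambda>z. of_real (exp (- (cmod z)\<^sup>2))) (\<lambda>z. - of_real (exp (- (cmod z)\<^sup>2)) * cnj z)
    (\<lambda>z. - of_real (exp (- (cmod z)\<^sup>2)) * z)"
proof -
  have "((\<lambda>t. exp (- t)) has_real_derivative - exp (- t)) (at t)" for t :: real
    by (auto intro!: derivative_eq_intros)
  from wirtinger_compose_real[OF wirtinger_cmod_square this] show ?thesis by simp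
qed

lemma times_cont_diff_gaussian: "times_cont_diff k (\<lambda>z. complex_of_real (exp (- (cmod z)\<^sup>2)))"
proof -
  have "times_cont_diff k (\<lambda>z. complex_of_real (- (cmod z)\<^sup>2))" for k
    using times_cont_diff_mult[OF times_cont_diff_const[of k "-1"] times_cont_diff_cmod_square[of k]]
    by simp
  then show ?thesis by (rule times_cont_diff_exp)
qed

lemma cutoff_outside: "cmod z \<ge> real (Suc n) \<Longrightarrow> cutoff n z = 0"
proof -
  assume "cmod z \<ge> real (Suc n)"
  then have "(real (Suc n))\<^sup>2 \<le> (cmod z)\<^sup>2" by (intro power_mono) auto
  then have "1 - (cmod z)\<^sup>2 / (real (Suc n))\<^sup>2 \<le> 0" by (simp add: le_divide_eq del: of_nat_Suc)
  then have "\<not> 1 - (cmod z)\<^sup>2 / (real (Suc n))\<^sup>2 > 0" by linarith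
  then show ?thesis by (simp only: cutoff_def flat_def if_False of_real_0)
qed

text \<open>
  The identity results from testing with \<open>cnj q exp (- |z|\<^sup>2)\<close>: the \<open>zbar\<close>-derivative of this function is
  \<open>- cnj (zbar q - a) exp (- |z|\<^sup>2)\<close>.  It has no compact support and is multiplied by \<open>cutoff n\<close>.  The additional term
  from the derivative of the cutoff is dominated by a multiple of \<open>|z| |q|\<close> and tends to zero.
\<close>

lemma weak_d_zbar_inner:
  assumes u: "u \<in> L2 gauss" and v: "v \<in> L2 gauss" and uv: "weak_d_zbar u v"
    and smooth: "\<And>k. times_cont_diff k q" and q: "wirtinger q a b"
    and qL2: "q \<in> L2 gauss" and zqL2: "(\<lambda>z. cnj z * q z) \<in> L2 gauss" and aL2: "a \<in> L2 gauss"
  shows "L2_inner gauss v q = L2_inner gauss u (\<lambda>z. cnj z * q z - a z)"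
proof -
  define s where "s z = cnj z * q z - a z" for z
  have sL2: "s \<in> L2 gauss" unfolding s_def by (intro L2_diff zqL2 aL2)
  define \<rho> where "\<rho> n z = 1 - (cmod z)\<^sup>2 / (real (Suc n))\<^sup>2" for n z
  define \<chi>' where "\<chi>' n z = of_real (flat (flat_step 1) (\<rho> n z)) * (- z / (of_nat (Suc n))\<^sup>2)" for n z
  define \<psi> where "\<psi> n z = cutoff n z * (cnj (q z) * of_real (exp (- (cmod z)\<^sup>2)))" for n z
  have \<rho>_le: "\<rho> n z \<le> 1" for n z by (simp add: \<rho>_def)
  have \<rho>_lim: "(\<lambda>n. \<rho> n z) \<longlonglongrightarrow> 1" for z
  proof -
    have "(\<lambda>n. (cmod z)\<^sup>2 * (inverse (real (Suc n)))\<^sup>2) \<longlonglongrightarrow> (cmod z)\<^sup>2 * 0\<^sup>2"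
      by (intro tendsto_intros LIMSEQ_inverse_real_of_nat)
    from tendsto_diff[OF tendsto_const[of 1] this] show ?thesis
      by (simp add: \<rho>_def divide_inverse power_inverse del: of_nat_Suc)
  qed
  have flat_lim: "(\<lambda>n. flat p (\<rho> n z)) \<longlonglongrightarrow> flat p 1" for p z
    by (rule isCont_tendsto_compose[OF DERIV_isCont[OF flat_deriv] \<rho>_lim])
  have test: "test_function (\<psi> n)" for n
  proof -
    have "times_cont_diff k (\<psi> n)" for k
    proof -
      have "times_cont_diff k (\<lambda>z. cnj (q z))" by (rule times_cont_diff_cnj[OF smooth])
      then show ?thesis unfolding \<psi>_def
        by (intro times_cont_diff_mult times_cont_diff_cutoff times_cont_diff_gaussian)
    qed
    moreover have "compact (closure {z. \<psi> n z \<noteq> 0})"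
    proof -
      have "{z. \<psi> n z \<noteq> 0} \<subseteq> cball 0 (real (Suc n))"
      proof
        fix z assume "z \<in> {z. \<psi> n z \<noteq> 0}"
        then have "cutoff n z \<noteq> 0" by (simp add: \<psi>_def)
        then have "\<not> real (Suc n) \<le> cmod z" using cutoff_outside by blast
        then show "z \<in> cball 0 (real (Suc n))" unfolding mem_cball_0 by linarith
      qed
      then have "bounded {z. \<psi> n z \<noteq> 0}" by (rule bounded_subset[OF bounded_cball])
      then show ?thesis by (simp add: compact_closure)
    qed
    ultimately show ?thesis by (simp add: test_function_def)
  qed
  \<comment> \<open>The derivative falls on the cutoff (giving \<open>\<chi>'\<close>), on \<open>cnj q\<close> and on the Gaussian; the last two combine to \<open>cnj s\<close>.\<close>
  have dz: "d_zbar (\<psi> n) z = of_real (exp (- (cmod z)\<^sup>2)) * (\<chi>' n z * cnj (q z) - cutoff n z * cnj (s z))" for n z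
    unfolding \<psi>_def
    by (subst d_zbar_wirtinger[OF wirtinger_mult[OF wirtinger_cutoff wirtinger_mult[OF wirtinger_cnj[OF q] wirtinger_gaussian]]])
      (simp add: \<chi>'_def \<rho>_def s_def algebra_simps del: of_nat_Suc)
  have um [measurable]: "u \<in> borel_measurable lebesgue" and vm [measurable]: "v \<in> borel_measurable lebesgue"
    and qm [measurable]: "q \<in> borel_measurable lebesgue" and sm [measurable]: "s \<in> borel_measurable lebesgue"
    using u v qL2 sL2 by (auto simp: L2_def measurable_gauss_iff)
  have cm [measurable]: "cutoff n \<in> borel_measurable lebesgue" for n
    using wirtinger_continuous[OF wirtinger_cutoff] 
    by (intro measurable_completion) (auto intro: borel_measurable_continuous_onI)
  have [measurable]: "\<chi>' n \<in> borel_measurable lebesgue" for n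
  proof -
    have "continuous_on UNIV (flat (flat_step 1))"
      using flat_deriv by (intro continuous_at_imp_continuous_on ballI DERIV_isCont) blast
    then have "continuous_on UNIV (\<lambda>z. flat (flat_step 1) (\<rho> n z))"
      by (rule continuous_on_compose2) (auto simp: \<rho>_def intro!: continuous_intros simp del: of_nat_Suc)
    then have "continuous_on UNIV (\<chi>' n)" unfolding \<chi>'_def
      by (intro continuous_intros) (simp_all del: of_nat_Suc)
    then show ?thesis by (intro measurable_completion) (auto intro: borel_measurable_continuous_onI)
  qed
  have id: "(LINT z|gauss. u z * (\<chi>' n z * cnj (q z) - cutoff n z * cnj (s z)))
      = - (LINT z|gauss. v z * (cutoff n z * cnj (q z)))" for n
  proof -
    have "(LINT z|gauss. u z * (\<chi>' n z * cnj (q z) - cutoff n z * cnj (s z))) = (LINT z|lebesgue. u z * d_zbar (\<psi> n) z)"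
      by (subst integral_gauss) (auto simp: dz scaleR_conv_of_real mult_ac intro!: Bochner_Integration.integral_cong)
    also have "\<dots> = - (LINT z|lebesgue. v z * \<psi> n z)"
      using uv test by (auto simp: weak_d_zbar_def)
    also have "(LINT z|lebesgue. v z * \<psi> n z) = (LINT z|gauss. v z * (cutoff n z * cnj (q z)))"
      by (subst integral_gauss) (auto simp: \<psi>_def scaleR_conv_of_real mult_ac intro!: Bochner_Integration.integral_cong)
    finally show ?thesis .
  qed
  obtain B where B: "\<And>t. t \<le> 1 \<Longrightarrow> \<bar>flat 1 t\<bar> \<le> B" using flat_bounded by blast
  obtain B' where B': "\<And>t. t \<le> 1 \<Longrightarrow> \<bar>flat (flat_step 1) t\<bar> \<le> B'" using flat_bounded by blast
  have cutoff_le: "cmod (cutoff n z) \<le> B" for n z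
    using B[OF \<rho>_le] by (simp add: cutoff_def \<rho>_def)
  have B'0: "B' \<ge> 0" using B'[of 0] by (simp add: flat_def)
  have \<chi>'_le: "cmod (\<chi>' n z) \<le> B' * cmod z" for n z
  proof -
    have "cmod (- z / (of_nat (Suc n))\<^sup>2) \<le> cmod z"
    proof -
      have "1 \<le> (real (Suc n))\<^sup>2" by (simp add: one_le_power)
      then show ?thesis by (simp add: norm_divide norm_power divide_le_eq mult_le_cancel_left1 del: of_nat_Suc)
    qed
    then show ?thesis using B'[OF \<rho>_le[of n z]] B'0 unfolding \<chi>'_def norm_mult by (intro mult_mono) auto
  qed
  have cutoff_lim: "(\<lambda>n. cutoff n z) \<longlonglongrightarrow> of_real (exp (-1))" for z
    using tendsto_of_real[OF flat_lim[of 1 z], where 'a = complex] by (simp add: cutoff_def \<rho>_def flat_def)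
  have \<chi>'_lim: "(\<lambda>n. \<chi>' n z) \<longlonglongrightarrow> 0" for z
  proof -
    have "(\<lambda>n. of_real (flat (flat_step 1) (\<rho> n z)) * (- z * of_real ((inverse (real (Suc n)))\<^sup>2)))
      \<longlonglongrightarrow> of_real (flat (flat_step 1) 1) * (- z * of_real (0\<^sup>2))"
      by (intro tendsto_intros flat_lim LIMSEQ_inverse_real_of_nat)
    then show ?thesis by (simp add: \<chi>'_def divide_inverse power_inverse del: of_nat_Suc)
  qed
  have gm: "f \<in> borel_measurable gauss" if "f \<in> borel_measurable lebesgue" for f :: "complex \<Rightarrow> complex"
    using that by (simp add: measurable_gauss_iff)
  have lim1: "(\<lambda>n. LINT z|gauss. u z * (\<chi>' n z * cnj (q z) - cutoff n z * cnj (s z)))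
      \<longlonglongrightarrow> (LINT z|gauss. u z * (0 * cnj (q z) - of_real (exp (-1)) * cnj (s z)))"
  proof (rule integral_dominated_convergence)
    show "integrable gauss (\<lambda>z. B' * cmod (u z * cnj (cnj z * q z)) + B * cmod (u z * cnj (s z)))"
      by (intro Bochner_Integration.integrable_add integrable_mult_right integrable_norm L2_integrable_inner u zqL2 sL2)
    show "AE z in gauss. (\<lambda>n. u z * (\<chi>' n z * cnj (q z) - cutoff n z * cnj (s z)))
      \<longlonglongrightarrow> u z * (0 * cnj (q z) - of_real (exp (-1)) * cnj (s z))"
      by (intro AE_I2 tendsto_intros \<chi>'_lim cutoff_lim)
    show "AE z in gauss. norm (u z * (\<chi>' n z * cnj (q z) - cutoff n z * cnj (s z)))
      \<le> B' * cmod (u z * cnj (cnj z * q z)) + B * cmod (u z * cnj (s z))" for n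
    proof (rule AE_I2)
      fix z
      have "cmod (\<chi>' n z * cnj (q z) - cutoff n z * cnj (s z)) \<le> cmod (\<chi>' n z) * cmod (q z) + cmod (cutoff n z) * cmod (s z)"
        using norm_triangle_ineq4[of "\<chi>' n z * cnj (q z)" "cutoff n z * cnj (s z)"] by (simp add: norm_mult)
      also have "\<dots> \<le> (B' * cmod z) * cmod (q z) + B * cmod (s z)"
        by (intro add_mono mult_right_mono \<chi>'_le cutoff_le) auto
      finally have "cmod (u z) * cmod (\<chi>' n z * cnj (q z) - cutoff n z * cnj (s z))
        \<le> cmod (u z) * ((B' * cmod z) * cmod (q z) + B * cmod (s z))" by (intro mult_left_mono) auto
      also have "\<dots> = B' * cmod (u z * cnj (cnj z * q z)) + B * cmod (u z * cnj (s z))"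
        by (simp add: norm_mult algebra_simps)
      finally show "norm (u z * (\<chi>' n z * cnj (q z) - cutoff n z * cnj (s z)))
        \<le> B' * cmod (u z * cnj (cnj z * q z)) + B * cmod (u z * cnj (s z))"
        by (simp only: norm_mult[of "u z"])
    qed
  qed (auto intro!: gm)
  have lim2: "(\<lambda>n. LINT z|gauss. v z * (cutoff n z * cnj (q z)))
      \<longlonglongrightarrow> (LINT z|gauss. v z * (of_real (exp (-1)) * cnj (q z)))"
  proof (rule integral_dominated_convergence)
    show "integrable gauss (\<lambda>z. B * cmod (v z * cnj (q z)))"
      by (intro integrable_mult_right integrable_norm L2_integrable_inner v qL2)
    show "AE z in gauss. (\<lambda>n. v z * (cutoff n z * cnj (q z))) \<longlonglongrightarrow> v z * (of_real (exp (-1)) * cnj (q z))"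
      by (intro AE_I2 tendsto_intros cutoff_lim)
    show "AE z in gauss. norm (v z * (cutoff n z * cnj (q z))) \<le> B * cmod (v z * cnj (q z))" for n
    proof (rule AE_I2)
      fix z
      show "norm (v z * (cutoff n z * cnj (q z))) \<le> B * cmod (v z * cnj (q z))"
        using mult_right_mono[OF cutoff_le[of n z], of "cmod (v z) * cmod (q z)"]
        by (simp add: norm_mult mult_ac)
    qed
  qed (auto intro!: gm)
  have "(LINT z|gauss. u z * (0 * cnj (q z) - of_real (exp (-1)) * cnj (s z)))
     = - (LINT z|gauss. v z * (of_real (exp (-1)) * cnj (q z)))"
    using LIMSEQ_unique[OF lim1[unfolded id] tendsto_minus[OF lim2]] .
  moreover have "(\<lambda>z. u z * (0 * cnj (q z) - of_real (exp (-1)) * cnj (s z)))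
      = (\<lambda>z. (- of_real (exp (-1))) * (u z * cnj (s z)))"
    by (simp add: fun_eq_iff)
  moreover have "(\<lambda>z. v z * (of_real (exp (-1)) * cnj (q z))) = (\<lambda>z. of_real (exp (-1)) * (v z * cnj (q z)))"
    by (simp add: fun_eq_iff)
  ultimately have "- of_real (exp (-1)) * L2_inner gauss u s = - (of_real (exp (-1)) * L2_inner gauss v q)"
    unfolding L2_inner_def by (simp only: integral_mult_right_zero)
  then have "of_real (exp (-1)) * L2_inner gauss u s = of_real (exp (-1)) * L2_inner gauss v q"
    by (simp only: minus_mult_left[symmetric] neg_equal_iff_equal)
  then show ?thesis unfolding s_def by simp
qed

section \<open>Complex Hermite polynomials\<close>

text \<open>
  \<open>h\<^sub>m\<^sub>,\<^sub>k = (- d/dz + zbar)\<^sup>k z\<^sup>m\<close>, where the derivative has been replaced by its value \<open>m h\<^sub>m\<^sub>-\<^sub>1\<^sub>,\<^sub>k\<close>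
  (see \<open>wirtinger_hermite\<close> below).  The truncated difference \<open>m - 1\<close> does no harm, as its coefficient is zero
  for \<open>m = 0\<close>.
\<close>

fun hermite :: "nat \<Rightarrow> nat \<Rightarrow> complex \<Rightarrow> complex" where
  "hermite m 0 z = z ^ m"
| "hermite m (Suc k) z = cnj z * hermite m k z - of_nat m * hermite (m - 1) k z"

text \<open>
  This lemma and the next express multiplication by \<open>zbar\<close> and \<open>z\<close> within the family; they show that its linear
  span contains all polynomials.
\<close>

lemma hermite_raise_k: "cnj z * hermite m k z = hermite m (Suc k) z + of_nat m * hermite (m - 1) k z"
  by simp

lemma hermite_raise_m: "z * hermite m k z = hermite (Suc m) k z + of_nat k * hermite m (k - 1) z"
proof (induction k arbitrary: m)
  case (Suc k)
  have k: "of_nat k * (cnj z * hermite m (k - 1) z - of_nat m * hermite (m - 1) (k - 1) z) = of_nat k * hermite m k z"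
    by (cases k) auto
  have m: "of_nat m * hermite (Suc (m - 1)) k z = of_nat m * hermite m k z"
    by (cases m) auto
  have "z * hermite m (Suc k) z = cnj z * (z * hermite m k z) - of_nat m * (z * hermite (m - 1) k z)"
    by (simp add: algebra_simps)
  also have "\<dots> = cnj z * hermite (Suc m) k z - of_nat m * hermite (Suc (m - 1)) k z
      + of_nat k * (cnj z * hermite m (k - 1) z - of_nat m * hermite (m - 1) (k - 1) z)"
    unfolding Suc.IH by (simp add: algebra_simps)
  also have "\<dots> = hermite (Suc m) (Suc k) z + of_nat (Suc k) * hermite m k z"
    unfolding k m by (simp add: algebra_simps)
  finally show ?case by simp
qed simp

lemma hermite_0_left: "hermite 0 k z = cnj z ^ k"
  by (induction k) auto

text \<open>
  Both derivatives lower an index.  The first holds since \<open>d/dz\<close> commutes with \<open>- d/dz + zbar\<close>, the second is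
  the commutation relation of \<open>d/dzbar\<close> with \<open>- d/dz + zbar\<close>.
\<close>

lemma wirtinger_hermite:
  "wirtinger (hermite m k) (\<lambda>z. of_nat m * hermite (m - 1) k z) (\<lambda>z. of_nat k * hermite m (k - 1) z)"
proof (induction k arbitrary: m)
  case 0
  have "wirtinger (\<lambda>z. z ^ m) (\<lambda>z. of_nat m * z ^ (m - 1)) (\<lambda>z. 0)"
  proof (induction m)
    case (Suc m)
    have eq: "1 * z ^ m + z * (of_nat m * z ^ (m - 1)) = of_nat (Suc m) * z ^ (Suc m - 1)" for z :: complex
      by (cases m) (auto simp: algebra_simps)
    have "wirtinger (\<lambda>z. z * z ^ m) (\<lambda>z. of_nat (Suc m) * z ^ (Suc m - 1)) (\<lambda>z. 0 * z ^ m + z * 0)"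
      using wirtinger_mult[OF wirtinger_ident Suc] unfolding eq .
    then show ?case by simp
  qed (simp add: wirtinger_const)
  then show ?case by simp
next
  case (Suc k)
  have a: "cnj z * (of_nat m * hermite (m - 1) k z) + - of_nat m * (of_nat (m - 1) * hermite (m - 1 - 1) k z)
      = of_nat m * hermite (m - 1) (Suc k) z" for z
    by (simp add: algebra_simps)
  have k: "of_nat k * (cnj z * hermite m (k - 1) z - of_nat m * hermite (m - 1) (k - 1) z) = of_nat k * hermite m k z" for z
    by (cases k) auto
  have "hermite m k z + cnj z * (of_nat k * hermite m (k - 1) z) + - of_nat m * (of_nat k * hermite (m - 1) (k - 1) z)
      = hermite m k z + of_nat k * (cnj z * hermite m (k - 1) z - of_nat m * hermite (m - 1) (k - 1) z)" for z
    by (simp add: algebra_simps)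
  then have b: "hermite m k z + cnj z * (of_nat k * hermite m (k - 1) z) + - of_nat m * (of_nat k * hermite (m - 1) (k - 1) z)
      = of_nat (Suc k) * hermite m k z" for z
    unfolding k by (simp add: algebra_simps)
  have "wirtinger (\<lambda>z. cnj z * hermite m k z + - of_nat m * hermite (m - 1) k z)
     (\<lambda>z. cnj z * (of_nat m * hermite (m - 1) k z) + - of_nat m * (of_nat (m - 1) * hermite (m - 1 - 1) k z))
     (\<lambda>z. hermite m k z + cnj z * (of_nat k * hermite m (k - 1) z) + - of_nat m * (of_nat k * hermite (m - 1) (k - 1) z))"
    using wirtinger_add[OF wirtinger_mult[OF wirtinger_cnj[OF wirtinger_ident] Suc[of m]]
      wirtinger_scale[OF Suc[of "m - 1"], of "- of_nat m"]] by simp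
  then show ?case unfolding a b by simp
qed

declare hermite.simps [simp del]

lemma continuous_hermite: "continuous_on S (hermite m k)"
  by (rule wirtinger_continuous[OF wirtinger_hermite])

lemma times_cont_diff_hermite: "times_cont_diff j (hermite m k)"
proof (induction j arbitrary: m k)
  case 0
  then show ?case by (simp add: continuous_hermite)
next
  case (Suc j)
  show ?case
    by (rule times_cont_diff_SucI[OF wirtinger_has_derivative[OF wirtinger_hermite]])
      (intro times_cont_diff_add times_cont_diff_mult times_cont_diff_const Suc)+
qed

lemma poly_growth_hermite: "poly_growth (hermite m k)"
proof (induction k arbitrary: m)
  case 0
  have "poly_growth (\<lambda>z. z ^ m)"
    by (induction m) (auto intro: poly_growth_const poly_growth_mult poly_growth_ident)
  then show ?case by (simp add: hermite.simps)
next
  case (Suc k)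
  have "poly_growth (\<lambda>z. cnj z * hermite m k z + (- of_nat m) * hermite (m - 1) k z)"
    by (intro poly_growth_add poly_growth_mult poly_growth_const Suc poly_growth_cnj poly_growth_ident)
  then show ?case by (simp add: hermite.simps)
qed

lemma hermite_L2: "hermite m k \<in> L2 gauss"
  by (intro L2_gauss_poly_growth continuous_hermite poly_growth_hermite)

abbreviation gauss_dbar :: "complex L2_operator" where
  "gauss_dbar \<equiv> dbar (\<lambda>z. (cmod z)\<^sup>2)"

lemma dbar_hermite: "(hermite m k, \<lambda>z. of_nat k * hermite m (k - 1) z) \<in> gauss_dbar"
  unfolding dbar_def mem_Collect_eq prod.case
  by (intro conjI hermite_L2 L2_scale classical_imp_weak_d_zbar[OF wirtinger_hermite]
      continuous_on_mult continuous_on_const continuous_hermite)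

text \<open>
  This is \<open>weak_d_zbar_inner\<close> with \<open>q = h\<^sub>m\<^sub>,\<^sub>k\<close>, for which \<open>zbar q - dq/dz\<close> is \<open>h\<^sub>m\<^sub>,\<^sub>k\<^sub>+\<^sub>1\<close> by definition.
\<close>

lemma dbar_hermite_coeff:
  assumes "(u, v) \<in> gauss_dbar"
  shows "L2_inner gauss v (hermite m k) = L2_inner gauss u (hermite m (Suc k))"
proof -
  have "L2_inner gauss v (hermite m k)
      = L2_inner gauss u (\<lambda>z. cnj z * hermite m k z - of_nat m * hermite (m - 1) k z)"
  proof (rule weak_d_zbar_inner[OF _ _ _ times_cont_diff_hermite wirtinger_hermite hermite_L2])
    show "(\<lambda>z. cnj z * hermite m k z) \<in> L2 gauss"
      unfolding hermite_raise_k by (intro L2_add L2_scale hermite_L2)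
  qed (use assms in \<open>auto simp: dbar_def intro: L2_scale hermite_L2\<close>)
  also have "(\<lambda>z. cnj z * hermite m k z - of_nat m * hermite (m - 1) k z) = hermite m (Suc k)"
    by (rule ext) (simp add: hermite.simps)
  finally show ?thesis .
qed

text \<open>
  The squared norm of the constant \<open>1 = h\<^sub>0\<^sub>,\<^sub>0\<close>; it is a common factor of the squared norms of all \<open>h\<^sub>m\<^sub>,\<^sub>k\<close>.
\<close>

definition gauss_mass :: real where
  "gauss_mass = (L2_norm gauss (\<lambda>z. 1))\<^sup>2"

text \<open>
  \<open>dbar_hermite_coeff\<close> for the pair of \<open>h\<^sub>m\<^sub>,\<^sub>k\<close> and its derivative.  It moves one step of the ladder from one side to
  the other, and all orthogonality relations follow from it.
\<close>

lemma hermite_inner_step: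
  "of_nat k * L2_inner gauss (hermite m (k - 1)) (hermite m' k') =
    L2_inner gauss (hermite m k) (hermite m' (Suc k'))"
  using dbar_hermite_coeff[OF dbar_hermite] by (simp add: L2_inner_scale_left)

lemma hermite_inner_k:
  "L2_inner gauss (hermite m k) (hermite m' k') =
    (if k = k' then fact k * L2_inner gauss (hermite m 0) (hermite m' 0) else 0)"
proof (induction k arbitrary: k')
  case 0
  show ?case
  proof (cases k')
    case (Suc j)
    then show ?thesis using hermite_inner_step[of 0 m m' j] by simp
  qed simp
next
  case (Suc k)
  show ?case
  proof (cases k')
    case 0
    have "L2_inner gauss (hermite m' 0) (hermite m (Suc k)) = 0"
      using hermite_inner_step[of 0 m' m k] by simp
    then have "L2_inner gauss (hermite m (Suc k)) (hermite m' 0) = 0"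
      by (subst L2_inner_commute) simp
    then show ?thesis using 0 by simp
  next
    case k': (Suc j)
    have "L2_inner gauss (hermite m (Suc k)) (hermite m' (Suc j)) =
        of_nat (Suc k) * L2_inner gauss (hermite m k) (hermite m' j)"
      using hermite_inner_step[of "Suc k" m m' j] by simp
    also have "\<dots> = (if k = j then fact (Suc k) * L2_inner gauss (hermite m 0) (hermite m' 0) else 0)"
      unfolding Suc.IH[of j] by simp
    finally show ?thesis by (simp add: k')
  qed
qed

text \<open>
  \<open>h\<^sub>m\<^sub>,\<^sub>0 = z\<^sup>m\<close> is the conjugate of \<open>h\<^sub>0\<^sub>,\<^sub>m = zbar\<^sup>m\<close>, so that the relations in the second index
  apply.
\<close>

lemma hermite_inner_m:
  "L2_inner gauss (hermite m 0) (hermite m' 0) = (if m = m' then fact m * of_real gauss_mass else 0)"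
proof -
  have "L2_inner gauss (hermite m 0) (hermite m' 0) = cnj (L2_inner gauss (hermite 0 m) (hermite 0 m'))"
    by (simp add: L2_inner_def hermite_0_left hermite.simps flip: Bochner_Integration.integral_cnj)
  also have "\<dots> = (if m = m' then fact m * cnj (L2_inner gauss (hermite 0 0) (hermite 0 0)) else 0)"
    by (subst hermite_inner_k) simp
  also have "L2_inner gauss (hermite 0 0) (hermite 0 0) = of_real gauss_mass"
  proof -
    have "hermite 0 0 = (\<lambda>z. 1)" by (rule ext) (simp add: hermite.simps)
    then show ?thesis by (simp add: L2_inner_self gauss_mass_def)
  qed
  finally show ?thesis by simp
qed

lemma hermite_inner:
  "L2_inner gauss (hermite m k) (hermite m' k') =
    (if m = m' \<and> k = k' then of_real (fact m * fact k * gauss_mass) else 0)"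
  by (subst hermite_inner_k) (simp add: hermite_inner_m mult.commute mult.left_commute)

lemma gauss_mass_pos: "gauss_mass > 0"
proof -
  have one: "(\<lambda>z. 1) \<in> L2 gauss" by (intro L2_gauss_poly_growth poly_growth_const continuous_on_const)
  have "\<not> (AE z in gauss. (1 :: complex) = 0)"
    unfolding AE_gauss_iff
  proof
    assume "AE z in (lebesgue :: complex measure). (1 :: complex) = 0"
    then have "AE z in (lborel :: complex measure). False" by (simp add: AE_completion_iff)
    then have "emeasure lborel (UNIV :: complex set) = 0" by (simp add: AE_iff_measurable[of UNIV lborel])
    then show False by (simp add: emeasure_lborel_UNIV)
  qed
  then have "L2_norm gauss (\<lambda>z. 1) \<noteq> 0" using L2_norm_eq_0_iff[OF one] by blast
  then show ?thesis by (simp add: gauss_mass_def)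
qed

section \<open>Completeness of the polynomials\<close>

inductive hermite_span :: "(complex \<Rightarrow> complex) \<Rightarrow> bool" where
  base: "hermite_span (hermite m k)"
| add: "hermite_span p \<Longrightarrow> hermite_span q \<Longrightarrow> hermite_span (\<lambda>z. p z + q z)"
| scale: "hermite_span p \<Longrightarrow> hermite_span (\<lambda>z. c * p z)"

lemma hermite_span_mult_ident: "hermite_span p \<Longrightarrow> hermite_span (\<lambda>z. z * p z)"
proof (induction rule: hermite_span.induct)
  case (base m k)
  show ?case unfolding hermite_raise_m by (intro hermite_span.intros)
next
  case (add p q)
  from hermite_span.add[OF add.IH] show ?case by (simp add: ring_distribs)
next
  case (scale p c)
  from hermite_span.scale[OF scale.IH, of c] show ?case by (simp add: mult.left_commute)
qed

lemma hermite_span_mult_cnj: "hermite_span p \<Longrightarrow> hermite_span (\<lambda>z. cnj z * p z)"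
proof (induction rule: hermite_span.induct)
  case (base m k)
  show ?case unfolding hermite_raise_k by (intro hermite_span.intros)
next
  case (add p q)
  from hermite_span.add[OF add.IH] show ?case by (simp add: ring_distribs)
next
  case (scale p c)
  from hermite_span.scale[OF scale.IH, of c] show ?case by (simp add: mult.left_commute)
qed

lemma real_linear_wirtinger:
  assumes "bounded_linear (l :: complex \<Rightarrow> real)"
  shows "of_real (l z) = Complex (l 1) (- l \<i>) / 2 * z + Complex (l 1) (l \<i>) / 2 * cnj z"
proof -
  interpret bounded_linear l by fact
  have "l z = l (Re z *\<^sub>R 1 + Im z *\<^sub>R \<i>)"
    by (rule arg_cong[where f = l]) (simp add: complex_eq_iff)
  also have "\<dots> = Re z * l 1 + Im z * l \<i>" by (simp only: add scaleR real_scaleR_def)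
  finally show ?thesis by (simp add: complex_eq_iff field_simps)
qed

text \<open>
  With \<open>q = h\<^sub>0\<^sub>,\<^sub>0 = 1\<close>, every real polynomial in the two real coordinates is in the span.
\<close>

lemma hermite_span_mult_real_polynomial:
  "real_polynomial_function p \<Longrightarrow> hermite_span q \<Longrightarrow> hermite_span (\<lambda>z. of_real (p z) * q z)"
proof (induction p arbitrary: q rule: real_polynomial_function.induct)
  case (linear l)
  have "(\<lambda>z. of_real (l z) * q z) =
      (\<lambda>z. Complex (l 1) (- l \<i>) / 2 * (z * q z) + Complex (l 1) (l \<i>) / 2 * (cnj z * q z))"
    unfolding real_linear_wirtinger[OF linear(1)] by (simp add: fun_eq_iff algebra_simps)
  then show ?case using linear(2)
    by (simp only:) (intro hermite_span.add hermite_span.scale hermite_span_mult_ident hermite_span_mult_cnj)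
next
  case (const c)
  then show ?case by (rule hermite_span.scale)
next
  case (add f g)
  from hermite_span.add[OF add.IH(1)[OF add.prems] add.IH(2)[OF add.prems]]
  show ?case by (simp add: ring_distribs)
next
  case (mult f g)
  from mult.IH(1)[OF mult.IH(2)[OF mult.prems]] show ?case by (simp add: mult.assoc)
qed

lemma poly_growth_real_polynomial:
  "real_polynomial_function p \<Longrightarrow> poly_growth (\<lambda>z. of_real (p z))"
proof (induction p rule: real_polynomial_function.induct)
  case (linear l)
  show ?case unfolding real_linear_wirtinger[OF linear(1)]
    by (intro poly_growth_add poly_growth_mult poly_growth_const poly_growth_ident poly_growth_cnj)
qed (auto intro: poly_growth_const poly_growth_add poly_growth_mult)

lemma real_polynomial_continuous: "real_polynomial_function p \<Longrightarrow> continuous_on S p"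
  by (intro continuous_on_polymonial_function) (simp add: real_polynomial_function_eq[symmetric])

text \<open>
  One half of the admissible growth \<open>exp (|z|\<^sup>2 / 4)\<close> is spent on \<open>g\<close>, the other on the polynomial.
\<close>

lemma real_polynomial_mult_L2:
  assumes p: "real_polynomial_function p" and g: "g \<in> borel_measurable borel"
    and bound: "\<And>z. \<bar>g z\<bar> \<le> C * exp ((cmod z)\<^sup>2 / 8)"
  shows "(\<lambda>z. complex_of_real (g z * p z)) \<in> L2 gauss"
proof -
  obtain D where D: "D \<ge> 0" "\<And>z. cmod (of_real (p z)) \<le> D * exp (1/8 * (cmod z)\<^sup>2)"
    using poly_growth_exp_bound[OF poly_growth_real_polynomial[OF p], of "1/8"] by auto
  have C: "C \<ge> 0" using order_trans[OF abs_ge_zero bound[of 0]] by simp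
  have [measurable]: "p \<in> borel_measurable borel" 
    by (intro borel_measurable_continuous_onI real_polynomial_continuous p)
  note g [measurable]
  show ?thesis
  proof (rule L2_gauss_growth)
    show "(\<lambda>z. complex_of_real (g z * p z)) \<in> borel_measurable borel" by measurable
    fix z
    have "\<bar>g z\<bar> * \<bar>p z\<bar> \<le> (C * exp ((cmod z)\<^sup>2 / 8)) * (D * exp (1/8 * (cmod z)\<^sup>2))"
      using D(2)[of z] C by (intro mult_mono bound) auto
    also have "\<dots> = C * D * exp ((cmod z)\<^sup>2 / 4)" by (simp add: exp_add[symmetric])
    finally show "cmod (complex_of_real (g z * p z)) \<le> C * D * exp ((cmod z)\<^sup>2 / 4)" by (simp add: norm_mult)
  qed
qed

definition orthogonal_to_polynomials :: "(complex \<Rightarrow> complex) \<Rightarrow> bool" where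
  "orthogonal_to_polynomials f \<longleftrightarrow> f \<in> L2 gauss \<and>
    (\<forall>p. real_polynomial_function p \<longrightarrow> L2_inner gauss f (\<lambda>z. of_real (p z)) = 0)"

lemma real_polynomial_L2:
  assumes "real_polynomial_function p"
  shows "(\<lambda>z. complex_of_real (p z)) \<in> L2 gauss"
  by (intro L2_gauss_poly_growth poly_growth_real_polynomial assms continuous_on_of_real
      real_polynomial_continuous)

lemma orthogonal_to_hermite_imp_polynomials:
  assumes f: "f \<in> L2 gauss" and orth: "\<And>m k. L2_inner gauss f (hermite m k) = 0"
  shows "orthogonal_to_polynomials f"
proof -
  have "q \<in> L2 gauss \<and> L2_inner gauss q f = 0" if "hermite_span q" for q
    using that
  proof (induction rule: hermite_span.induct)
    case (base m k)
    have "L2_inner gauss (hermite m k) f = cnj (L2_inner gauss f (hermite m k))" by (rule L2_inner_commute)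
    then show ?case by (simp add: hermite_L2 orth)
  qed (auto simp: L2_inner_add_left f L2_inner_scale_left intro: L2_add L2_scale)
  note span = this
  have "L2_inner gauss f (\<lambda>z. of_real (p z)) = 0" if p: "real_polynomial_function p" for p
  proof -
    have "hermite_span (\<lambda>z. of_real (p z) * hermite 0 0 z)"
      by (intro hermite_span_mult_real_polynomial p hermite_span.base)
    then have "L2_inner gauss (\<lambda>z. of_real (p z)) f = 0" using span by (simp add: hermite.simps)
    then show ?thesis by (subst L2_inner_commute) simp
  qed
  then show ?thesis using f by (simp add: orthogonal_to_polynomials_def)
qed

text \<open>
  Dominated convergence, stated once for the two approximation steps below: polynomials to continuous
  functions, and continuous functions to indicators.
\<close>

lemma orthogonal_to_polynomials_limit:
  assumes f: "orthogonal_to_polynomials f"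
    and orth: "\<And>n. orthogonal_to_polynomials (\<lambda>z. of_real (g n z) * f z)"
    and lim: "\<And>z. (\<lambda>n. g n z) \<longlonglongrightarrow> h z"
    and meas: "\<And>n. g n \<in> borel_measurable borel"
    and bound: "\<And>n z. \<bar>g n z\<bar> \<le> B"
  shows "orthogonal_to_polynomials (\<lambda>z. of_real (h z) * f z)"
proof -
  have fL2: "f \<in> L2 gauss" using f by (simp add: orthogonal_to_polynomials_def)
  have h_bound: "\<bar>h z\<bar> \<le> B" for z
    by (rule tendsto_upperbound[OF tendsto_rabs[OF lim[of z]]]) (auto simp: bound)
  have h_meas: "h \<in> borel_measurable borel"
    by (rule borel_measurable_LIMSEQ_metric[OF meas lim])
  have gm: "(\<lambda>z. complex_of_real (g n z)) \<in> borel_measurable gauss" for n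
    using meas[of n] by (intro borel_measurable_gauss) measurable
  have hm: "(\<lambda>z. complex_of_real (h z)) \<in> borel_measurable gauss"
    using h_meas by (intro borel_measurable_gauss) measurable
  have hL2: "(\<lambda>z. of_real (h z) * f z) \<in> L2 gauss"
    by (rule L2_bounded_mult[OF fL2 hm, of B]) (simp add: h_bound)
  have "L2_inner gauss (\<lambda>z. of_real (h z) * f z) (\<lambda>z. of_real (p z)) = 0" if p: "real_polynomial_function p" for p
  proof -
    note pL2 = real_polynomial_L2[OF p]
    have "(\<lambda>n. LINT z|gauss. (of_real (g n z) * f z) * cnj (of_real (p z))) \<longlonglongrightarrow>
       (LINT z|gauss. (of_real (h z) * f z) * cnj (of_real (p z)))"
    proof (rule integral_dominated_convergence)
      show "integrable gauss (\<lambda>z. B * cmod (f z * cnj (of_real (p z))))"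
        by (intro integrable_mult_right integrable_norm L2_integrable_inner fL2 pL2)
      show "AE z in gauss. (\<lambda>n. (of_real (g n z) * f z) * cnj (of_real (p z))) \<longlonglongrightarrow> (of_real (h z) * f z) * cnj (of_real (p z))"
        by (intro AE_I2 tendsto_intros lim)
      show "AE z in gauss. norm ((of_real (g n z) * f z) * cnj (of_real (p z))) \<le> B * cmod (f z * cnj (of_real (p z)))" for n
      proof (rule AE_I2)
        fix z
        show "norm ((of_real (g n z) * f z) * cnj (of_real (p z))) \<le> B * cmod (f z * cnj (of_real (p z)))"
          using mult_right_mono[OF bound[of n z], of "cmod (f z) * \<bar>p z\<bar>"] by (simp add: norm_mult mult.assoc)
      qed
    qed (use L2_measurable[OF hL2] L2_measurable[OF pL2] L2_measurable[OF fL2] gm in measurable)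
    moreover have "(LINT z|gauss. (of_real (g n z) * f z) * cnj (of_real (p z))) = 0" for n
      using orth[of n] p unfolding orthogonal_to_polynomials_def L2_inner_def by blast
    ultimately show ?thesis unfolding L2_inner_def by (simp add: LIMSEQ_const_iff)
  qed
  then show ?thesis using hL2 by (simp add: orthogonal_to_polynomials_def)
qed

lemma real_polynomial_power: "real_polynomial_function p \<Longrightarrow> real_polynomial_function (\<lambda>z. p z ^ n)"
  by (induction n) auto

text \<open>
  The partial sums of the exponential series are polynomials.  They are dominated by
  \<open>exp (l\<^sup>2 / 16) \<le> C exp (|z|\<^sup>2 / 8)\<close>, which is in \<open>L\<^sup>2\<close> together with its product with any polynomial; this is the reason
  for the factor \<open>1/16\<close>.  The narrow range of this factor is harmless, because the new function again satisfies the hypothesis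
  and the step can be iterated.
\<close>

lemma orthogonal_to_polynomials_gaussian:
  assumes f: "orthogonal_to_polynomials f" and l: "real_polynomial_function l"
    and l_bound: "\<And>z. \<bar>l z\<bar> \<le> cmod z + c"
  shows "orthogonal_to_polynomials (\<lambda>z. of_real (exp (- (l z)\<^sup>2 / 16)) * f z)"
proof -
  have fL2: "f \<in> L2 gauss" using f by (simp add: orthogonal_to_polynomials_def)
  have lm [measurable]: "l \<in> borel_measurable borel" 
    by (intro borel_measurable_continuous_onI real_polynomial_continuous l)
  have L2: "(\<lambda>z. of_real (exp (- (l z)\<^sup>2 / 16)) * f z) \<in> L2 gauss"
    by (rule L2_bounded_mult[OF fL2, of _ 1]) (auto intro!: borel_measurable_gauss)
  have exp_bound: "\<bar>exp ((l z)\<^sup>2 / 16)\<bar> \<le> exp (c\<^sup>2 / 8) * exp ((cmod z)\<^sup>2 / 8)" for z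
  proof -
    have "(l z)\<^sup>2 \<le> (cmod z + c)\<^sup>2" using l_bound[of z] by (simp add: abs_le_square_iff[symmetric])
    also have "\<dots> \<le> 2 * (cmod z)\<^sup>2 + 2 * c\<^sup>2"
      using sum_squares_bound[of "cmod z" c] by (simp add: power2_sum)
    finally have "(l z)\<^sup>2 / 16 \<le> c\<^sup>2 / 8 + (cmod z)\<^sup>2 / 8" by simp
    then show ?thesis by (simp add: exp_add[symmetric])
  qed
  have "L2_inner gauss (\<lambda>z. of_real (exp (- (l z)\<^sup>2 / 16)) * f z) (\<lambda>z. of_real (p z)) = 0"
    if p: "real_polynomial_function p" for p
  proof -
    note pL2 = real_polynomial_L2[OF p]
    define T where "T N z = (\<Sum>n<N. (- (l z)\<^sup>2 / 16) ^ n / fact n)" for N z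
    have T_poly: "real_polynomial_function (T N)" for N
      unfolding T_def power2_eq_square
      by (intro real_polynomial_function_sum real_polynomial_function_divide real_polynomial_power
          real_polynomial_function_minus real_polynomial_function.intros(4) l) auto
    have T_lim: "(\<lambda>N. T N z) \<longlonglongrightarrow> exp (- (l z)\<^sup>2 / 16)" for z
    proof -
      have "x ^ n / fact n = x ^ n /\<^sub>R fact n" for x :: real and n by (simp add: field_simps)
      then show ?thesis using exp_converges[of "- (l z)\<^sup>2 / 16"] by (simp only: T_def sums_def)
    qed
    have T_bound: "\<bar>T N z\<bar> \<le> exp ((l z)\<^sup>2 / 16)" for N z
    proof -
      have "\<bar>T N z\<bar> \<le> (\<Sum>n<N. \<bar>(- (l z)\<^sup>2 / 16) ^ n / fact n\<bar>)" unfolding T_def by (rule sum_abs)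
      also have "\<dots> = (\<Sum>n<N. ((l z)\<^sup>2 / 16) ^ n /\<^sub>R fact n)"
      proof (intro sum.cong refl)
        fix n
        have "\<bar>(- (l z)\<^sup>2 / 16) ^ n / fact n\<bar> = \<bar>- (l z)\<^sup>2 / 16\<bar> ^ n / fact n"
          by (simp only: abs_divide power_abs abs_of_nonneg[OF fact_ge_zero])
        also have "\<bar>- (l z)\<^sup>2 / 16\<bar> = (l z)\<^sup>2 / 16" by simp
        finally show "\<bar>(- (l z)\<^sup>2 / 16) ^ n / fact n\<bar> = ((l z)\<^sup>2 / 16) ^ n /\<^sub>R fact n"
          by (simp only: real_scaleR_def divide_inverse_commute)
      qed
      also have "\<dots> \<le> exp ((l z)\<^sup>2 / 16)"
        unfolding exp_def by (intro sum_le_suminf summable_exp_generic) auto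
      finally show ?thesis .
    qed
    have eL2: "(\<lambda>z. complex_of_real (exp ((l z)\<^sup>2 / 16) * p z)) \<in> L2 gauss"
      by (rule real_polynomial_mult_L2[OF p _ exp_bound]) measurable
    have "(\<lambda>N. LINT z|gauss. f z * cnj (of_real (T N z * p z))) \<longlonglongrightarrow>
       (LINT z|gauss. f z * cnj (of_real (exp (- (l z)\<^sup>2 / 16) * p z)))"
    proof (rule integral_dominated_convergence)
      show "integrable gauss (\<lambda>z. cmod (f z * cnj (of_real (exp ((l z)\<^sup>2 / 16) * p z))))"
        by (intro integrable_norm L2_integrable_inner fL2 eL2)
      show "AE z in gauss. (\<lambda>N. f z * cnj (of_real (T N z * p z))) \<longlonglongrightarrow> f z * cnj (of_real (exp (- (l z)\<^sup>2 / 16) * p z))"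
        by (intro AE_I2 tendsto_intros T_lim)
      show "AE z in gauss. norm (f z * cnj (of_real (T N z * p z))) \<le> cmod (f z * cnj (of_real (exp ((l z)\<^sup>2 / 16) * p z)))" for N
      proof (rule AE_I2)
        fix z
        have "\<bar>T N z\<bar> * \<bar>p z\<bar> \<le> exp ((l z)\<^sup>2 / 16) * \<bar>p z\<bar>" by (intro mult_right_mono T_bound) simp
        then show "norm (f z * cnj (of_real (T N z * p z))) \<le> cmod (f z * cnj (of_real (exp ((l z)\<^sup>2 / 16) * p z)))"
          by (simp add: norm_mult mult_left_mono)
      qed
      show "(\<lambda>z. f z * cnj (of_real (T N z * p z))) \<in> borel_measurable gauss" for N
        using L2_integrable_inner[OF fL2 real_polynomial_L2[OF real_polynomial_function.intros(4)[OF T_poly[of N] p]]]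
        by (rule borel_measurable_integrable)
      have "(\<lambda>z. f z * cnj (of_real (exp (- (l z)\<^sup>2 / 16) * p z)))
         = (\<lambda>z. (of_real (exp (- (l z)\<^sup>2 / 16)) * f z) * cnj (of_real (p z)))" by (simp add: fun_eq_iff)
      then show "(\<lambda>z. f z * cnj (of_real (exp (- (l z)\<^sup>2 / 16) * p z))) \<in> borel_measurable gauss"
        by (simp only: borel_measurable_integrable[OF L2_integrable_inner[OF L2 pL2]])
    qed
    moreover have "(LINT z|gauss. f z * cnj (of_real (T N z * p z))) = 0" for N
      using f real_polynomial_function.intros(4)[OF T_poly[of N] p]
      unfolding orthogonal_to_polynomials_def L2_inner_def by blast
    ultimately have "(LINT z|gauss. f z * cnj (of_real (exp (- (l z)\<^sup>2 / 16) * p z))) = 0"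
      by (simp add: LIMSEQ_const_iff)
    then show ?thesis unfolding L2_inner_def by (simp add: mult_ac)
  qed
  then show ?thesis using L2 by (simp add: orthogonal_to_polynomials_def)
qed

lemma orthogonal_to_polynomials_add:
  "orthogonal_to_polynomials f \<Longrightarrow> orthogonal_to_polynomials g \<Longrightarrow> orthogonal_to_polynomials (\<lambda>z. f z + g z)"
  by (simp add: orthogonal_to_polynomials_def L2_add L2_inner_add_left real_polynomial_L2)

lemma orthogonal_to_polynomials_scale:
  "orthogonal_to_polynomials f \<Longrightarrow> orthogonal_to_polynomials (\<lambda>z. c * f z)"
  by (simp add: orthogonal_to_polynomials_def L2_scale L2_inner_scale_left)

text \<open>
  The induction is over the polynomial \<open>r\<close> for all \<open>f\<close> at once; for a product, the claim is used twice.
\<close>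

lemma orthogonal_to_polynomials_poly_gaussian:
  assumes l: "real_polynomial_function l" and l_bound: "\<And>z. \<bar>l z\<bar> \<le> cmod z + c"
  shows "real_polynomial_function (r :: real \<Rightarrow> real) \<Longrightarrow> orthogonal_to_polynomials f \<Longrightarrow>
    orthogonal_to_polynomials (\<lambda>z. of_real (r (exp (- (l z)\<^sup>2 / 16))) * f z)"
proof (induction r arbitrary: f rule: real_polynomial_function.induct)
  case (linear r)
  note orth = linear(2)
  interpret bounded_linear r by fact
  have "r x = r 1 * x" for x using scaleR[of x 1] by simp
  then have r_exp: "r (exp (- (l z)\<^sup>2 / 16)) = r 1 * exp (- (l z)\<^sup>2 / 16)" for z .
  have "(\<lambda>z. of_real (r (exp (- (l z)\<^sup>2 / 16))) * f z) =
      (\<lambda>z. of_real (r 1) * (of_real (exp (- (l z)\<^sup>2 / 16)) * f z))"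
    by (simp only: r_exp mult.assoc of_real_mult)
  then show ?case
    by (simp only: orthogonal_to_polynomials_scale[OF orthogonal_to_polynomials_gaussian[OF orth l l_bound]])
next
  case (const c)
  then show ?case by (rule orthogonal_to_polynomials_scale)
next
  case (add r s)
  from orthogonal_to_polynomials_add[OF add.IH(1)[OF add.prems] add.IH(2)[OF add.prems]]
  show ?case by (simp add: ring_distribs)
next
  case (mult r s)
  from mult.IH(1)[OF mult.IH(2)[OF mult.prems]] show ?case by (simp add: mult.assoc)
qed

lemma orthogonal_to_polynomials_continuous_gaussian:
  assumes l: "real_polynomial_function l" and l_bound: "\<And>z. \<bar>l z\<bar> \<le> cmod z + c"
    and r: "continuous_on {0..1} (r :: real \<Rightarrow> real)" and f: "orthogonal_to_polynomials f"
  shows "orthogonal_to_polynomials (\<lambda>z. of_real (r (exp (- (l z)\<^sup>2 / 16))) * f z)"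
proof -
  define E where "E z = exp (- (l z)\<^sup>2 / 16)" for z
  have E: "E z \<in> {0..1}" for z by (simp add: E_def)
  have "\<exists>g. real_polynomial_function g \<and> (\<forall>x\<in>{0..1}. \<bar>r x - g x\<bar> < inverse (real (Suc n)))" for n
    using Stone_Weierstrass_real_polynomial_function[OF compact_Icc r, of "inverse (real (Suc n))"]
    by (metis inverse_positive_iff_positive of_nat_0_less_iff zero_less_Suc)
  then obtain g where g: "\<And>n. real_polynomial_function (g n)"
    "\<And>n x. x \<in> {0..1} \<Longrightarrow> \<bar>r x - g n x\<bar> < inverse (real (Suc n))" by metis
  have "bounded (r ` {0..1})" by (intro compact_imp_bounded compact_continuous_image r) auto
  then obtain B where B: "\<forall>x\<in>{0..1}. \<bar>r x\<bar> \<le> B" unfolding bounded_iff by auto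
  have "orthogonal_to_polynomials (\<lambda>z. of_real (r (E z)) * f z)"
  proof (rule orthogonal_to_polynomials_limit[OF f])
    show "orthogonal_to_polynomials (\<lambda>z. of_real (g n (E z)) * f z)" for n
      unfolding E_def by (rule orthogonal_to_polynomials_poly_gaussian[OF l l_bound g(1) f])
    show "(\<lambda>n. g n (E z)) \<longlonglongrightarrow> r (E z)" for z
    proof (rule LIM_zero_cancel, rule Lim_null_comparison[OF _ LIMSEQ_inverse_real_of_nat])
      show "\<forall>\<^sub>F n in sequentially. norm (g n (E z) - r (E z)) \<le> inverse (real (Suc n))"
        using g(2)[OF E[of z]] by (intro always_eventually allI) (simp add: abs_minus_commute less_imp_le del: of_nat_Suc)
    qed
    have "continuous_on UNIV (\<lambda>z. g n (E z))" for n
      unfolding E_def by (intro continuous_on_compose2[OF real_polynomial_continuous[OF g(1), of UNIV]] 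
          continuous_intros real_polynomial_continuous l) auto
    then show "(\<lambda>z. g n (E z)) \<in> borel_measurable borel" for n by (rule borel_measurable_continuous_onI)
    show "\<bar>g n (E z)\<bar> \<le> B + 1" for n z
    proof -
      have "inverse (real (Suc n)) \<le> 1" by (simp add: field_simps)
      then show ?thesis using g(2)[OF E[of z], of n] bspec[OF B E[of z]] by linarith
    qed
  qed
  then show ?thesis by (simp add: E_def)
qed

text \<open>
  The strip is where the Gaussian of \<open>l\<close> is at least \<open>e = exp (- h\<^sup>2 / 16)\<close>.  The indicator of \<open>{e..}\<close> is the limit of
  continuous ramps.
\<close>

lemma orthogonal_to_polynomials_strip:
  assumes l: "real_polynomial_function l" and l_bound: "\<And>z. \<bar>l z\<bar> \<le> cmod z + c" and h: "h \<ge> 0"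
    and f: "orthogonal_to_polynomials f"
  shows "orthogonal_to_polynomials (\<lambda>z. of_real (indicator {z. \<bar>l z\<bar> \<le> h} z) * f z)"
proof -
  define e where "e = exp (- h\<^sup>2 / 16)"
  \<comment> \<open>The ramp is \<open>1\<close> from \<open>e\<close> on and falls to \<open>0\<close> within distance \<open>1/n\<close> to the left of \<open>e\<close>.\<close>
  define r where "r n x = max 0 (min 1 (1 + real n * (x - e)))" for n :: nat and x :: real
  have r_cont: "continuous_on S (r n)" for S n unfolding r_def by (intro continuous_intros)
  show ?thesis
  proof (rule orthogonal_to_polynomials_limit[OF f])
    show "orthogonal_to_polynomials (\<lambda>z. of_real (r n (exp (- (l z)\<^sup>2 / 16))) * f z)" for n
      by (rule orthogonal_to_polynomials_continuous_gaussian[OF l l_bound r_cont f])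
    have "continuous_on UNIV (\<lambda>z. r n (exp (- (l z)\<^sup>2 / 16)))" for n
      by (intro continuous_on_compose2[OF r_cont[of UNIV]] 
          continuous_intros real_polynomial_continuous l) auto
    then show "(\<lambda>z. r n (exp (- (l z)\<^sup>2 / 16))) \<in> borel_measurable borel" for n by (rule borel_measurable_continuous_onI)
    show "\<bar>r n (exp (- (l z)\<^sup>2 / 16))\<bar> \<le> 1" for n z by (simp add: r_def)
    fix z
    let ?x = "exp (- (l z)\<^sup>2 / 16)"
    have iff: "\<bar>l z\<bar> \<le> h \<longleftrightarrow> e \<le> ?x" using h by (simp add: e_def abs_le_square_iff[symmetric])
    show "(\<lambda>n. r n ?x) \<longlonglongrightarrow> indicator {z. \<bar>l z\<bar> \<le> h} z"
    proof (cases "e \<le> ?x")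
      case True
      then have "r n ?x = 1" for n by (simp add: r_def)
      then show ?thesis using True iff by simp
    next
      case False
      then obtain N where N: "1 < real N * (e - ?x)" using reals_Archimedean3[of "e - ?x"] by auto
      have "r n ?x = 0" if "n \<ge> N" for n
      proof -
        have "real N * (e - ?x) \<le> real n * (e - ?x)" using False that by (intro mult_right_mono) auto
        then have "1 + real n * (?x - e) \<le> 0" using N by (simp add: algebra_simps)
        then show ?thesis by (simp add: r_def)
      qed
      then have "(\<lambda>n. r n ?x) \<longlonglongrightarrow> 0"
        by (intro tendsto_eventually) (auto simp: eventually_sequentially)
      then show ?thesis using False iff by simp
    qed
  qed
qed

text \<open>
  A square is the intersection of a vertical and a horizontal strip.
\<close>

lemma orthogonal_to_polynomials_cube:
  assumes f: "orthogonal_to_polynomials f" and h: "h > 0"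
  shows "(LINT z|lebesgue. indicator (cbox x (x + h *\<^sub>R One)) z *\<^sub>R (exp (- (cmod z)\<^sup>2) *\<^sub>R f z)) = 0"
proof -
  have fL2: "f \<in> L2 gauss" using f by (simp add: orthogonal_to_polynomials_def)
  then have [measurable]: "f \<in> borel_measurable lebesgue" by (simp add: L2_def measurable_gauss_iff)
  define l1 where "l1 z = Re z - (Re x + h / 2)" for z
  define l2 where "l2 z = Im z - (Im x + h / 2)" for z
  have l: "real_polynomial_function l1" "real_polynomial_function l2"
    unfolding l1_def l2_def
    by (intro real_polynomial_function_diff real_polynomial_function.intros(2) real_polynomial_function.intros(1)
        bounded_linear_Re bounded_linear_Im)+
  have b1: "\<bar>l1 z\<bar> \<le> cmod z + \<bar>Re x + h / 2\<bar>" for z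
    using abs_Re_le_cmod[of z] by (simp add: l1_def)
  have b2: "\<bar>l2 z\<bar> \<le> cmod z + \<bar>Im x + h / 2\<bar>" for z
    using abs_Im_le_cmod[of z] by (simp add: l2_def)
  have "orthogonal_to_polynomials (\<lambda>z. of_real (indicator {z. \<bar>l1 z\<bar> \<le> h / 2} z) *
      (of_real (indicator {z. \<bar>l2 z\<bar> \<le> h / 2} z) * f z))"
    using h by (intro orthogonal_to_polynomials_strip[OF l(1) b1] orthogonal_to_polynomials_strip[OF l(2) b2] f) auto
  moreover have "of_real (indicator {z. \<bar>l1 z\<bar> \<le> h / 2} z) * (of_real (indicator {z. \<bar>l2 z\<bar> \<le> h / 2} z) * f z)
     = indicator (cbox x (x + h *\<^sub>R One)) z *\<^sub>R f z" for z
    by (auto simp: indicator_def l1_def l2_def in_cbox_complex_iff Basis_complex_def abs_le_iff field_simps)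
  ultimately have "orthogonal_to_polynomials (\<lambda>z. indicator (cbox x (x + h *\<^sub>R One)) z *\<^sub>R f z)"
    by (simp only:)
  then have "L2_inner gauss (\<lambda>z. indicator (cbox x (x + h *\<^sub>R One)) z *\<^sub>R f z) (\<lambda>z. of_real 1) = 0"
    unfolding orthogonal_to_polynomials_def using real_polynomial_function.intros(2) by blast
  then have "(LINT z|gauss. indicator (cbox x (x + h *\<^sub>R One)) z *\<^sub>R f z) = 0"
    by (simp add: L2_inner_def)
  moreover have [measurable]: "cbox x (x + h *\<^sub>R One) \<in> sets lebesgue" by simp
  have "(\<lambda>z. indicator (cbox x (x + h *\<^sub>R One)) z *\<^sub>R f z) \<in> borel_measurable lebesgue" by measurable
  ultimately show ?thesis by (simp add: integral_gauss mult_ac)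
qed

text \<open>
  Lebesgue's differentiation theorem recovers \<open>f exp (- |z|\<^sup>2)\<close> almost everywhere from its means over small squares, all
  of which are zero.
\<close>

theorem orthogonal_to_polynomials_AE_0:
  assumes f: "orthogonal_to_polynomials f"
  shows "AE z in gauss. f z = 0"
proof -
  have fL2: "f \<in> L2 gauss" using f by (simp add: orthogonal_to_polynomials_def)
  then have [measurable]: "f \<in> borel_measurable lebesgue" by (simp add: L2_def measurable_gauss_iff)
  define F where "F z = exp (- (cmod z)\<^sup>2) *\<^sub>R f z" for z
  have "integrable gauss f"
    using L2_integrable_inner[OF fL2 real_polynomial_L2[OF real_polynomial_function.intros(2)[of 1]]] by simp
  then have intF: "integrable lebesgue F" unfolding F_def by (subst (asm) integrable_gauss_iff) auto
  have set_int: "set_integrable lebesgue (cbox a b) F" for a b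
    unfolding set_integrable_def by (intro integrable_mult_indicator intF) simp
  have int: "F integrable_on cbox a b" for a b
    by (rule set_lebesgue_integral_eq_integral(1)[OF set_int])
  have cube: "integral (cbox x (x + h *\<^sub>R One)) F = 0" if "h > 0" for x h
    using set_lebesgue_integral_eq_integral(2)[OF set_int, of x "x + h *\<^sub>R One"]
      orthogonal_to_polynomials_cube[OF f that, of x]
    by (simp add: F_def set_lebesgue_integral_def)
  obtain N where N: "negligible N" "\<And>x e. x \<notin> N \<Longrightarrow> 0 < e \<Longrightarrow>
      \<exists>d>0. \<forall>h. 0 < h \<and> h < d \<longrightarrow> norm (integral (cbox x (x + h *\<^sub>R One)) F /\<^sub>R h ^ DIM(complex) - F x) < e"
    using integrable_ccontinuous_explicit[OF int] by blast
  have "F x = 0" if xN: "x \<notin> N" for x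
  proof (rule ccontr)
    assume "F x \<noteq> 0"
    then obtain d where d: "d > 0" 
      "\<And>h. 0 < h \<Longrightarrow> h < d \<Longrightarrow> norm (integral (cbox x (x + h *\<^sub>R One)) F /\<^sub>R h ^ DIM(complex) - F x) < norm (F x)"
      using N(2)[OF xN, of "norm (F x)"] by auto
    \<comment> \<open>The mean over the square is zero, so the distance of \<open>F x\<close> from it is \<open>norm (F x)\<close> itself.\<close>
    from d(2)[of "d / 2"] d(1) show False by (simp add: cube)
  qed
  then have "AE z in lebesgue. F z = 0"
    using N(1) by (intro AE_I'[of N]) (auto simp: negligible_iff_null_sets)
  then show ?thesis unfolding AE_gauss_iff by (simp add: F_def)
qed

section \<open>The Cauchy-Riemann operator in Hermite coefficients\<close>

definition hermite_norm :: "nat \<Rightarrow> nat \<Rightarrow> real" where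
  "hermite_norm m k = sqrt (fact m * fact k * gauss_mass)"

lemma hermite_norm_pos: "hermite_norm m k > 0"
  by (simp add: hermite_norm_def gauss_mass_pos)

lemma hermite_norm_square: "(hermite_norm m k)\<^sup>2 = fact m * fact k * gauss_mass"
  using gauss_mass_pos by (simp add: hermite_norm_def)

lemma hermite_norm_Suc: "hermite_norm m (Suc k) = sqrt (real (Suc k)) * hermite_norm m k"
  by (simp add: hermite_norm_def real_sqrt_mult[symmetric] mult_ac del: of_nat_Suc)

definition hermite_basis :: "nat \<times> nat \<Rightarrow> complex \<Rightarrow> complex" where
  "hermite_basis = (\<lambda>(m, k) z. of_real (inverse (hermite_norm m k)) * hermite m k z)"

text \<open>
  From here on, statements about the orthonormal basis are translated into inner products with the unnormalised
  polynomials, for which the ladder relations hold without square roots.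
\<close>

lemma inner_hermite_basis:
  "L2_inner gauss f (hermite_basis (m, k)) = L2_inner gauss f (hermite m k) / of_real (hermite_norm m k)"
  unfolding hermite_basis_def prod.case L2_inner_scale_right by (simp add: divide_inverse mult.commute)

lemma inner_hermite_basis_left:
  "L2_inner gauss (hermite_basis (m, k)) g = L2_inner gauss (hermite m k) g / of_real (hermite_norm m k)"
  unfolding hermite_basis_def prod.case L2_inner_scale_left by (simp add: divide_inverse mult.commute)

interpretation hermite: orthonormal_basis gauss hermite_basis
proof
  show "hermite_basis i \<in> L2 gauss" for i
    by (cases i) (simp add: hermite_basis_def L2_scale hermite_L2)
  show "L2_inner gauss (hermite_basis i) (hermite_basis j) = (if i = j then 1 else 0)" for i j
  proof (cases i; cases j)
    fix m k m' k' assume ij: "i = (m, k)" "j = (m', k')"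
    have "L2_inner gauss (hermite_basis i) (hermite_basis j) =
        L2_inner gauss (hermite m k) (hermite m' k') / of_real (hermite_norm m k * hermite_norm m' k')"
      unfolding ij inner_hermite_basis inner_hermite_basis_left by (simp add: mult.commute)
    also have "\<dots> = (if i = j then 1 else 0)"
    proof (cases "i = j")
      case True
      have "of_real (hermite_norm m k * hermite_norm m k) = (of_real (fact m * fact k * gauss_mass) :: complex)"
        by (simp only: hermite_norm_square[symmetric] power2_eq_square)
      moreover have "(of_real (fact m * fact k * gauss_mass) :: complex) \<noteq> 0"
        using gauss_mass_pos by simp
      ultimately show ?thesis using True ij by (simp add: hermite_inner)
    qed (use ij in \<open>auto simp: hermite_inner\<close>)
    finally show ?thesis .
  qed
  show "AE z in gauss. f z = 0" if "f \<in> L2 gauss" "\<And>i. L2_inner gauss f (hermite_basis i) = 0" for f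
  proof (rule orthogonal_to_polynomials_AE_0[OF orthogonal_to_hermite_imp_polynomials[OF that(1)]])
    fix m k
    show "L2_inner gauss f (hermite m k) = 0"
      using that(2)[of "(m, k)"] hermite_norm_pos[of m k] by (simp add: inner_hermite_basis)
  qed
qed

lemma hermite_Parseval:
  assumes "f \<in> L2 gauss" "g \<in> L2 gauss"
  shows "((\<lambda>(m, k). L2_inner gauss f (hermite m k) * L2_inner gauss (hermite m k) g
      / of_real (fact m * fact k * gauss_mass)) has_sum L2_inner gauss f g) UNIV"
proof -
  have "L2_inner gauss f (hermite_basis (m, k)) * L2_inner gauss (hermite_basis (m, k)) g
     = L2_inner gauss f (hermite m k) * L2_inner gauss (hermite m k) g / of_real (fact m * fact k * gauss_mass)" for m k
    unfolding inner_hermite_basis inner_hermite_basis_left hermite_norm_square[symmetric]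
    by (simp add: power2_eq_square)
  then have "(\<lambda>i. L2_inner gauss f (hermite_basis i) * L2_inner gauss (hermite_basis i) g) =
     (\<lambda>(m, k). L2_inner gauss f (hermite m k) * L2_inner gauss (hermite m k) g / of_real (fact m * fact k * gauss_mass))"
    by (simp add: fun_eq_iff)
  then show ?thesis using hermite.Parseval[OF assms] by (simp only:)
qed

definition shift :: "nat \<times> nat \<Rightarrow> nat \<times> nat" where
  "shift = (\<lambda>(m, k). (m, Suc k))"

lemma inj_shift: "inj shift"
  by (auto simp: inj_def shift_def)

lemma not_in_range_shift: "i \<notin> range shift \<Longrightarrow> snd i = 0"
  by (cases i; cases "snd i") (auto simp: shift_def image_iff)

text \<open>
  The hypotheses say in terms of coefficients that \<open>v = D u\<close> and \<open>h = D* g\<close>.  By Parseval's identity both sides are sums over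
  \<open>(m, k)\<close>.  Those on the right vanish for \<open>k = 0\<close> and become those on the left when \<open>k\<close> is shifted by one, since the squares of the
  norms satisfy \<open>|h\<^sub>m\<^sub>,\<^sub>k\<^sub>+\<^sub>1|\<^sup>2 = (k + 1) |h\<^sub>m\<^sub>,\<^sub>k|\<^sup>2\<close>.
\<close>

lemma ladder_pairing:
  assumes L2: "u \<in> L2 gauss" "v \<in> L2 gauss" "g \<in> L2 gauss" "h \<in> L2 gauss"
    and uv: "\<And>m k. L2_inner gauss v (hermite m k) = L2_inner gauss u (hermite m (Suc k))"
    and gh: "\<And>m k. L2_inner gauss h (hermite m k) = of_nat k * L2_inner gauss g (hermite m (k - 1))"
  shows "L2_inner gauss v g = L2_inner gauss u h"
proof -
  define t where "t = (\<lambda>(m, k). L2_inner gauss v (hermite m k) * L2_inner gauss (hermite m k) g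
      / of_real (fact m * fact k * gauss_mass))"
  define s where "s = (\<lambda>(m, k). L2_inner gauss u (hermite m k) * L2_inner gauss (hermite m k) h
      / of_real (fact m * fact k * gauss_mass))"
  have hg: "L2_inner gauss (hermite m k) h = of_nat k * L2_inner gauss (hermite m (k - 1)) g" for m k
  proof -
    have "L2_inner gauss (hermite m k) h = cnj (L2_inner gauss h (hermite m k))" by (rule L2_inner_commute)
    also have "\<dots> = of_nat k * cnj (L2_inner gauss g (hermite m (k - 1)))" unfolding gh by simp
    also have "cnj (L2_inner gauss g (hermite m (k - 1))) = L2_inner gauss (hermite m (k - 1)) g"
      by (rule L2_inner_commute[symmetric])
    finally show ?thesis .
  qed
  have st: "s \<circ> shift = t"
  proof
    fix i :: "nat \<times> nat"
    obtain m k where i: "i = (m, k)" by (cases i)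
    have "of_nat (Suc k) * of_real (fact m * fact k * gauss_mass) = (of_real (fact m * fact (Suc k) * gauss_mass) :: complex)"
      by (simp add: algebra_simps)
    moreover have "(of_nat (Suc k) :: complex) \<noteq> 0" by (rule of_nat_neq_0)
    ultimately show "(s \<circ> shift) i = t i"
      by (simp add: i s_def t_def shift_def hg uv divide_simps del: of_nat_Suc fact_Suc)
        (simp add: mult_ac)
  qed
  have "(t has_sum L2_inner gauss v g) UNIV"
    unfolding t_def by (rule hermite_Parseval) (rule L2)+
  then have "(s has_sum L2_inner gauss v g) (range shift)"
    unfolding st[symmetric] by (simp add: has_sum_reindex inj_shift)
  moreover have "s i = 0" if "i \<notin> range shift" for i
    using not_in_range_shift[OF that] by (cases i) (simp add: s_def hg)
  then have "(s has_sum L2_inner gauss v g) (range shift) \<longleftrightarrow> (s has_sum L2_inner gauss v g) UNIV"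
    by (intro has_sum_cong_neutral) auto
  ultimately have "(s has_sum L2_inner gauss v g) UNIV" by blast
  moreover have "(s has_sum L2_inner gauss u h) UNIV"
    unfolding s_def by (rule hermite_Parseval) (rule L2)+
  ultimately show ?thesis by (rule has_sum_unique)
qed

lemma compact_support_L2:
  assumes cont: "continuous_on UNIV f" and supp: "\<And>z. cmod z > R \<Longrightarrow> f z = 0"
  shows "f \<in> L2 gauss"
proof -
  have "bounded (f ` cball 0 R)"
    by (intro compact_imp_bounded compact_continuous_image continuous_on_subset[OF cont]) auto
  then obtain B where B: "\<forall>z\<in>cball 0 R. cmod (f z) \<le> B" unfolding bounded_iff by auto
  have "cmod (f z) \<le> \<bar>B\<bar> * (1 + cmod z) ^ 0" for z
    using bspec[OF B, of z] supp[of z] by (cases "cmod z \<le> R") auto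
  then show ?thesis by (intro L2_gauss_poly_growth[OF cont] poly_growthI)
qed

text \<open>
  For the converse, the weak derivative tested against \<open>\<psi>\<close> is an instance of \<open>ladder_pairing\<close> with
  \<open>g = exp (|z|\<^sup>2) cnj \<psi>\<close> and \<open>h = D* g\<close>.  The coefficients of this \<open>h\<close> are known because the polynomials themselves
  have weak derivatives.
\<close>

theorem dbar_iff_coeff:
  "(u, v) \<in> gauss_dbar \<longleftrightarrow> u \<in> L2 gauss \<and> v \<in> L2 gauss \<and>
    (\<forall>m k. L2_inner gauss v (hermite m k) = L2_inner gauss u (hermite m (Suc k)))"
proof
  assume "(u, v) \<in> gauss_dbar"
  then show "u \<in> L2 gauss \<and> v \<in> L2 gauss \<and>
    (\<forall>m k. L2_inner gauss v (hermite m k) = L2_inner gauss u (hermite m (Suc k)))"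
    using dbar_hermite_coeff by (auto simp: dbar_def)
next
  assume *: "u \<in> L2 gauss \<and> v \<in> L2 gauss \<and>
    (\<forall>m k. L2_inner gauss v (hermite m k) = L2_inner gauss u (hermite m (Suc k)))"
  then have u: "u \<in> L2 gauss" and v: "v \<in> L2 gauss" by auto
  have "(LINT z|lebesgue. u z * d_zbar \<psi> z) = - (LINT z|lebesgue. v z * \<psi> z)" if \<psi>: "test_function \<psi>" for \<psi>
  proof -
    have smooth: "times_cont_diff (Suc 0) \<psi>" and comp: "compact (closure {z. \<psi> z \<noteq> 0})"
      using \<psi> by (auto simp: test_function_def simp del: times_cont_diff.simps)
    obtain D where D: "\<And>z. (\<psi> has_derivative D z) (at z)"
      "continuous_on UNIV (\<lambda>z. D z 1)" "continuous_on UNIV (\<lambda>z. D z \<i>)"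
      using times_cont_diff_SucE[OF smooth] by auto
    obtain R where R: "\<And>z. \<psi> z \<noteq> 0 \<Longrightarrow> norm z \<le> R"
      using bounded_subset[OF compact_imp_bounded[OF comp] closure_subset] by (auto simp: bounded_iff)
    then have supp: "\<psi> z = 0" if "norm z > R" for z using that by force
    have D0: "D z = (\<lambda>h. 0)" if z: "norm z > R" for z
      by (rule derivative_outside_support[OF D(1) supp z])
    have cont\<psi>: "continuous_on UNIV \<psi>"
      using D(1) by (meson continuous_at_imp_continuous_on has_derivative_continuous)
    have dz: "d_zbar \<psi> z = (D z 1 + \<i> * D z \<i>) / 2" for z
      by (simp add: d_zbar_def frechet_derivative_eq[OF D(1)])
    have contdz: "continuous_on UNIV (d_zbar \<psi>)"
      unfolding dz[abs_def] by (intro continuous_intros D) auto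
    \<comment> \<open>The factor \<open>exp (|z|\<^sup>2)\<close> cancels the weight: inner products with \<open>g\<close> and \<open>h\<close> are unweighted integrals against \<open>\<psi>\<close> and its derivative.\<close>
    define g where "g z = of_real (exp ((cmod z)\<^sup>2)) * cnj (\<psi> z)" for z
    define h where "h z = of_real (exp ((cmod z)\<^sup>2)) * - cnj (d_zbar \<psi> z)" for z
    have "continuous_on UNIV g" "continuous_on UNIV h"
      unfolding g_def h_def by (intro continuous_intros cont\<psi> contdz)+
    then have g: "g \<in> L2 gauss" and h: "h \<in> L2 gauss"
      using supp D0 by (auto intro!: compact_support_L2[of _ R] simp: g_def h_def dz)
    have weight: "exp (- (cmod z)\<^sup>2) *\<^sub>R (f z * cnj (of_real (exp ((cmod z)\<^sup>2)) * w)) = f z * cnj w" for f z w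
      by (simp add: scaleR_conv_of_real exp_minus field_simps)
    have inner_g: "L2_inner gauss f g = (LINT z|lebesgue. f z * \<psi> z)" if "f \<in> L2 gauss" for f
    proof -
      have "L2_inner gauss f g = (LINT z|lebesgue. exp (- (cmod z)\<^sup>2) *\<^sub>R (f z * cnj (g z)))"
        unfolding L2_inner_def
        using L2_integrable_inner[OF that g] by (intro integral_gauss) (simp add: measurable_gauss_iff[symmetric])
      then show ?thesis unfolding g_def weight by simp
    qed
    have inner_h: "L2_inner gauss f h = - (LINT z|lebesgue. f z * d_zbar \<psi> z)" if "f \<in> L2 gauss" for f
    proof -
      have "L2_inner gauss f h = (LINT z|lebesgue. exp (- (cmod z)\<^sup>2) *\<^sub>R (f z * cnj (h z)))"
        unfolding L2_inner_def
        using L2_integrable_inner[OF that h] by (intro integral_gauss) (simp add: measurable_gauss_iff[symmetric])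
      then show ?thesis unfolding h_def weight by simp
    qed
    have "L2_inner gauss h (hermite m k) = of_nat k * L2_inner gauss g (hermite m (k - 1))" for m k
    proof -
      have "weak_d_zbar (hermite m k) (\<lambda>z. of_nat k * hermite m (k - 1) z)"
        using dbar_hermite[of m k] by (simp add: dbar_def)
      then have "L2_inner gauss (hermite m k) h = L2_inner gauss (\<lambda>z. of_nat k * hermite m (k - 1) z) g"
        using \<psi> by (simp add: inner_h inner_g hermite_L2 L2_scale weak_d_zbar_def)
      then have *: "L2_inner gauss (hermite m k) h = of_nat k * L2_inner gauss (hermite m (k - 1)) g"
        by (simp add: L2_inner_scale_left)
      have "L2_inner gauss h (hermite m k) = cnj (L2_inner gauss (hermite m k) h)" by (rule L2_inner_commute)
      also have "\<dots> = of_nat k * cnj (L2_inner gauss (hermite m (k - 1)) g)" unfolding * by simp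
      also have "cnj (L2_inner gauss (hermite m (k - 1)) g) = L2_inner gauss g (hermite m (k - 1))"
        by (rule L2_inner_commute[symmetric])
      finally show ?thesis .
    qed
    then have "L2_inner gauss v g = L2_inner gauss u h"
      using * by (intro ladder_pairing[OF u v g h]) blast+
    then show ?thesis by (simp add: inner_g inner_h u v)
  qed
  then show "(u, v) \<in> gauss_dbar"
    using u v by (simp add: dbar_def weak_d_zbar_def L2_gauss_locally_integrable)
qed

abbreviation gauss_dbar_adjoint :: "complex L2_operator" where
  "gauss_dbar_adjoint \<equiv> dbar_adjoint (\<lambda>z. (cmod z)\<^sup>2)"

text \<open>
  The defining property of the adjoint, tested on polynomials, gives the coefficients; \<open>ladder_pairing\<close> gives the converse.
\<close>

theorem dbar_adjoint_iff_coeff: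
  "(g, h) \<in> gauss_dbar_adjoint \<longleftrightarrow> g \<in> L2 gauss \<and> h \<in> L2 gauss \<and>
    (\<forall>m k. L2_inner gauss h (hermite m k) = of_nat k * L2_inner gauss g (hermite m (k - 1)))"
proof
  assume gh: "(g, h) \<in> gauss_dbar_adjoint"
  have "L2_inner gauss h (hermite m k) = of_nat k * L2_inner gauss g (hermite m (k - 1))" for m k
  proof -
    have *: "L2_inner gauss (\<lambda>z. of_nat k * hermite m (k - 1) z) g = L2_inner gauss (hermite m k) h"
      using gh dbar_hermite[of m k] by (auto simp: dbar_adjoint_def L2_adjoint_def)
    have "L2_inner gauss h (hermite m k) = cnj (L2_inner gauss (hermite m k) h)" by (rule L2_inner_commute)
    also have "\<dots> = of_nat k * cnj (L2_inner gauss (hermite m (k - 1)) g)"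
      unfolding *[symmetric] L2_inner_scale_left by simp
    also have "cnj (L2_inner gauss (hermite m (k - 1)) g) = L2_inner gauss g (hermite m (k - 1))"
      by (rule L2_inner_commute[symmetric])
    finally show ?thesis .
  qed
  then show "g \<in> L2 gauss \<and> h \<in> L2 gauss \<and>
    (\<forall>m k. L2_inner gauss h (hermite m k) = of_nat k * L2_inner gauss g (hermite m (k - 1)))"
    using gh by (auto simp: dbar_adjoint_def L2_adjoint_def)
next
  assume *: "g \<in> L2 gauss \<and> h \<in> L2 gauss \<and>
    (\<forall>m k. L2_inner gauss h (hermite m k) = of_nat k * L2_inner gauss g (hermite m (k - 1)))"
  then have g: "g \<in> L2 gauss" and h: "h \<in> L2 gauss" by auto
  have "L2_inner gauss v g = L2_inner gauss u h" if "(u, v) \<in> gauss_dbar" for u v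
  proof -
    have u: "u \<in> L2 gauss" and v: "v \<in> L2 gauss"
      and uv: "\<And>m k. L2_inner gauss v (hermite m k) = L2_inner gauss u (hermite m (Suc k))"
      using that unfolding dbar_iff_coeff by auto
    show ?thesis by (rule ladder_pairing[OF u v g h uv]) (use * in blast)
  qed
  then show "(g, h) \<in> gauss_dbar_adjoint"
    using g h by (auto simp: dbar_adjoint_def L2_adjoint_def)
qed

lemma diagonal_hermite_iff:
  "(u, w) \<in> hermite.diagonal_operator l \<longleftrightarrow> u \<in> L2 gauss \<and> w \<in> L2 gauss \<and>
    (\<forall>m k. L2_inner gauss w (hermite m k) = l (m, k) * L2_inner gauss u (hermite m k))"
proof -
  have "L2_inner gauss w (hermite_basis (m, k)) = l (m, k) * L2_inner gauss u (hermite_basis (m, k)) \<longleftrightarrow>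
      L2_inner gauss w (hermite m k) = l (m, k) * L2_inner gauss u (hermite m k)" for m k
    using hermite_norm_pos[of m k] unfolding inner_hermite_basis by simp
  then show ?thesis unfolding hermite.diagonal_operator_def by simp
qed

section \<open>The complex Laplacians\<close>

text \<open>
  If both \<open>u\<^sub>i\<close> and \<open>n\<^sub>i u\<^sub>i\<close> are square-summable, then so is \<open>sqrt n\<^sub>i u\<^sub>i\<close>: the domain of the Laplacian is contained in
  the domain of its quadratic form.
\<close>

lemma sqrt_weight_bound:
  assumes "w = of_nat n * u"
  shows "(cmod (of_real (sqrt (real n)) * u))\<^sup>2 \<le> (cmod u)\<^sup>2 + (cmod w)\<^sup>2"
proof -
  have "real n * (cmod u)\<^sup>2 \<le> (1 + (real n)\<^sup>2) * (cmod u)\<^sup>2"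
  proof (rule mult_right_mono)
    have "0 \<le> (real n - 1)\<^sup>2" by simp
    then have "2 * real n \<le> 1 + (real n)\<^sup>2" by (simp add: power2_diff)
    then show "real n \<le> 1 + (real n)\<^sup>2" by linarith
  qed simp
  then show ?thesis using assms by (simp add: norm_mult power_mult_distrib ring_distribs)
qed

lemma hermite_coeff_square_summable:
  assumes "u \<in> L2 gauss" "w \<in> L2 gauss"
  shows "(\<lambda>i. (cmod (L2_inner gauss u (hermite_basis i)))\<^sup>2 + (cmod (L2_inner gauss w (hermite_basis i)))\<^sup>2)
    summable_on A"
  by (rule summable_on_subset_banach[of _ UNIV])
    (intro summable_on_add hermite.coeff_square_summable assms, simp)

text \<open>
  A diagonal pair \<open>(u, w)\<close> needs an intermediate \<open>v\<close>, whose coefficients must be those of \<open>u\<close> shifted down by one.  In the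
  orthonormal basis these are \<open>sqrt (k + 1) u\<^sub>m\<^sub>,\<^sub>k\<^sub>+\<^sub>1\<close>.
\<close>

theorem box0_diagonal:
  "box0 (\<lambda>z. (cmod z)\<^sup>2) = hermite.diagonal_operator (\<lambda>(m, k). of_nat k)"
proof (intro set_eqI, unfold split_paired_all, rule iffI)
  fix u w
  assume "(u, w) \<in> box0 (\<lambda>z. (cmod z)\<^sup>2)"
  then obtain v where v: "(u, v) \<in> gauss_dbar" "(v, w) \<in> gauss_dbar_adjoint"
    by (auto simp: box0_def)
  have "L2_inner gauss w (hermite m k) = of_nat k * L2_inner gauss u (hermite m k)" for m k
    using v unfolding dbar_iff_coeff dbar_adjoint_iff_coeff by (cases k) auto
  then show "(u, w) \<in> hermite.diagonal_operator (\<lambda>(m, k). of_nat k)"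
    using v unfolding dbar_iff_coeff dbar_adjoint_iff_coeff diagonal_hermite_iff by auto
next
  fix u w
  assume "(u, w) \<in> hermite.diagonal_operator (\<lambda>(m, k). of_nat k)"
  then have u: "u \<in> L2 gauss" and w: "w \<in> L2 gauss"
    and uw: "\<And>m k. L2_inner gauss w (hermite m k) = of_nat k * L2_inner gauss u (hermite m k)"
    unfolding diagonal_hermite_iff by auto
  define F where "F i = (cmod (L2_inner gauss u (hermite_basis i)))\<^sup>2 + (cmod (L2_inner gauss w (hermite_basis i)))\<^sup>2" for i
  define c where "c = (\<lambda>(m, k). L2_inner gauss u (hermite m (Suc k)) / of_real (hermite_norm m k))"
  have c_bound: "(cmod (c i))\<^sup>2 \<le> (F \<circ> shift) i" for i
  proof -
    obtain m k where i: "i = (m, k)" by (cases i)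
    have "c i = of_real (sqrt (real (Suc k))) * L2_inner gauss u (hermite_basis (m, Suc k))"
      using hermite_norm_pos[of m k]
      by (simp add: c_def i inner_hermite_basis hermite_norm_Suc del: of_nat_Suc)
    moreover have "L2_inner gauss w (hermite_basis (m, Suc k)) = of_nat (Suc k) * L2_inner gauss u (hermite_basis (m, Suc k))"
      unfolding inner_hermite_basis uw by simp
    ultimately show ?thesis using sqrt_weight_bound by (simp add: F_def i shift_def del: of_nat_Suc)
  qed
  have "F summable_on range shift"
    unfolding F_def by (rule hermite_coeff_square_summable[OF u w])
  then have "(F \<circ> shift) summable_on UNIV" by (simp add: summable_on_reindex inj_shift)
  then have "(\<lambda>i. (cmod (c i))\<^sup>2) summable_on UNIV"
    by (rule summable_on_comparison_test) (rule c_bound, simp)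
  then obtain v where v: "v \<in> L2 gauss" "\<And>i. L2_inner gauss v (hermite_basis i) = c i"
    using hermite.Riesz_Fischer by blast
  have v_coeff: "L2_inner gauss v (hermite m k) = L2_inner gauss u (hermite m (Suc k))" for m k
    using v(2)[of "(m, k)"] hermite_norm_pos[of m k] by (simp add: c_def inner_hermite_basis)
  have "(u, v) \<in> gauss_dbar" unfolding dbar_iff_coeff using u v v_coeff by auto
  moreover have "(v, w) \<in> gauss_dbar_adjoint"
    unfolding dbar_adjoint_iff_coeff
  proof (intro conjI allI v w)
    fix m k
    show "L2_inner gauss w (hermite m k) = of_nat k * L2_inner gauss v (hermite m (k - 1))"
      by (cases k) (simp_all add: uw v_coeff)
  qed
  ultimately show "(u, w) \<in> box0 (\<lambda>z. (cmod z)\<^sup>2)" by (auto simp: box0_def)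
qed

text \<open>
  As for \<open>box0_diagonal\<close>, with an intermediate \<open>h\<close> whose coefficients are those of \<open>g\<close> shifted up by one: in the orthonormal basis,
  \<open>sqrt k g\<^sub>m\<^sub>,\<^sub>k\<^sub>-\<^sub>1\<close>, and zero for \<open>k = 0\<close>.
\<close>

theorem box1_diagonal:
  "box1 (\<lambda>z. (cmod z)\<^sup>2) = hermite.diagonal_operator (\<lambda>(m, k). of_nat (Suc k))"
proof (intro set_eqI, unfold split_paired_all, rule iffI)
  fix g w
  assume "(g, w) \<in> box1 (\<lambda>z. (cmod z)\<^sup>2)"
  then obtain h where h: "(g, h) \<in> gauss_dbar_adjoint" "(h, w) \<in> gauss_dbar"
    by (auto simp: box1_def)
  have "L2_inner gauss w (hermite m k) = of_nat (Suc k) * L2_inner gauss g (hermite m k)" for m k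
    using h unfolding dbar_iff_coeff dbar_adjoint_iff_coeff by simp
  then show "(g, w) \<in> hermite.diagonal_operator (\<lambda>(m, k). of_nat (Suc k))"
    using h unfolding dbar_iff_coeff dbar_adjoint_iff_coeff diagonal_hermite_iff by auto
next
  fix g w
  assume "(g, w) \<in> hermite.diagonal_operator (\<lambda>(m, k). of_nat (Suc k))"
  then have g: "g \<in> L2 gauss" and w: "w \<in> L2 gauss"
    and gw: "\<And>m k. L2_inner gauss w (hermite m k) = of_nat (Suc k) * L2_inner gauss g (hermite m k)"
    unfolding diagonal_hermite_iff by auto
  define F where "F i = (cmod (L2_inner gauss g (hermite_basis i)))\<^sup>2 + (cmod (L2_inner gauss w (hermite_basis i)))\<^sup>2" for i
  define c where "c = (\<lambda>(m, k). of_nat k * L2_inner gauss g (hermite m (k - 1)) / of_real (hermite_norm m k))"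
  have c_bound: "(cmod ((c \<circ> shift) i))\<^sup>2 \<le> F i" for i
  proof -
    obtain m k where i: "i = (m, k)" by (cases i)
    have "of_nat (Suc k) = (of_real (sqrt (real (Suc k))) * of_real (sqrt (real (Suc k))) :: complex)"
      by (simp only: of_real_mult[symmetric] real_sqrt_mult_self abs_of_nat of_real_of_nat_eq)
    then have "(c \<circ> shift) i = of_real (sqrt (real (Suc k))) * L2_inner gauss g (hermite_basis (m, k))"
      by (simp add: c_def i shift_def inner_hermite_basis hermite_norm_Suc del: of_nat_Suc)
    moreover have "L2_inner gauss w (hermite_basis (m, k)) = of_nat (Suc k) * L2_inner gauss g (hermite_basis (m, k))"
      unfolding inner_hermite_basis gw by simp
    ultimately show ?thesis using sqrt_weight_bound by (simp add: F_def i del: of_nat_Suc)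
  qed
  have "F summable_on UNIV"
    unfolding F_def by (rule hermite_coeff_square_summable[OF g w])
  then have "(\<lambda>i. (cmod ((c \<circ> shift) i))\<^sup>2) summable_on UNIV"
    by (rule summable_on_comparison_test) (rule c_bound, simp)
  then have "((\<lambda>i. (cmod (c i))\<^sup>2) \<circ> shift) summable_on UNIV" by (simp add: o_def)
  then have "(\<lambda>i. (cmod (c i))\<^sup>2) summable_on range shift" by (simp add: summable_on_reindex inj_shift)
  moreover have "c i = 0" if "i \<notin> range shift" for i
    using not_in_range_shift[OF that] by (cases i) (simp add: c_def)
  then have "(\<lambda>i. (cmod (c i))\<^sup>2) summable_on range shift \<longleftrightarrow> (\<lambda>i. (cmod (c i))\<^sup>2) summable_on UNIV"
    by (intro summable_on_cong_neutral) auto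
  ultimately have "(\<lambda>i. (cmod (c i))\<^sup>2) summable_on UNIV" by blast
  then obtain h where h: "h \<in> L2 gauss" "\<And>i. L2_inner gauss h (hermite_basis i) = c i"
    using hermite.Riesz_Fischer by blast
  have h_coeff: "L2_inner gauss h (hermite m k) = of_nat k * L2_inner gauss g (hermite m (k - 1))" for m k
    using h(2)[of "(m, k)"] hermite_norm_pos[of m k] by (simp add: c_def inner_hermite_basis)
  have "(g, h) \<in> gauss_dbar_adjoint" unfolding dbar_adjoint_iff_coeff using g h h_coeff by auto
  moreover have "(h, w) \<in> gauss_dbar"
    unfolding dbar_iff_coeff using h(1) w by (auto simp: h_coeff gw)
  ultimately show "(g, w) \<in> box1 (\<lambda>z. (cmod z)\<^sup>2)" by (auto simp: box1_def)
qed

lemma infinite_hermite_fibre: "infinite {i. (case i of (m :: nat, k) \<Rightarrow> of_nat (f k)) = (of_nat (f k) :: complex)}"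
proof -
  have "infinite (range (\<lambda>m :: nat. (m, k)))" by (rule range_inj_infinite) (auto simp: inj_def)
  then show ?thesis by (rule infinite_super[rotated]) auto
qed

lemma closure_hermite_eigenvalues:
  "closure (range (\<lambda>(m :: nat, k :: nat). of_nat (f k) :: complex)) = {of_nat (f k) | k. True}"
proof -
  have "range (\<lambda>(m :: nat, k :: nat). of_nat (f k) :: complex) = of_nat ` range f" by (auto simp: image_iff)
  then show ?thesis using closed_of_nat_image[of "range f", where 'a = complex] by auto
qed

theorem theorem2p3:
  fixes \<phi> :: "complex \<Rightarrow> real" and M :: "complex measure"
  assumes "\<phi> = (\<lambda>z. (cmod z)\<^sup>2)"
    and "M = weighted_measure \<phi>"
  shows "spectrum M (box0 \<phi>) = {of_nat k | k :: nat. True} \<and>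
    (\<forall>k :: nat. is_eigenvalue M (box0 \<phi>) (of_nat k) \<and>
       eigenvalue_multiplicity M (box0 \<phi>) (of_nat k) = \<infinity>) \<and>
    (0 \<in> essential_spectrum M (box0 \<phi>) \<and>
       (\<forall>z \<in> essential_spectrum M (box0 \<phi>). \<exists>r \<ge> 0. z = complex_of_real r)) \<and>
    spectrum M (box1 \<phi>) = {of_nat k | k :: nat. k \<ge> 1} \<and>
    (\<forall>k :: nat. k \<ge> 1 \<longrightarrow> is_eigenvalue M (box1 \<phi>) (of_nat k) \<and>
       eigenvalue_multiplicity M (box1 \<phi>) (of_nat k) = \<infinity>)"
proof -
  have M: "M = gauss" and box0: "box0 \<phi> = hermite.diagonal_operator (\<lambda>(m, k). of_nat k)"
    and box1: "box1 \<phi> = hermite.diagonal_operator (\<lambda>(m, k). of_nat (Suc k))"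
    using assms box0_diagonal box1_diagonal by auto
  have spec0: "spectrum M (box0 \<phi>) = {of_nat k | k :: nat. True}"
    unfolding M box0 hermite.spectrum_diagonal by (rule closure_hermite_eigenvalues[of "\<lambda>k. k"])
  have mult0: "eigenvalue_multiplicity M (box0 \<phi>) (of_nat k) = \<infinity>" for k
    unfolding M box0 by (rule hermite.eigenvalue_multiplicity_diagonal[OF infinite_hermite_fibre[of "\<lambda>k. k"]])
  have eig0: "is_eigenvalue M (box0 \<phi>) (of_nat k)" for k
    unfolding M box0 using hermite.is_eigenvalue_diagonal[of "\<lambda>(m, k). of_nat k" "(0, k)"] by simp
  have "spectrum M (box1 \<phi>) = {of_nat (Suc k) | k. True}"
    unfolding M box1 hermite.spectrum_diagonal by (rule closure_hermite_eigenvalues[of Suc])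
  also have "\<dots> = {of_nat k | k :: nat. k \<ge> 1}"
    by (auto simp del: of_nat_Suc) (metis Suc_le_D One_nat_def)
  finally have spec1: "spectrum M (box1 \<phi>) = {of_nat k | k :: nat. k \<ge> 1}" .
  have mult1: "eigenvalue_multiplicity M (box1 \<phi>) (of_nat (Suc k)) = \<infinity>" for k
    unfolding M box1 by (rule hermite.eigenvalue_multiplicity_diagonal[OF infinite_hermite_fibre[of Suc]])
  have eig1: "is_eigenvalue M (box1 \<phi>) (of_nat (Suc k))" for k
    unfolding M box1 using hermite.is_eigenvalue_diagonal[of "\<lambda>(m, k). of_nat (Suc k)" "(0, k)"] by simp
  have "0 \<in> spectrum M (box0 \<phi>)" unfolding spec0 by (auto intro: exI[of _ 0])
  moreover have "0 \<notin> discrete_spectrum M (box0 \<phi>)"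
    using mult0[of 0] by (simp add: discrete_spectrum_def)
  ultimately have ess0: "0 \<in> essential_spectrum M (box0 \<phi>)" by (simp add: essential_spectrum_def)
  have ess: "\<exists>r\<ge>0. z = complex_of_real r" if "z \<in> essential_spectrum M (box0 \<phi>)" for z
  proof -
    have "z \<in> spectrum M (box0 \<phi>)" using that by (simp add: essential_spectrum_def)
    then obtain k :: nat where "z = of_nat k" unfolding spec0 by blast
    then show ?thesis by (intro exI[of _ "real k"]) simp
  qed
  have eig1': "is_eigenvalue M (box1 \<phi>) (of_nat k)" if "k \<ge> 1" for k
    using eig1[of "k - 1"] that by simp
  have mult1': "eigenvalue_multiplicity M (box1 \<phi>) (of_nat k) = \<infinity>" if "k \<ge> 1" for k
    using mult1[of "k - 1"] that by simp
  show ?thesis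
    by (intro conjI allI impI ballI spec0 eig0 mult0 ess0 ess spec1 eig1' mult1')
qed

end
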